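(* The synthesis problem for flat, non-strict global window $L$-PCTL formulae is in $\mathsf{coRE}$: the set of pairs $(M,\forall G\,\Phi)$, with $M$ a finite MDP and $\forall G\,\Phi$ a global window formula where $\Phi$ is flat and non-strict, for which there exists a strategy $\sigma$ with $M[\sigma]\models\forall G\,\Phi$, has a recursively enumerable complement.
   Context: A Markov chain (MC) is a tuple $(S,s_{\mathrm{init}},P,AP,L)$ with $S$ a countable set of states, $s_{\mathrm{init}}\in S$, $P:S\to\mathrm{Dist}(S)$, $AP$ a nonempty finite set of atomic propositions, $L:S\to 2^{AP}$; it induces the standard probability measure $\mu$ on infinite paths from each state. A Markov decision process (MDP) is $M=(S,A,s_{\mathrm{init}},P,AP,L)$ with $S$ finite, $A$ a finite set of actions, $P:S\times A\to\mathrm{Dist}(S)$ with rational probabilities in binary (every action available in every state). A finite path is $s_0a_0s_1\cdots s_i$ with $P(s_j,a_j,s_{j+1})>0$. A strategy $\sigma$ maps finite paths to distributions over $A$ (randomisation and unbounded memory allowed). $M[\sigma]$ is the MC whose states are finite paths of $M$, initial state $s_{\mathrm{init}}$, transitions $\rho\to\rho a s$ with probability $\sigma(\rho)(a)P(\mathrm{last}(\rho),a,s)$, labels $L(\mathrm{last}(\rho))$. $L$-PCTL: state formulae $\Phi::=p\mid\neg p\mid\Phi_1\wedge\Phi_2\mid\Phi_1\vee\Phi_2\mid\sum_{i=1}^n c_i\mathbb P(\varphi_i)\succcurlyeq c_0$ with $p\in AP$, $n\ge1$, $c_i\in\mathbb Z$, ${\succcurlyeq}\in\{\ge,>\}$;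 path formulae $\varphi::=X^\ell\Phi\mid\Phi_1U^\ell\Phi_2\mid\Phi_1W^\ell\Phi_2\mid\Phi_1U^\infty\Phi_2\mid\Phi_1W^\infty\Phi_2$, $\ell\in\mathbb N$. An infinite path $s_0s_1\cdots$ satisfies $X^\ell\Phi$ iff $s_\ell\models\Phi$; $\Phi_1U^\ell\Phi_2$ iff some $j\le\ell$ has $s_j\models\Phi_2$ and $s_i\models\Phi_1$ for all $i<j$; $\Phi_1W^\ell\Phi_2$ iff for every $j\le\ell$, $s_j\models\Phi_1$ or $s_j\models\Phi_2$ or some $i<j$ has $s_i\models\Phi_2$; $\infty$ versions let $j$ range over $\mathbb N$. A state $s$ satisfies $\sum c_i\mathbb P(\varphi_i)\succcurlyeq c_0$ iff $\sum c_i\,\mu(\{\text{paths from } s\text{ satisfying }\varphi_i\})\succcurlyeq c_0$; atomic and Boolean cases as usual. $\Phi$ is a window formula if all horizon labels are finite; non-strict if $\succcurlyeq$ is always $\ge$; flat if no $\mathbb P$ operator occurs inside the argument of another $\mathbb P$ operator. A global window formula is $\forall G\,\Phi$ with $\Phi$ a window formula; a state satisfies it iff every state reachable from it satisfies $\Phi$; an MC satisfies it if its initial state does. *)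

theory Defs
  imports "HOL-Probability.Probability" "HOL-Library.Nat_Bijection"
begin

section \<open>Recursively enumerable sets of natural numbers\<close>

text \<open>Kleene's partial recursive functions. The relation \<open>rec_eval f xs y\<close> says that \<open>f\<close>
  converges on the argument list \<open>xs\<close> with value \<open>y\<close>; in \<open>PRec\<close> and \<open>Mu\<close> the recursion
  (respectively search) variable is the first argument.\<close>

datatype recf =
    Zero
  | Succ
  | Proj nat
  | Comp recf "recf list"
  | PRec recf recf
  | Mu recf

inductive rec_eval :: "recf \<Rightarrow> nat list \<Rightarrow> nat \<Rightarrow> bool" where
  Zero: "rec_eval Zero xs 0"
| Succ: "rec_eval Succ [x] (Suc x)"
| Proj: "i < length xs \<Longrightarrow> rec_eval (Proj i) xs (xs ! i)"
| Comp: "list_all2 (\<lambda>g y. rec_eval g xs y) gs ys \<Longrightarrow> rec_eval f ys z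
    \<Longrightarrow> rec_eval (Comp f gs) xs z"
| PRec_0: "rec_eval f xs y \<Longrightarrow> rec_eval (PRec f g) (0 # xs) y"
| PRec_Suc: "rec_eval (PRec f g) (n # xs) r \<Longrightarrow> rec_eval g (n # r # xs) y
    \<Longrightarrow> rec_eval (PRec f g) (Suc n # xs) y"
| Mu: "rec_eval f (n # xs) 0 \<Longrightarrow> \<forall>i<n. \<exists>k. rec_eval f (i # xs) (Suc k)
    \<Longrightarrow> rec_eval (Mu f) xs n"

inductive_cases rec_evalE:
  "rec_eval Zero xs y" "rec_eval Succ xs y" "rec_eval (Proj i) xs y" "rec_eval (Comp f gs) xs y"
  "rec_eval (PRec f g) (0 # xs) y" "rec_eval (PRec f g) (Suc n # xs) y" "rec_eval (Mu f) xs y"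

lemma rec_eval_deterministic: "rec_eval f xs y \<Longrightarrow> rec_eval f xs z \<Longrightarrow> y = z"
proof (induction arbitrary: z rule: rec_eval.induct)
  case (Zero xs)
  then show ?case by (rule rec_evalE(1)) simp
next
  case (Succ x)
  then show ?case by (rule rec_evalE(2)) simp
next
  case (Proj i xs)
  from Proj(2) show ?case by (rule rec_evalE(3)) simp
next
  case (Comp xs gs ys f w)
  from Comp.prems obtain ys' where ys': "list_all2 (\<lambda>g y. rec_eval g xs y) gs ys'"
    and z: "rec_eval f ys' z"
    by (rule rec_evalE(4))
  have "ys = ys'"
    using Comp.IH(1) ys' by (auto simp: list_all2_conv_all_nth intro!: nth_equalityI)
  with Comp.IH(2) z show ?case by simp
next
  case (PRec_0 f xs y g)
  from PRec_0.prems show ?case by (rule rec_evalE(5)) (rule PRec_0.IH)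
next
  case (PRec_Suc f g n xs r y)
  from PRec_Suc.prems obtain r' where "rec_eval (PRec f g) (n # xs) r'" "rec_eval g (n # r' # xs) z"
    by (rule rec_evalE(6))
  with PRec_Suc.IH show ?case by blast
next
  case (Mu f n xs)
  from Mu.prems have z: "rec_eval f (z # xs) 0" "\<forall>i<z. \<exists>k. rec_eval f (i # xs) (Suc k)"
    by (rule rec_evalE(7), simp)+
  have "\<not> z < n"
    using Mu.IH(2) z(1) by blast
  moreover have "\<not> n < z"
    using Mu.IH(1) z(2) by fastforce
  ultimately show ?case by simp
qed

definition RE :: "nat set \<Rightarrow> bool" where
  "RE A \<longleftrightarrow> (\<exists>f. A = {x. \<exists>y. rec_eval f [x] y})"

definition coRE :: "nat set \<Rightarrow> bool" where
  "coRE A \<longleftrightarrow> RE (- A)"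


section \<open>Markov chains\<close>

record ('s, 'p) mc =
  mc_states :: "'s set"
  mc_init :: 's
  mc_trans :: "'s \<Rightarrow> 's pmf"
  mc_ap :: "'p set"
  mc_label :: "'s \<Rightarrow> 'p set"

definition markov_chain :: "('s, 'p) mc \<Rightarrow> bool" where
  "markov_chain C \<longleftrightarrow>
     countable (mc_states C) \<and>
     mc_init C \<in> mc_states C \<and>
     (\<forall>s\<in>mc_states C. set_pmf (mc_trans C s) \<subseteq> mc_states C) \<and>
     finite (mc_ap C) \<and> mc_ap C \<noteq> {} \<and>
     (\<forall>s\<in>mc_states C. mc_label C s \<subseteq> mc_ap C)"

text \<open>The path measure is the Ionescu-Tulcea limit of the one-step kernels: coordinate \<open>0\<close>
  is the start state, and coordinate \<open>Suc j\<close> is drawn from the distribution of the state at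
  coordinate \<open>j\<close>. Over a countable type of states it is the usual measure, see
  \<open>emeasure_path_measure_cylinder\<close> below.\<close>

definition path_kernel :: "('s, 'p) mc \<Rightarrow> 's \<Rightarrow> nat \<Rightarrow> (nat \<Rightarrow> 's) \<Rightarrow> 's measure" where
  "path_kernel C s i \<omega> =
     measure_pmf (case i of 0 \<Rightarrow> return_pmf s | Suc j \<Rightarrow> mc_trans C (\<omega> j))"

definition path_measure :: "('s, 'p) mc \<Rightarrow> 's \<Rightarrow> (nat \<Rightarrow> 's) measure" where
  "path_measure C s =
     projective_family.lim UNIV
       (Ionescu_Tulcea.CI (path_kernel C s) (\<lambda>_. count_space UNIV)) (\<lambda>_. count_space UNIV)"

lemma Ionescu_Tulcea_path_kernel:
  fixes D :: "('s :: countable, 'p) mc"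
  shows "Ionescu_Tulcea (path_kernel D s) (\<lambda>_. count_space UNIV)"
proof (rule Ionescu_Tulcea.intro)
  show "path_kernel D s i \<in> measurable (PiM {0..<i} (\<lambda>_. count_space UNIV))
      (subprob_algebra (count_space UNIV))" for i
  proof (cases i)
    case 0
    then show ?thesis
      by (simp add: path_kernel_def[abs_def] measure_pmf_in_subprob_algebra)
  next
    case (Suc j)
    have "(\<lambda>\<omega>. measure_pmf (mc_trans D (\<omega> j))) \<in> measurable (PiM {0..<i} (\<lambda>_. count_space UNIV))
      (subprob_algebra (count_space UNIV))"
      by (rule measurable_compose[OF measurable_component_singleton[of j]])
        (auto simp: Suc measure_pmf_in_subprob_algebra)
    then show ?thesis
      by (simp add: path_kernel_def[abs_def] Suc)
  qed
  show "prob_space (path_kernel D s i \<omega>)" for i \<omega>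
    by (simp add: path_kernel_def measure_pmf.prob_space_axioms)
qed

lemma sets_path_measure:
  fixes D :: "('s :: countable, 'p) mc"
  shows "sets (path_measure D s) = sets (PiM UNIV (\<lambda>_. count_space UNIV))"
proof -
  interpret Ionescu_Tulcea "path_kernel D s" "\<lambda>_. count_space UNIV"
    by (rule Ionescu_Tulcea_path_kernel)
  show ?thesis unfolding path_measure_def by (rule PF.sets_lim)
qed

lemma emeasure_path_measure_cylinder:
  fixes D :: "('s :: countable, 'p) mc"
  shows "emeasure (path_measure D s) {\<omega>. \<forall>i\<le>n. \<omega> i = x i} =
    ennreal (if x 0 = s then \<Prod>i<n. pmf (mc_trans D (x i)) (x (Suc i)) else 0)"
proof -
  interpret Ionescu_Tulcea "path_kernel D s" "\<lambda>_. count_space UNIV"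
    by (rule Ionescu_Tulcea_path_kernel)
  let ?M = "\<lambda>_ :: nat. count_space (UNIV :: 's set)"
  let ?X = "\<lambda>n. PiE {0..<n} (\<lambda>i. {x i})"
  let ?u = "\<lambda>_ :: nat. undefined :: 's"
  let ?k = "\<lambda>n. pmf (case n of 0 \<Rightarrow> return_pmf s | Suc j \<Rightarrow> mc_trans D (x j)) (x n)"
  have X[measurable]: "?X n \<in> sets (PiM {0..<n} ?M)" for n
    by (intro sets_PiM_I_finite) auto
  have u: "?u \<in> space (PiM {0..<0} ?M)"
    by (simp add: space_PiM)
  have step: "emeasure (C 0 (Suc n) ?u) (?X (Suc n)) = emeasure (C 0 n ?u) (?X n) * ennreal (?k n)"
    for n
  proof -
    have sp: "space (C 0 n ?u) = space (PiM {0..<n} ?M)"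
      using space_C[OF u, of n] by simp
    have "emeasure (eP n \<omega>) (?X (Suc n)) = ennreal (?k n) * indicator (?X n) \<omega>"
      if \<omega>: "\<omega> \<in> space (PiM {0..<n} ?M)" for \<omega>
    proof -
      have ext: "\<omega> \<in> extensional {0..<n}" using \<omega> by (simp add: space_PiM PiE_iff)
      have "fun_upd \<omega> n -` ?X (Suc n) \<inter> space (count_space UNIV) = (if \<omega> \<in> ?X n then {x n} else {})"
      proof (intro set_eqI)
        fix y
        have "fun_upd \<omega> n y \<in> ?X (Suc n) \<longleftrightarrow> \<omega> \<in> ?X n \<and> y = x n"
          using ext unfolding PiE_iff extensional_def by (simp add: less_Suc_eq Ball_def) auto
        then show "y \<in> fun_upd \<omega> n -` ?X (Suc n) \<inter> space (count_space UNIV) \<longleftrightarrow>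
            y \<in> (if \<omega> \<in> ?X n then {x n} else {})"
          by (simp only: vimage_eq Int_iff space_count_space) simp
      qed
      moreover have "path_kernel D s n \<omega> = measure_pmf
          (case n of 0 \<Rightarrow> return_pmf s | Suc j \<Rightarrow> mc_trans D (x j))" if "\<omega> \<in> ?X n"
        using that by (cases n) (auto simp: path_kernel_def PiE_iff)
      ultimately show ?thesis
        using emeasure_eP[OF \<omega> X[of "Suc n"]] by (auto simp: emeasure_pmf_single)
    qed
    note eP_X = this
    have "sets (C 0 n ?u) = sets (PiM {0..<n} ?M)"
      using sets_C[OF u, of n] by simp
    then have "eP n \<in> measurable (C 0 n ?u) (subprob_algebra (PiM {0..<Suc n} ?M))"
      using measurable_eP[of n] by (subst measurable_cong_sets[OF _ refl])
    then have "emeasure (C 0 n ?u \<bind> eP n) (?X (Suc n)) =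
        (\<integral>\<^sup>+\<omega>. emeasure (eP n \<omega>) (?X (Suc n)) \<partial>C 0 n ?u)"
      using prob_space.not_empty[OF prob_space_C[OF u, of n]] X[of "Suc n"]
      by (intro emeasure_bind)
    also have "\<dots> = (\<integral>\<^sup>+\<omega>. ennreal (?k n) * indicator (?X n) \<omega> \<partial>C 0 n ?u)"
      by (rule nn_integral_cong) (simp only: sp eP_X)
    finally have "emeasure (C 0 (Suc n) ?u) (?X (Suc n)) =
        (\<integral>\<^sup>+\<omega>. ennreal (?k n) * indicator (?X n) \<omega> \<partial>C 0 n ?u)"
      by (simp only: C.simps add_0)
    also have "\<dots> = ennreal (?k n) * emeasure (C 0 n ?u) (?X n)"
      using sets_C[OF u, of n] X[of n] by (intro nn_integral_cmult_indicator) simp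
    finally show ?thesis by (simp only: mult.commute)
  qed
  have C_eq: "emeasure (C 0 n ?u) (?X n) = ennreal (\<Prod>i<n. ?k i)" for n
  proof (induction n)
    case 0
    show ?case using X[of 0] by (simp add: emeasure_return)
  next
    case (Suc n)
    then show ?case
      by (subst step) (simp add: ennreal_mult' prod_nonneg mult.commute)
  qed
  have "{\<omega>. \<forall>i\<le>n. \<omega> i = x i} = PF.emb UNIV {0..<Suc n} (?X (Suc n))"
    by (auto simp: prod_emb_def space_PiM PiE_iff less_Suc_eq_le)
  then have "emeasure (path_measure D s) {\<omega>. \<forall>i\<le>n. \<omega> i = x i} = emeasure (CI {0..<Suc n}) (?X (Suc n))"
    unfolding path_measure_def using lim[of "{0..<Suc n}", OF _ X] by simp
  also have "\<dots> = emeasure (C 0 (Suc n) ?u) (?X (Suc n))"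
    using emeasure_CI[OF order_refl X, of "Suc n"] prod_emb_id[of "?X (Suc n)" "{0..<Suc n}" ?M]
    by (simp add: PiE_mono)
  also have "\<dots> = ennreal (\<Prod>i<Suc n. ?k i)"
    by (rule C_eq)
  also have "(\<Prod>i<Suc n. ?k i) = (if x 0 = s then \<Prod>i<n. pmf (mc_trans D (x i)) (x (Suc i)) else 0)"
    by (subst prod.lessThan_Suc_shift) (auto simp: pmf_return)
  finally show ?thesis .
qed

definition mc_reachable :: "('s, 'p) mc \<Rightarrow> 's \<Rightarrow> 's \<Rightarrow> bool" where
  "mc_reachable C = (\<lambda>s t. t \<in> set_pmf (mc_trans C s))\<^sup>*\<^sup>*"


section \<open>Markov decision processes and strategies\<close>

record ('s, 'a, 'p) mdp =
  mdp_states :: "'s set"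
  mdp_actions :: "'a set"
  mdp_init :: 's
  mdp_trans :: "'s \<Rightarrow> 'a \<Rightarrow> 's pmf"
  mdp_ap :: "'p set"
  mdp_label :: "'s \<Rightarrow> 'p set"

definition markov_decision_process :: "('s, 'a, 'p) mdp \<Rightarrow> bool" where
  "markov_decision_process M \<longleftrightarrow>
     finite (mdp_states M) \<and> finite (mdp_actions M) \<and>
     mdp_init M \<in> mdp_states M \<and>
     (\<forall>s\<in>mdp_states M. \<forall>a\<in>mdp_actions M.
        set_pmf (mdp_trans M s a) \<subseteq> mdp_states M \<and> (\<forall>t. pmf (mdp_trans M s a) t \<in> \<rat>)) \<and>
     finite (mdp_ap M) \<and> mdp_ap M \<noteq> {} \<and>
     (\<forall>s\<in>mdp_states M. mdp_label M s \<subseteq> mdp_ap M)"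

datatype ('s, 'a) fpath = Start 's | Step "('s, 'a) fpath" 'a 's

instance fpath :: (countable, countable) countable
  by countable_datatype

primrec fpath_last :: "('s, 'a) fpath \<Rightarrow> 's" where
  "fpath_last (Start s) = s"
| "fpath_last (Step \<rho> a s) = s"

inductive_set finite_paths :: "('s, 'a, 'p) mdp \<Rightarrow> ('s, 'a) fpath set"
  for M :: "('s, 'a, 'p) mdp" where
  Start: "s \<in> mdp_states M \<Longrightarrow> Start s \<in> finite_paths M"
| Step: "\<rho> \<in> finite_paths M \<Longrightarrow> a \<in> mdp_actions M \<Longrightarrow> s \<in> mdp_states M
    \<Longrightarrow> pmf (mdp_trans M (fpath_last \<rho>) a) s > 0 \<Longrightarrow> Step \<rho> a s \<in> finite_paths M"

definition strategy :: "('s, 'a, 'p) mdp \<Rightarrow> (('s, 'a) fpath \<Rightarrow> 'a pmf) \<Rightarrow> bool" where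
  "strategy M \<sigma> \<longleftrightarrow> (\<forall>\<rho>\<in>finite_paths M. set_pmf (\<sigma> \<rho>) \<subseteq> mdp_actions M)"

definition induced_mc ::
    "('s, 'a, 'p) mdp \<Rightarrow> (('s, 'a) fpath \<Rightarrow> 'a pmf) \<Rightarrow> (('s, 'a) fpath, 'p) mc" where
  "induced_mc M \<sigma> =
     \<lparr> mc_states = finite_paths M,
       mc_init = Start (mdp_init M),
       mc_trans = (\<lambda>\<rho>. do {
         a \<leftarrow> \<sigma> \<rho>;
         s \<leftarrow> mdp_trans M (fpath_last \<rho>) a;
         return_pmf (Step \<rho> a s) }),
       mc_ap = mdp_ap M,
       mc_label = (\<lambda>\<rho>. mdp_label M (fpath_last \<rho>)) \<rparr>"

lemma markov_chain_induced_mc: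
  fixes M :: "('s :: countable, 'a :: countable, 'p) mdp"
  assumes M: "markov_decision_process M" and \<sigma>: "strategy M \<sigma>"
  shows "markov_chain (induced_mc M \<sigma>)"
proof -
  have last: "fpath_last \<rho> \<in> mdp_states M" if "\<rho> \<in> finite_paths M" for \<rho>
    using that by cases auto
  have "Step \<rho> a s \<in> finite_paths M"
    if "\<rho> \<in> finite_paths M" "a \<in> set_pmf (\<sigma> \<rho>)" "s \<in> set_pmf (mdp_trans M (fpath_last \<rho>) a)"
    for \<rho> a s
  proof (rule finite_paths.Step)
    show "a \<in> mdp_actions M" using \<sigma> that by (auto simp: strategy_def)
    then show "s \<in> mdp_states M"
      using M last[OF that(1)] that(3) unfolding markov_decision_process_def by blast
  qed (use that in \<open>simp_all add: pmf_positive\<close>)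
  then show ?thesis
    using M by (auto simp: markov_chain_def induced_mc_def markov_decision_process_def
      intro: finite_paths.Start dest: last)
qed

lemma pmf_induced_mc:
  "pmf (mc_trans (induced_mc M \<sigma>) \<rho>) (Step \<rho> a s) =
     pmf (\<sigma> \<rho>) a * pmf (mdp_trans M (fpath_last \<rho>) a) s"
proof -
  have "mc_trans (induced_mc M \<sigma>) \<rho> = map_pmf (\<lambda>(a, s). Step \<rho> a s)
      (\<sigma> \<rho> \<bind> (\<lambda>a. map_pmf (Pair a) (mdp_trans M (fpath_last \<rho>) a)))"
    by (simp add: induced_mc_def map_bind_pmf map_pmf_comp) (simp add: map_pmf_def)
  moreover have "inj (\<lambda>(a, s). Step \<rho> a s)"
    by (auto simp: inj_def)
  ultimately have "pmf (mc_trans (induced_mc M \<sigma>) \<rho>) (Step \<rho> a s) =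
      pmf (\<sigma> \<rho> \<bind> (\<lambda>a. map_pmf (Pair a) (mdp_trans M (fpath_last \<rho>) a))) (a, s)"
    by (metis (no_types, lifting) case_prod_conv pmf_map_inj')
  also have "\<dots> = measure_pmf.expectation (\<sigma> \<rho>)
      (\<lambda>b. pmf (mdp_trans M (fpath_last \<rho>) a) s * indicator {a} b)"
    unfolding pmf_bind
  proof (rule Bochner_Integration.integral_cong[OF refl])
    fix b
    show "pmf (map_pmf (Pair b) (mdp_trans M (fpath_last \<rho>) b)) (a, s) =
      pmf (mdp_trans M (fpath_last \<rho>) a) s * indicator {a} b"
      by (cases "a = b") (auto simp: pmf_map_inj' inj_def pmf_eq_0_set_pmf)
  qed
  finally show ?thesis by (simp add: pmf.rep_eq mult.commute)
qed


section \<open>L-PCTL\<close>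

datatype cmp = Ge | Gt

primrec cmp_holds :: "cmp \<Rightarrow> real \<Rightarrow> real \<Rightarrow> bool" where
  "cmp_holds Ge x y \<longleftrightarrow> x \<ge> y"
| "cmp_holds Gt x y \<longleftrightarrow> x > y"

text \<open>\<open>PSum [(c\<^sub>1, \<phi>\<^sub>1), \<dots>, (c\<^sub>n, \<phi>\<^sub>n)] R c\<^sub>0\<close> is the linear constraint on the probabilities
  of \<open>\<phi>\<^sub>1, \<dots>, \<phi>\<^sub>n\<close> with coefficients \<open>c\<^sub>1, \<dots>, c\<^sub>n\<close> and bound \<open>c\<^sub>0\<close>; the requirement
  \<open>n \<ge> 1\<close> is part of \<open>lpctl_sf\<close>.\<close>

datatype (sf_atoms: 'p) sform =
    Atom 'p
  | NegAtom 'p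
  | Conj "'p sform" "'p sform"
  | Disj "'p sform" "'p sform"
  | PSum "(int \<times> 'p pform) list" cmp int
and (pf_atoms: 'p) pform =
    Next nat "'p sform"
  | Until "'p sform" enat "'p sform"
  | WeakUntil "'p sform" enat "'p sform"

fun sf_sat :: "('s, 'p) mc \<Rightarrow> 's \<Rightarrow> 'p sform \<Rightarrow> bool"
and pf_sat :: "('s, 'p) mc \<Rightarrow> (nat \<Rightarrow> 's) \<Rightarrow> 'p pform \<Rightarrow> bool" where
  "sf_sat C s (Atom p) \<longleftrightarrow> p \<in> mc_label C s"
| "sf_sat C s (NegAtom p) \<longleftrightarrow> p \<notin> mc_label C s"
| "sf_sat C s (Conj \<Phi> \<Psi>) \<longleftrightarrow> sf_sat C s \<Phi> \<and> sf_sat C s \<Psi>"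
| "sf_sat C s (Disj \<Phi> \<Psi>) \<longleftrightarrow> sf_sat C s \<Phi> \<or> sf_sat C s \<Psi>"
| "sf_sat C s (PSum cs R c\<^sub>0) \<longleftrightarrow>
     cmp_holds R
       (\<Sum>x\<leftarrow>cs. of_int (fst x) *
          measure (path_measure C s) {\<omega> \<in> space (path_measure C s). pf_sat C \<omega> (snd x)})
       (of_int c\<^sub>0)"
| "pf_sat C \<omega> (Next l \<Phi>) \<longleftrightarrow> sf_sat C (\<omega> l) \<Phi>"
| "pf_sat C \<omega> (Until \<Phi> l \<Psi>) \<longleftrightarrow>
     (\<exists>j. enat j \<le> l \<and> sf_sat C (\<omega> j) \<Psi> \<and> (\<forall>i<j. sf_sat C (\<omega> i) \<Phi>))"
| "pf_sat C \<omega> (WeakUntil \<Phi> l \<Psi>) \<longleftrightarrow>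
     (\<forall>j. enat j \<le> l \<longrightarrow>
        sf_sat C (\<omega> j) \<Phi> \<or> sf_sat C (\<omega> j) \<Psi> \<or> (\<exists>i<j. sf_sat C (\<omega> i) \<Psi>))"

fun sums_nonempty_sf :: "'p sform \<Rightarrow> bool"
and sums_nonempty_pf :: "'p pform \<Rightarrow> bool" where
  "sums_nonempty_sf (Atom p) \<longleftrightarrow> True"
| "sums_nonempty_sf (NegAtom p) \<longleftrightarrow> True"
| "sums_nonempty_sf (Conj \<Phi> \<Psi>) \<longleftrightarrow> sums_nonempty_sf \<Phi> \<and> sums_nonempty_sf \<Psi>"
| "sums_nonempty_sf (Disj \<Phi> \<Psi>) \<longleftrightarrow> sums_nonempty_sf \<Phi> \<and> sums_nonempty_sf \<Psi>"
| "sums_nonempty_sf (PSum cs R c\<^sub>0) \<longleftrightarrow> cs \<noteq> [] \<and> (\<forall>x\<in>set cs. sums_nonempty_pf (snd x))"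
| "sums_nonempty_pf (Next l \<Phi>) \<longleftrightarrow> sums_nonempty_sf \<Phi>"
| "sums_nonempty_pf (Until \<Phi> l \<Psi>) \<longleftrightarrow> sums_nonempty_sf \<Phi> \<and> sums_nonempty_sf \<Psi>"
| "sums_nonempty_pf (WeakUntil \<Phi> l \<Psi>) \<longleftrightarrow> sums_nonempty_sf \<Phi> \<and> sums_nonempty_sf \<Psi>"

definition lpctl_sf :: "'p set \<Rightarrow> 'p sform \<Rightarrow> bool" where
  "lpctl_sf AP \<Phi> \<longleftrightarrow> sf_atoms \<Phi> \<subseteq> AP \<and> sums_nonempty_sf \<Phi>"

fun window_sf :: "'p sform \<Rightarrow> bool"
and window_pf :: "'p pform \<Rightarrow> bool" where
  "window_sf (Atom p) \<longleftrightarrow> True"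
| "window_sf (NegAtom p) \<longleftrightarrow> True"
| "window_sf (Conj \<Phi> \<Psi>) \<longleftrightarrow> window_sf \<Phi> \<and> window_sf \<Psi>"
| "window_sf (Disj \<Phi> \<Psi>) \<longleftrightarrow> window_sf \<Phi> \<and> window_sf \<Psi>"
| "window_sf (PSum cs R c\<^sub>0) \<longleftrightarrow> (\<forall>x\<in>set cs. window_pf (snd x))"
| "window_pf (Next l \<Phi>) \<longleftrightarrow> window_sf \<Phi>"
| "window_pf (Until \<Phi> l \<Psi>) \<longleftrightarrow> l \<noteq> \<infinity> \<and> window_sf \<Phi> \<and> window_sf \<Psi>"
| "window_pf (WeakUntil \<Phi> l \<Psi>) \<longleftrightarrow> l \<noteq> \<infinity> \<and> window_sf \<Phi> \<and> window_sf \<Psi>"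

fun nonstrict_sf :: "'p sform \<Rightarrow> bool"
and nonstrict_pf :: "'p pform \<Rightarrow> bool" where
  "nonstrict_sf (Atom p) \<longleftrightarrow> True"
| "nonstrict_sf (NegAtom p) \<longleftrightarrow> True"
| "nonstrict_sf (Conj \<Phi> \<Psi>) \<longleftrightarrow> nonstrict_sf \<Phi> \<and> nonstrict_sf \<Psi>"
| "nonstrict_sf (Disj \<Phi> \<Psi>) \<longleftrightarrow> nonstrict_sf \<Phi> \<and> nonstrict_sf \<Psi>"
| "nonstrict_sf (PSum cs R c\<^sub>0) \<longleftrightarrow> R = Ge \<and> (\<forall>x\<in>set cs. nonstrict_pf (snd x))"
| "nonstrict_pf (Next l \<Phi>) \<longleftrightarrow> nonstrict_sf \<Phi>"
| "nonstrict_pf (Until \<Phi> l \<Psi>) \<longleftrightarrow> nonstrict_sf \<Phi> \<and> nonstrict_sf \<Psi>"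
| "nonstrict_pf (WeakUntil \<Phi> l \<Psi>) \<longleftrightarrow> nonstrict_sf \<Phi> \<and> nonstrict_sf \<Psi>"

primrec prob_free_sf :: "'p sform \<Rightarrow> bool" where
  "prob_free_sf (Atom p) \<longleftrightarrow> True"
| "prob_free_sf (NegAtom p) \<longleftrightarrow> True"
| "prob_free_sf (Conj \<Phi> \<Psi>) \<longleftrightarrow> prob_free_sf \<Phi> \<and> prob_free_sf \<Psi>"
| "prob_free_sf (Disj \<Phi> \<Psi>) \<longleftrightarrow> prob_free_sf \<Phi> \<and> prob_free_sf \<Psi>"
| "prob_free_sf (PSum cs R c\<^sub>0) \<longleftrightarrow> False"

primrec prob_free_pf :: "'p pform \<Rightarrow> bool" where
  "prob_free_pf (Next l \<Phi>) \<longleftrightarrow> prob_free_sf \<Phi>"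
| "prob_free_pf (Until \<Phi> l \<Psi>) \<longleftrightarrow> prob_free_sf \<Phi> \<and> prob_free_sf \<Psi>"
| "prob_free_pf (WeakUntil \<Phi> l \<Psi>) \<longleftrightarrow> prob_free_sf \<Phi> \<and> prob_free_sf \<Psi>"

primrec flat_sf :: "'p sform \<Rightarrow> bool" where
  "flat_sf (Atom p) \<longleftrightarrow> True"
| "flat_sf (NegAtom p) \<longleftrightarrow> True"
| "flat_sf (Conj \<Phi> \<Psi>) \<longleftrightarrow> flat_sf \<Phi> \<and> flat_sf \<Psi>"
| "flat_sf (Disj \<Phi> \<Psi>) \<longleftrightarrow> flat_sf \<Phi> \<and> flat_sf \<Psi>"
| "flat_sf (PSum cs R c\<^sub>0) \<longleftrightarrow> (\<forall>x\<in>set cs. prob_free_pf (snd x))"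

datatype 'p gform = AG "'p sform"

primrec gf_sat :: "('s, 'p) mc \<Rightarrow> 's \<Rightarrow> 'p gform \<Rightarrow> bool" where
  "gf_sat C s (AG \<Phi>) \<longleftrightarrow> (\<forall>t. mc_reachable C s t \<longrightarrow> sf_sat C t \<Phi>)"

definition mc_models :: "('s, 'p) mc \<Rightarrow> 'p gform \<Rightarrow> bool" where
  "mc_models C \<Psi> \<longleftrightarrow> gf_sat C (mc_init C) \<Psi>"


section \<open>Encoding of the instances as natural numbers\<close>

text \<open>States, actions and atomic propositions of an instance are natural numbers. Functions
  on finite carriers are encoded by their graphs, and a rational probability by its reduced
  numerator and denominator. Values outside the carriers do not enter the code, and the code determines
  everything else (\<open>encode_inj\<close>, \<open>encode_mdp_inj\<close>).\<close>

fun encode_sf :: "nat sform \<Rightarrow> nat"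
and encode_pf :: "nat pform \<Rightarrow> nat" where
  "encode_sf (Atom p) = list_encode [0, p]"
| "encode_sf (NegAtom p) = list_encode [1, p]"
| "encode_sf (Conj \<Phi> \<Psi>) = list_encode [2, encode_sf \<Phi>, encode_sf \<Psi>]"
| "encode_sf (Disj \<Phi> \<Psi>) = list_encode [3, encode_sf \<Phi>, encode_sf \<Psi>]"
| "encode_sf (PSum cs R c\<^sub>0) = list_encode
     [4, list_encode (map (\<lambda>x. prod_encode (int_encode (fst x), encode_pf (snd x))) cs),
      (case R of Ge \<Rightarrow> 0 | Gt \<Rightarrow> 1), int_encode c\<^sub>0]"
| "encode_pf (Next l \<Phi>) = list_encode [0, l, encode_sf \<Phi>]"
| "encode_pf (Until \<Phi> l \<Psi>) =
     list_encode [1, encode_sf \<Phi>, (case l of enat k \<Rightarrow> Suc k | \<infinity> \<Rightarrow> 0), encode_sf \<Psi>]"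
| "encode_pf (WeakUntil \<Phi> l \<Psi>) =
     list_encode [2, encode_sf \<Phi>, (case l of enat k \<Rightarrow> Suc k | \<infinity> \<Rightarrow> 0), encode_sf \<Psi>]"

primrec encode_gf :: "nat gform \<Rightarrow> nat" where
  "encode_gf (AG \<Phi>) = encode_sf \<Phi>"

definition encode_prob :: "real \<Rightarrow> nat" where
  "encode_prob x = (case quotient_of (the_inv of_rat x) of (k, m) \<Rightarrow> prod_encode (nat k, nat m))"

definition encode_mdp :: "(nat, nat, nat) mdp \<Rightarrow> nat" where
  "encode_mdp M = list_encode
     [set_encode (mdp_states M),
      set_encode (mdp_actions M),
      mdp_init M,
      set_encode {list_encode [s, a, t, encode_prob (pmf (mdp_trans M s a) t)] | s a t.
        s \<in> mdp_states M \<and> a \<in> mdp_actions M \<and> t \<in> mdp_states M},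
      set_encode (mdp_ap M),
      set_encode {list_encode [s, p] | s p. s \<in> mdp_states M \<and> p \<in> mdp_label M s}]"

definition encode_instance :: "(nat, nat, nat) mdp \<Rightarrow> nat gform \<Rightarrow> nat" where
  "encode_instance M \<Psi> = prod_encode (encode_mdp M, encode_gf \<Psi>)"


lemma encode_inj:
  "encode_sf \<Phi> = encode_sf \<Phi>' \<longleftrightarrow> \<Phi> = \<Phi>'"
  "encode_pf \<phi> = encode_pf \<phi>' \<longleftrightarrow> \<phi> = \<phi>'"
proof (induction \<Phi> and \<phi> arbitrary: \<Phi>' and \<phi>' rule: encode_sf_encode_pf.induct)
  case (1 p) show ?case by (cases \<Phi>') (simp_all add: list_encode_eq del: list_encode.simps)
next
  case (2 p) show ?case by (cases \<Phi>') (simp_all add: list_encode_eq del: list_encode.simps)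
next
  case (3 \<Phi> \<Psi>) then show ?case by (cases \<Phi>') (simp_all add: list_encode_eq del: list_encode.simps)
next
  case (4 \<Phi> \<Psi>) then show ?case by (cases \<Phi>') (simp_all add: list_encode_eq del: list_encode.simps)
next
  case (5 cs R c)
  have "map (\<lambda>x. prod_encode (int_encode (fst x), encode_pf (snd x))) cs =
        map (\<lambda>x. prod_encode (int_encode (fst x), encode_pf (snd x))) ds \<longleftrightarrow> cs = ds" for ds
    using 5
  proof (induction cs arbitrary: ds)
    case Nil then show ?case by auto
  next
    case (Cons y ys)
    show ?case
    proof (cases ds)
      case Nil then show ?thesis by simp
    next
      case (Cons z zs)
      with Cons.IH[of zs] Cons.prems show ?thesis
        by (auto simp: prod_encode_eq int_encode_eq prod_eq_iff)
    qed
  qed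
  then show ?case
    by (cases \<Phi>') (auto simp: list_encode_eq int_encode_eq simp del: list_encode.simps
      split: cmp.splits)
next
  case (6 l \<Phi>) then show ?case by (cases \<phi>') (simp_all add: list_encode_eq del: list_encode.simps)
next
  case (7 \<Phi> l \<Psi>) then show ?case
    by (cases \<phi>') (auto simp: list_encode_eq simp del: list_encode.simps split: enat.splits)
next
  case (8 \<Phi> l \<Psi>) then show ?case
    by (cases \<phi>') (auto simp: list_encode_eq simp del: list_encode.simps split: enat.splits)
qed

lemma encode_prob_inj:
  assumes "x \<in> \<rat>" "y \<in> \<rat>" "0 \<le> x" "0 \<le> y" "encode_prob x = encode_prob y"
  shows "x = y"
proof -
  obtain q r where q: "x = of_rat q" and r: "y = of_rat r"
    using assms(1,2) by (auto elim!: Rats_cases)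
  have [simp]: "the_inv of_rat (of_rat z :: real) = z" for z
    by (rule the_inv_f_f) (simp add: inj_def)
  obtain k m where km: "quotient_of q = (k, m)" by fastforce
  obtain k' m' where km': "quotient_of r = (k', m')" by fastforce
  have pos: "0 < m" "0 < m'" using quotient_of_denom_pos km km' by auto
  have eq: "q = of_int k / of_int m" "r = of_int k' / of_int m'"
    using quotient_of_div km km' by auto
  have "0 \<le> q" "0 \<le> r" using assms(3,4) q r by auto
  then have "0 \<le> k" "0 \<le> k'" using pos by (auto simp: eq zero_le_divide_iff)
  then have "k = k'" "m = m'"
    using assms(5) pos by (auto simp: encode_prob_def q r km km' prod_encode_eq)
  then show ?thesis using eq q r by simp
qed

lemma encode_mdp_inj:
  assumes M: "markov_decision_process M" and N: "markov_decision_process N"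
    and eq: "encode_mdp M = encode_mdp N"
  shows "mdp_states M = mdp_states N" "mdp_actions M = mdp_actions N"
    "mdp_init M = mdp_init N" "mdp_ap M = mdp_ap N"
    "\<And>s a. s \<in> mdp_states M \<Longrightarrow> a \<in> mdp_actions M \<Longrightarrow> mdp_trans M s a = mdp_trans N s a"
    "\<And>s. s \<in> mdp_states M \<Longrightarrow> mdp_label M s = mdp_label N s"
proof -
  let ?T = "\<lambda>M :: (nat, nat, nat) mdp.
    {list_encode [s, a, t, encode_prob (pmf (mdp_trans M s a) t)] | s a t.
        s \<in> mdp_states M \<and> a \<in> mdp_actions M \<and> t \<in> mdp_states M}"
  let ?L = "\<lambda>M :: (nat, nat, nat) mdp.
    {list_encode [s, p] | s p. s \<in> mdp_states M \<and> p \<in> mdp_label M s}"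
  have fin: "finite (?T M)" "finite (?L M)" if "markov_decision_process M" for M
  proof -
    have "?T M = (\<lambda>(s, a, t). list_encode [s, a, t, encode_prob (pmf (mdp_trans M s a) t)]) `
        (mdp_states M \<times> mdp_actions M \<times> mdp_states M)"
      by (auto simp: image_iff list_encode_eq simp del: list_encode.simps)
    then show "finite (?T M)"
      using that by (simp add: markov_decision_process_def del: list_encode.simps)
    have "?L M \<subseteq> (\<lambda>x. list_encode [fst x, snd x]) ` (mdp_states M \<times> mdp_ap M)"
    proof
      fix c assume "c \<in> ?L M"
      then obtain s p where c: "c = list_encode [s, p]" "s \<in> mdp_states M" "p \<in> mdp_label M s"
        by blast
      then have "(s, p) \<in> mdp_states M \<times> mdp_ap M"
        using that unfolding markov_decision_process_def by blast
      then show "c \<in> (\<lambda>x. list_encode [fst x, snd x]) ` (mdp_states M \<times> mdp_ap M)"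
        by (rule rev_image_eqI) (simp add: c(1) del: list_encode.simps)
    qed
    then show "finite (?L M)"
      by (rule finite_subset) (use that in \<open>auto simp: markov_decision_process_def\<close>)
  qed
  have fin': "finite (mdp_states M)" "finite (mdp_actions M)" "finite (mdp_ap M)"
    "finite (mdp_states N)" "finite (mdp_actions N)" "finite (mdp_ap N)"
    using M N by (simp_all add: markov_decision_process_def)
  have eqs: "mdp_states M = mdp_states N" "mdp_actions M = mdp_actions N"
    "mdp_init M = mdp_init N" "mdp_ap M = mdp_ap N" "?T M = ?T N" "?L M = ?L N"
    using eq[unfolded encode_mdp_def list_encode_eq list.inject set_encode_eq[OF fin'(1,4)]
      set_encode_eq[OF fin'(2,5)] set_encode_eq[OF fin'(3,6)]
      set_encode_eq[OF fin(1)[OF M] fin(1)[OF N]] set_encode_eq[OF fin(2)[OF M] fin(2)[OF N]]]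
    by - ((elim conjE, assumption)+)
  then show "mdp_states M = mdp_states N" "mdp_actions M = mdp_actions N"
    "mdp_init M = mdp_init N" "mdp_ap M = mdp_ap N" by auto
  show "mdp_label M s = mdp_label N s" if "s \<in> mdp_states M" for s
  proof -
    have "p \<in> mdp_label M s \<longleftrightarrow> list_encode [s, p] \<in> ?L M" for p
      using that by (auto simp: list_encode_eq simp del: list_encode.simps)
    moreover have "p \<in> mdp_label N s \<longleftrightarrow> list_encode [s, p] \<in> ?L N" for p
      using that eqs(1) by (auto simp: list_encode_eq simp del: list_encode.simps)
    ultimately show ?thesis unfolding eqs(6) by blast
  qed
  show "mdp_trans M s a = mdp_trans N s a" if sa: "s \<in> mdp_states M" "a \<in> mdp_actions M" for s a
  proof (rule pmf_eqI)
    fix t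
    show "pmf (mdp_trans M s a) t = pmf (mdp_trans N s a) t"
    proof (cases "t \<in> mdp_states M")
      case True
      then have "list_encode [s, a, t, encode_prob (pmf (mdp_trans M s a) t)] \<in> ?T M"
        using sa by blast
      then have "list_encode [s, a, t, encode_prob (pmf (mdp_trans M s a) t)] \<in> ?T N"
        unfolding eqs(5) .
      then have "encode_prob (pmf (mdp_trans M s a) t) = encode_prob (pmf (mdp_trans N s a) t)"
        by (auto simp: list_encode_eq simp del: list_encode.simps)
      then show ?thesis
        using M N sa eqs(1,2) by (intro encode_prob_inj) (auto simp: markov_decision_process_def)
    next
      case False
      have "set_pmf (mdp_trans M s a) \<subseteq> mdp_states M"
        using M sa by (simp add: markov_decision_process_def)
      moreover have "set_pmf (mdp_trans N s a) \<subseteq> mdp_states M"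
        using N sa eqs(1,2) by (simp add: markov_decision_process_def)
      ultimately have "t \<notin> set_pmf (mdp_trans M s a)" "t \<notin> set_pmf (mdp_trans N s a)"
        using False by auto
      then show ?thesis by (simp add: set_pmf_iff)
    qed
  qed
qed

end

theory Submission
  imports Defs
begin

text \<open>Describe a strategy by the probability \<open>m w\<close> that the finite path \<open>w\<close> from the
  initial state is taken. Such masses are characterised by linear equations. For a flat
  window formula, the condition at \<open>w\<close> multiplied by \<open>m w\<close> is a positive Boolean combination of
  homogeneous linear inequalities in the masses of the extensions of \<open>w\<close>, and it holds trivially
  if \<open>w\<close> is unreachable. All inequalities being non-strict, compactness of \<open>[0, 1]\<^sup>\<nat>\<close> shows
  that the system is solvable iff for every \<open>K\<close> its constraints up to depth \<open>K\<close> have a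
  solution in multiples of \<open>1 / K\<close>, each inequality being relaxed by the sum of the absolute
  values of its coefficients divided by \<open>K\<close>: rounding a solution down to the grid costs no more
  than that, and the relaxations vanish in the limit. The test for \<open>K\<close> is a finite search, so an
  instance without a strategy is recognised by a \<open>K\<close> that fails.\<close>

section \<open>Computable functions\<close>

text \<open>The unknowns are masses of paths rather than the probabilities chosen by the strategy. A
  mass is a product of choices, so in terms of the choices a window condition is a polynomial; in
  terms of masses it is linear with integer coefficients, and the cost of rounding to a grid can be
  read off these. Conditional probabilities are quotients of masses. Clearing the denominator also
  removes the case distinction on whether a history is reachable, which would not survive a limit.
  Flatness makes the set of extensions of \<open>w\<close> that count for a path formula independent
  of the strategy, and the finite horizon makes it finite; with nesting this set would itself depend
  on the masses. A disjunction may be met through different disjuncts for different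
  \<open>K\<close>, but each constraint has finitely many of them, so one survives the limit.
  Everything tested for \<open>K\<close> lives in the natural numbers: masses are scaled by
  \<open>K\<close>, coefficients are split into two parts. Numbers that encode no instance belong to
  the complement as well, so the test also has to recognise exactly the codes of instances.\<close>

definition recursive :: "nat \<Rightarrow> (nat list \<Rightarrow> nat) \<Rightarrow> bool" where
  "recursive n F \<longleftrightarrow> (\<exists>r. \<forall>xs. length xs = n \<longrightarrow> rec_eval r xs (F xs))"

lemma recursive_cong:
  assumes "recursive n F" "\<And>xs. length xs = n \<Longrightarrow> F xs = G xs"
  shows "recursive n G"
  using assms unfolding recursive_def by metis

lemma recursive_zero: "recursive n (\<lambda>xs. 0)"
  unfolding recursive_def by (auto intro: rec_eval.Zero)

lemma recursive_nth: "i < n \<Longrightarrow> recursive n (\<lambda>xs. xs ! i)"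
  unfolding recursive_def by (auto intro!: exI[of _ "Proj i"] rec_eval.Proj)

lemma recursive_compose:
  assumes F: "recursive (length Gs) F" and G: "\<forall>G\<in>set Gs. recursive n G"
  shows "recursive n (\<lambda>xs. F (map (\<lambda>G. G xs) Gs))"
proof -
  obtain r where r: "\<And>xs. length xs = length Gs \<Longrightarrow> rec_eval r xs (F xs)"
    using F by (auto simp: recursive_def)
  obtain q where q: "\<And>G xs. G \<in> set Gs \<Longrightarrow> length xs = n \<Longrightarrow> rec_eval (q G) xs (G xs)"
    using G unfolding recursive_def by metis
  have "rec_eval (Comp r (map q Gs)) xs (F (map (\<lambda>G. G xs) Gs))" if "length xs = n" for xs
    by (rule rec_eval.Comp[OF _ r]) (use that q in \<open>auto simp: list_all2_conv_all_nth\<close>)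
  then show ?thesis unfolding recursive_def by blast
qed

lemma recursive_compose1:
  assumes "recursive (Suc 0) F" "recursive n G"
  shows "recursive n (\<lambda>xs. F [G xs])"
  using recursive_compose[of "[G]" F n] assms by simp

lemma recursive_compose2:
  assumes "recursive 2 F" "recursive n G" "recursive n H"
  shows "recursive n (\<lambda>xs. F [G xs, H xs])"
  using recursive_compose[of "[G, H]" F n] assms by (simp add: numeral_2_eq_2)

lemma recursive_Suc:
  assumes "recursive n F"
  shows "recursive n (\<lambda>xs. Suc (F xs))"
proof -
  have "recursive (Suc 0) (\<lambda>xs. Suc (hd xs))"
    unfolding recursive_def
    by (rule exI[of _ Succ]) (auto simp: length_Suc_conv intro: rec_eval.Succ)
  from recursive_compose1[OF this assms] show ?thesis by simp
qed

lemma recursive_const: "recursive n (\<lambda>xs. c)"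
  by (induction c) (auto intro: recursive_zero recursive_Suc)

lemma recursive_rec_nat:
  assumes F: "recursive n F" and G: "recursive (Suc (Suc n)) G" and N: "recursive n N"
  shows "recursive n (\<lambda>xs. rec_nat (F xs) (\<lambda>i r. G (i # r # xs)) (N xs))"
proof -
  obtain f where f: "\<And>xs. length xs = n \<Longrightarrow> rec_eval f xs (F xs)"
    using F by (auto simp: recursive_def)
  obtain g where g: "\<And>xs. length xs = Suc (Suc n) \<Longrightarrow> rec_eval g xs (G xs)"
    using G by (auto simp: recursive_def)
  have "rec_eval (PRec f g) (k # xs) (rec_nat (F xs) (\<lambda>i r. G (i # r # xs)) k)"
    if "length xs = n" for xs k
    by (induction k) (use that in \<open>auto intro!: rec_eval.PRec_0 f rec_eval.PRec_Suc g\<close>)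
  \<comment> \<open>\<open>H\<close> takes the bound as the head of its argument list, where
    \<open>PRec\<close> recurses; substituting \<open>N xs\<close> and the projections afterwards
    gives the claim.\<close>
  moreover define H where "H ys = rec_nat (F (tl ys)) (\<lambda>i r. G (i # r # tl ys)) (hd ys)" for ys
  ultimately have "recursive (Suc n) H"
    unfolding recursive_def by (intro exI[of _ "PRec f g"]) (auto simp: length_Suc_conv)
  then have "recursive n (\<lambda>xs. H (N xs # map (\<lambda>i. xs ! i) [0..<n]))"
    using recursive_compose[of "N # map (\<lambda>i xs. xs ! i) [0..<n]" H n] N
    by (simp add: recursive_nth comp_def)
  then show ?thesis
    by (rule recursive_cong) (auto simp: H_def map_nth)
qed

text \<open>\<open>Mu\<close> demands convergence to a nonzero value everywhere below the result;
  totality of \<open>F\<close> and minimality provide it.\<close>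

lemma recursive_Least:
  assumes F: "recursive (Suc n) F" and ex: "\<And>xs. length xs = n \<Longrightarrow> \<exists>y. F (y # xs) = 0"
  shows "recursive n (\<lambda>xs. LEAST y. F (y # xs) = 0)"
proof -
  obtain f where f: "\<And>xs. length xs = Suc n \<Longrightarrow> rec_eval f xs (F xs)"
    using F by (auto simp: recursive_def)
  have "rec_eval (Mu f) xs (LEAST y. F (y # xs) = 0)" if l: "length xs = n" for xs
  proof (rule rec_eval.Mu)
    show "rec_eval f ((LEAST y. F (y # xs) = 0) # xs) 0"
      using f[of "(LEAST y. F (y # xs) = 0) # xs"] LeastI_ex[OF ex[OF l]] l by simp
    show "\<forall>i<LEAST y. F (y # xs) = 0. \<exists>k. rec_eval f (i # xs) (Suc k)"
    proof (intro allI impI)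
      fix i assume "i < (LEAST y. F (y # xs) = 0)"
      then have "F (i # xs) \<noteq> 0" by (rule not_less_Least)
      then show "\<exists>k. rec_eval f (i # xs) (Suc k)"
        using f[of "i # xs"] l by (metis length_Cons not0_implies_Suc)
    qed
  qed
  then show ?thesis unfolding recursive_def by blast
qed

lemma recursive_add:
  assumes "recursive n F" "recursive n G"
  shows "recursive n (\<lambda>xs. F xs + G xs)"
proof -
  have "recursive n (\<lambda>xs. rec_nat (F xs) (\<lambda>i r. Suc ((i # r # xs) ! 1)) (G xs))"
    by (rule recursive_rec_nat[OF assms(1) _ assms(2)]) (intro recursive_Suc recursive_nth, simp)
  moreover have "rec_nat a (\<lambda>i. Suc) b = a + b" for a b by (induction b) auto
  ultimately show ?thesis by simp
qed

lemma recursive_mult: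
  assumes "recursive n F" "recursive n G"
  shows "recursive n (\<lambda>xs. F xs * G xs)"
proof -
  have "recursive 2 (\<lambda>xs. rec_nat 0 (\<lambda>i r. (i # r # xs) ! 1 + (i # r # xs) ! 2) (xs ! 1))"
    by (intro recursive_rec_nat recursive_add recursive_zero recursive_nth) auto
  moreover have "rec_nat 0 (\<lambda>i r. r + a) b = a * b" for a b :: nat by (induction b) auto
  ultimately have "recursive 2 (\<lambda>xs. xs ! 0 * xs ! 1)"
    by (simp add: numeral_2_eq_2)
  from recursive_compose2[OF this assms] show ?thesis by simp
qed

lemma recursive_diff:
  assumes "recursive n F" "recursive n G"
  shows "recursive n (\<lambda>xs. F xs - G xs)"
proof -
  \<comment> \<open>Returning the counter instead of the accumulator computes the predecessor, which
    is then iterated.\<close>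
  have "recursive (Suc 0) (\<lambda>xs. rec_nat 0 (\<lambda>i r. (i # r # xs) ! 0) (xs ! 0))"
    by (intro recursive_rec_nat recursive_zero recursive_nth) auto
  moreover have "rec_nat 0 (\<lambda>i r. i) b = b - 1" for b :: nat by (induction b) auto
  ultimately have pred: "recursive (Suc 0) (\<lambda>xs. xs ! 0 - 1)"
    by simp
  have "recursive n (\<lambda>xs. rec_nat (F xs) (\<lambda>i r. (i # r # xs) ! 1 - 1) (G xs))"
    using recursive_compose1[OF pred recursive_nth[of 1 "Suc (Suc n)"]]
    by (intro recursive_rec_nat[OF assms(1) _ assms(2)]) simp
  moreover have "rec_nat a (\<lambda>i r. r - 1) b = a - b" for a b :: nat by (induction b) auto
  ultimately show ?thesis by simp
qed

lemma recursive_triangle: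
  assumes "recursive n F"
  shows "recursive n (\<lambda>xs. triangle (F xs))"
proof -
  have "recursive n (\<lambda>xs. rec_nat 0 (\<lambda>i r. (i # r # xs) ! 1 + Suc ((i # r # xs) ! 0)) (F xs))"
    by (intro recursive_rec_nat recursive_add recursive_Suc recursive_zero recursive_nth assms) auto
  moreover have "rec_nat 0 (\<lambda>i r. r + Suc i) b = triangle b" for b by (induction b) auto
  ultimately show ?thesis by simp
qed

lemma recursive_prod_encode:
  assumes "recursive n F" "recursive n G"
  shows "recursive n (\<lambda>xs. prod_encode (F xs, G xs))"
  unfolding prod_encode_def prod.case by (intro recursive_add recursive_triangle assms)

text \<open>On the diagonal \<open>a + b\<close> the pairing function takes values from
  \<open>triangle (a + b)\<close> up to \<open>triangle (Suc (a + b)) - 1\<close>. So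
  \<open>a + b\<close> is the first \<open>k\<close> with
  \<open>prod_encode (a, b) < triangle (Suc k)\<close>, expressed here by a truncated
  difference.\<close>

lemma Least_triangle:
  "(LEAST k. Suc (prod_encode (a, b)) - triangle (Suc k) = 0) = a + b"
proof (rule Least_equality)
  have mono: "i \<le> j \<Longrightarrow> triangle i \<le> triangle j" for i j
    by (induction rule: dec_induct) auto
  fix k assume "Suc (prod_encode (a, b)) - triangle (Suc k) = 0"
  then have "triangle (a + b) < triangle (Suc k)" by (simp add: prod_encode_def)
  then show "a + b \<le> k" using mono[of "Suc k" "a + b"] by (meson leD not_less_eq_eq)
qed (simp add: prod_encode_def)

lemma recursive_prod_decode:
  assumes "recursive n F"
  shows "recursive n (\<lambda>xs. fst (prod_decode (F xs)))" "recursive n (\<lambda>xs. snd (prod_decode (F xs)))"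
proof -
  let ?k = "\<lambda>xs. LEAST k. Suc ((k # xs) ! 1) - triangle (Suc ((k # xs) ! 0)) = 0"
  \<comment> \<open>The search stops at \<open>k = x\<close> at the latest, since
    \<open>triangle (Suc x) = triangle x + Suc x\<close>.\<close>
  have k: "recursive (Suc 0) ?k"
    by (intro recursive_Least recursive_diff recursive_Suc recursive_triangle recursive_nth)
      (auto intro: exI[of _ "xs ! 0" for xs] trans_le_add2)
  have k_eq: "?k [x] = fst (prod_decode x) + snd (prod_decode x)" for x
    using Least_triangle[of "fst (prod_decode x)" "snd (prod_decode x)"] by simp
  have x: "x = triangle (fst (prod_decode x) + snd (prod_decode x)) + fst (prod_decode x)" for x
    using prod_decode_inverse[of x] by (simp add: prod_encode_def split: prod.splits)
  have fst_eq: "x - triangle (?k [x]) = fst (prod_decode x)" for x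
    unfolding k_eq by (subst x) simp
  have k': "recursive n (\<lambda>xs. ?k [F xs])"
    by (rule recursive_compose1[OF k assms])
  have "recursive n (\<lambda>xs. F xs - triangle (?k [F xs]))"
    by (intro recursive_diff recursive_triangle assms k')
  then show fst: "recursive n (\<lambda>xs. fst (prod_decode (F xs)))"
    unfolding fst_eq .
  have "recursive n (\<lambda>xs. ?k [F xs] - fst (prod_decode (F xs)))"
    by (intro recursive_diff k' fst)
  then show "recursive n (\<lambda>xs. snd (prod_decode (F xs)))"
    unfolding k_eq by simp
qed

section \<open>Injective codes of typed data\<close>

class encodable =
  fixes enc :: "'a \<Rightarrow> nat"
  assumes enc_eq_iff [simp]: "enc x = enc y \<longleftrightarrow> x = y"

instantiation nat :: encodable
begin
definition enc_nat :: "nat \<Rightarrow> nat" where [simp]: "enc_nat n = n"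
instance by standard simp
end

instantiation bool :: encodable
begin
definition enc_bool :: "bool \<Rightarrow> nat" where [simp]: "enc_bool b = of_bool b"
instance by standard simp
end

instantiation prod :: (encodable, encodable) encodable
begin
definition enc_prod :: "'a \<times> 'b \<Rightarrow> nat" where
  [simp]: "enc_prod z = prod_encode (enc (fst z), enc (snd z))"
instance by standard (simp add: prod_eq_iff)
end

text \<open>Codes of lists of numbers have to agree with \<open>list_encode\<close>, and those of
  pairs with \<open>prod_encode\<close>, because instances are encoded by these functions; decoding
  then acts as the identity on codes.\<close>

instantiation list :: (encodable) encodable
begin
definition enc_list :: "'a list \<Rightarrow> nat" where
  "enc_list xs = list_encode (map enc xs)"
instance
proof
  fix xs ys :: "'a list"
  have "inj (enc :: 'a \<Rightarrow> nat)" by (simp add: inj_def)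
  then show "enc xs = enc ys \<longleftrightarrow> xs = ys"
    by (simp add: enc_list_def list_encode_eq inj_map_eq_map)
qed
end

lemma enc_Nil [simp]: "enc [] = 0"
  and enc_Cons [simp]: "enc (x # xs) = Suc (prod_encode (enc x, enc xs))"
  by (simp_all add: enc_list_def)

lemma enc_nat_list: "enc (xs :: nat list) = list_encode xs"
  by (simp add: enc_list_def enc_nat_def[abs_def])

text \<open>Lets the code of a list serve as a number of iterations that is enough to traverse
  it.\<close>

lemma length_le_enc: "length xs \<le> enc xs"
  by (induction xs) (auto intro: le_trans le_prod_encode_2)

text \<open>Closure under substitution in every arity is the form in which realisers are used;
  \<open>computableI\<close> obtains it from the unary case by composition.\<close>

definition recursive1 :: "(nat \<Rightarrow> nat) \<Rightarrow> bool" where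
  "recursive1 g \<longleftrightarrow> (\<forall>n F. recursive n F \<longrightarrow> recursive n (\<lambda>xs. g (F xs)))"

lemma recursive1D: "recursive1 g \<Longrightarrow> recursive n F \<Longrightarrow> recursive n (\<lambda>xs. g (F xs))"
  by (simp add: recursive1_def)

text \<open>Only the values of \<open>g\<close> on codes matter; on numbers that encode no value a
  realiser may do anything.\<close>

definition computable :: "('a :: encodable \<Rightarrow> 'b :: encodable) \<Rightarrow> bool" where
  "computable f \<longleftrightarrow> (\<exists>g. recursive1 g \<and> (\<forall>x. g (enc x) = enc (f x)))"

section \<open>Closure rules for computable functions\<close>

named_theorems computable_intros

lemma computableI:
  assumes "recursive (Suc 0) (\<lambda>xs. g (xs ! 0))" "\<And>x. g (enc x) = enc (f x)"
  shows "computable f"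
  using recursive_compose1[OF assms(1)] assms(2) unfolding computable_def recursive1_def
  by (intro exI[of _ g]) simp

lemma recursive_arg: "recursive (Suc 0) (\<lambda>xs. xs ! 0)"
  by (rule recursive_nth) simp

lemma computable_compose:
  assumes "computable f" "computable g"
  shows "computable (\<lambda>x. f (g x))"
proof -
  from assms obtain f' g' where
    "recursive1 f'" "\<And>x. f' (enc x) = enc (f x)"
    "recursive1 g'" "\<And>x. g' (enc x) = enc (g x)"
    unfolding computable_def by blast
  then show ?thesis
    by (intro computableI[of "\<lambda>n. f' (g' n)"])
      (simp_all add: recursive1D[of f'] recursive1D[of g'] recursive_arg)
qed

text \<open>This rule and the following ones let every argument depend on \<open>x\<close>, so that
  a term with parameters is processed from its head symbol inwards.\<close>

lemma computable_id [computable_intros]: "computable (\<lambda>x. x)"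
  by (rule computableI[of "\<lambda>x. x"]) (auto intro: recursive1D recursive_arg)

lemma computable_const [computable_intros]: "computable (\<lambda>x. c)"
  by (rule computableI[of "\<lambda>x. enc c"]) (simp_all add: recursive_const)

lemma computable_Pair [computable_intros]:
  assumes "computable f" "computable g"
  shows "computable (\<lambda>x. (f x, g x))"
proof -
  from assms obtain f' g' where
    "recursive1 f'" "\<And>x. f' (enc x) = enc (f x)"
    "recursive1 g'" "\<And>x. g' (enc x) = enc (g x)"
    unfolding computable_def by blast
  then show ?thesis
    by (intro computableI[of "\<lambda>n. prod_encode (f' n, g' n)"] recursive_prod_encode)
      (auto intro: recursive1D recursive_arg)
qed

lemma computable_fst [computable_intros]:
  assumes "computable f" shows "computable (\<lambda>x. fst (f x))"
proof -
  have "computable (fst :: 'b \<times> 'c \<Rightarrow> 'b)"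
    by (rule computableI[of "\<lambda>n. fst (prod_decode n)"]) (simp_all add: recursive_prod_decode recursive_arg)
  from computable_compose[OF this assms] show ?thesis .
qed

lemma computable_snd [computable_intros]:
  assumes "computable f" shows "computable (\<lambda>x. snd (f x))"
proof -
  have "computable (snd :: 'b \<times> 'c \<Rightarrow> 'c)"
    by (rule computableI[of "\<lambda>n. snd (prod_decode n)"]) (simp_all add: recursive_prod_decode recursive_arg)
  from computable_compose[OF this assms] show ?thesis .
qed

lemma computable_compose2:
  assumes "computable (\<lambda>z. f (fst z) (snd z))" "computable g" "computable h"
  shows "computable (\<lambda>x. f (g x) (h x))"
  using computable_compose[OF assms(1) computable_Pair[OF assms(2,3)]] by simp

lemma computable_compose3:
  assumes "computable (\<lambda>z. f (fst z) (fst (snd z)) (snd (snd z)))"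
    "computable g" "computable h" "computable k"
  shows "computable (\<lambda>x. f (g x) (h x) (k x))"
  using computable_compose[OF assms(1) computable_Pair[OF assms(2) computable_Pair[OF assms(3,4)]]]
  by simp

lemma computable_compose4:
  assumes "computable (\<lambda>z. f (fst z) (fst (snd z)) (fst (snd (snd z))) (snd (snd (snd z))))"
    "computable g" "computable h" "computable k" "computable l"
  shows "computable (\<lambda>x. f (g x) (h x) (k x) (l x))"
  using computable_compose[OF assms(1) computable_Pair[OF assms(2) computable_Pair[OF assms(3)
    computable_Pair[OF assms(4,5)]]]]
  by simp

lemma computable_Suc [computable_intros]:
  assumes "computable f" shows "computable (\<lambda>x. Suc (f x))"
proof -
  have "computable Suc"
    by (rule computableI[of Suc]) (simp_all add: recursive_arg recursive_Suc)
  from computable_compose[OF this assms] show ?thesis .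
qed

lemma computable_plus [computable_intros]:
  fixes f g :: "_ \<Rightarrow> nat"
  assumes "computable f" "computable g" shows "computable (\<lambda>x. f x + g x)"
proof (rule computable_compose2[of "(+)", OF _ assms])
  show "computable (\<lambda>z :: nat \<times> nat. fst z + snd z)"
    by (rule computableI[of "\<lambda>n. fst (prod_decode n) + snd (prod_decode n)"])
      (simp_all add: recursive_prod_decode recursive_arg recursive_add)
qed

lemma computable_times [computable_intros]:
  fixes f g :: "_ \<Rightarrow> nat"
  assumes "computable f" "computable g" shows "computable (\<lambda>x. f x * g x)"
proof (rule computable_compose2[of "(*)", OF _ assms])
  show "computable (\<lambda>z :: nat \<times> nat. fst z * snd z)"
    by (rule computableI[of "\<lambda>n. fst (prod_decode n) * snd (prod_decode n)"])
      (simp_all add: recursive_prod_decode recursive_arg recursive_mult)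
qed

lemma computable_minus [computable_intros]:
  fixes f g :: "_ \<Rightarrow> nat"
  assumes "computable f" "computable g" shows "computable (\<lambda>x. f x - g x)"
proof (rule computable_compose2[of "(-)", OF _ assms])
  show "computable (\<lambda>z :: nat \<times> nat. fst z - snd z)"
    by (rule computableI[of "\<lambda>n. fst (prod_decode n) - snd (prod_decode n)"])
      (simp_all add: recursive_prod_decode recursive_arg recursive_diff)
qed

lemma computable_enc [computable_intros]:
  assumes "computable f" shows "computable (\<lambda>x. enc (f x))"
  using assms unfolding computable_def by simp

text \<open>Truth values have the codes 0 and 1, so the choice is a weighted sum; evaluating both
  branches is harmless because realisers are total.\<close>

lemma computable_if [computable_intros]:
  assumes "computable b" "computable f" "computable g"
  shows "computable (\<lambda>x. if b x then f x else g x)"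
proof -
  from assms obtain b' f' g' where
    "recursive1 b'" "\<And>x. b' (enc x) = enc (b x)"
    "recursive1 f'" "\<And>x. f' (enc x) = enc (f x)"
    "recursive1 g'" "\<And>x. g' (enc x) = enc (g x)"
    unfolding computable_def by blast
  then show ?thesis
    by (intro computableI[of "\<lambda>n. b' n * f' n + (1 - b' n) * g' n"]
        recursive_add recursive_mult recursive_diff recursive_const) (auto intro: recursive1D recursive_arg)
qed

lemma computable_less [computable_intros]:
  fixes f g :: "_ \<Rightarrow> nat"
  assumes "computable f" "computable g" shows "computable (\<lambda>x. f x < g x)"
proof (rule computable_compose2[of "(<)", OF _ assms])
  have "recursive (Suc 0) (\<lambda>xs. 1 - (Suc (fst (prod_decode (xs ! 0))) - snd (prod_decode (xs ! 0))))"
    by (intro recursive_diff recursive_Suc recursive_const recursive_prod_decode recursive_arg)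
  then show "computable (\<lambda>z :: nat \<times> nat. fst z < snd z)"
    by (rule computableI[of "\<lambda>n. 1 - (Suc (fst (prod_decode n)) - snd (prod_decode n))"]) auto
qed

lemma computable_not [computable_intros]:
  assumes "computable P" shows "computable (\<lambda>x. \<not> P x)"
proof -
  have "(\<lambda>x. \<not> P x) = (\<lambda>x. if P x then False else True)" by auto
  then show ?thesis using assms by (simp only:) (intro computable_if computable_const)
qed

lemma computable_conj [computable_intros]:
  assumes "computable P" "computable Q" shows "computable (\<lambda>x. P x \<and> Q x)"
proof -
  have "(\<lambda>x. P x \<and> Q x) = (\<lambda>x. if P x then Q x else False)" by auto
  then show ?thesis using assms by (simp only:) (intro computable_intros)
qed

lemma computable_disj [computable_intros]:
  assumes "computable P" "computable Q" shows "computable (\<lambda>x. P x \<or> Q x)"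
proof -
  have "(\<lambda>x. P x \<or> Q x) = (\<lambda>x. if P x then True else Q x)" by auto
  then show ?thesis using assms by (simp only:) (intro computable_intros)
qed

lemma computable_imp [computable_intros]:
  assumes "computable P" "computable Q" shows "computable (\<lambda>x. P x \<longrightarrow> Q x)"
  unfolding imp_conv_disj by (intro computable_intros assms)

lemma computable_le [computable_intros]:
  fixes f g :: "_ \<Rightarrow> nat"
  assumes "computable f" "computable g" shows "computable (\<lambda>x. f x \<le> g x)"
  unfolding not_less[symmetric] by (intro computable_intros assms)

text \<open>Injectivity of the codes reduces equality in any encodable type to two comparisons of
  numbers.\<close>

lemma computable_eq [computable_intros]:
  assumes "computable f" "computable g" shows "computable (\<lambda>x. f x = g x)"
proof -
  have "(\<lambda>x. f x = g x) = (\<lambda>x. enc (f x) \<le> enc (g x) \<and> enc (g x) \<le> enc (f x))"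
    by (metis enc_eq_iff order_antisym order_refl)
  then show ?thesis using assms by (simp only:) (intro computable_intros)
qed

text \<open>The parameter \<open>x\<close> travels inside the code of the triple
  \<open>(x, i, r)\<close>, so the step function may depend on it.\<close>

lemma computable_rec_nat [computable_intros]:
  assumes f: "computable f" and g: "computable (\<lambda>z. g (fst z) (fst (snd z)) (snd (snd z)))"
    and n: "computable n"
  shows "computable (\<lambda>x. rec_nat (f x) (g x) (n x))"
proof -
  from f g n obtain f' g' n' where
    f': "recursive1 f'" "\<And>x. f' (enc x) = enc (f x)" and
    g': "recursive1 g'" "\<And>z. g' (enc z) = enc (g (fst z) (fst (snd z)) (snd (snd z)))" and
    n': "recursive1 n'" "\<And>x. n' (enc x) = enc (n x)"
    unfolding computable_def by blast
  let ?h = "\<lambda>x. rec_nat (f' x) (\<lambda>i r. g' (prod_encode (x, prod_encode (i, r)))) (n' x)"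
  have "recursive (Suc 0) (\<lambda>xs. rec_nat (f' (xs ! 0)) (\<lambda>i r. g' (prod_encode ((i # r # xs) ! 2,
      prod_encode ((i # r # xs) ! 0, (i # r # xs) ! 1)))) (n' (xs ! 0)))"
    by (intro recursive_rec_nat recursive1D[OF f'(1)] recursive1D[OF g'(1)] recursive1D[OF n'(1)] recursive_prod_encode recursive_nth) auto
  then have "recursive (Suc 0) (\<lambda>xs. ?h (xs ! 0))" by (simp add: numeral_2_eq_2)
  moreover have "rec_nat (f' (enc x)) (\<lambda>i r. g' (prod_encode (enc x, prod_encode (i, r)))) k
      = enc (rec_nat (f x) (g x) k)" for x k
    by (induction k) (use f'(2) g'(2)[of "(x, i, r)" for i r] in simp_all)
  ultimately show ?thesis
    by (intro computableI[of ?h]) (simp_all add: n'(2))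
qed

lemma computable_div [computable_intros]:
  fixes f g :: "_ \<Rightarrow> nat"
  assumes "computable f" "computable g" shows "computable (\<lambda>x. f x div g x)"
proof -
  \<comment> \<open>The recursion counts which of the first \<open>k\<close> positive multiples of
    \<open>m\<close> do not exceed \<open>n\<close>; \<open>n\<close> rounds are enough because
    \<open>n div m \<le> n\<close>.\<close>
  have "rec_nat 0 (\<lambda>i r. if Suc i * m \<le> n then Suc r else r) k = min k (n div m)"
    if "m > 0" for m n k :: nat
  proof (induction k)
    case (Suc k)
    have "Suc k * m \<le> n \<longleftrightarrow> Suc k \<le> n div m"
      using that by (metis less_eq_div_iff_mult_less_eq)
    with Suc show ?case by auto
  qed simp
  then have "n div m = (if m = 0 then 0 else rec_nat 0 (\<lambda>i r. if Suc i * m \<le> n then Suc r else r) n)"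
    for m n :: nat
    by (auto simp: div_le_dividend)
  then have "(\<lambda>x. f x div g x) = (\<lambda>x. if g x = 0 then 0 else
      rec_nat 0 (\<lambda>i r. if Suc i * g x \<le> f x then Suc r else r) (f x))"
    by blast
  moreover have "computable \<dots>"
    by (intro computable_intros computable_compose[OF assms(1)] computable_compose[OF assms(2)] assms)
  ultimately show ?thesis by simp
qed

lemma computable_mod [computable_intros]:
  fixes f g :: "_ \<Rightarrow> nat"
  assumes "computable f" "computable g" shows "computable (\<lambda>x. f x mod g x)"
  unfolding modulo_nat_def by (intro computable_intros assms)

lemma computable_power [computable_intros]:
  fixes f g :: "_ \<Rightarrow> nat"
  assumes "computable f" "computable g" shows "computable (\<lambda>x. f x ^ g x)"
proof -
  have "a ^ b = rec_nat 1 (\<lambda>i r. a * r) b" for a b :: nat by (induction b) auto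
  then show ?thesis
    by (simp only:) (intro computable_intros computable_compose[OF assms(1)] assms)
qed

lemma computable_case_list [computable_intros]:
  assumes l: "computable l" and a: "computable a"
    and b: "computable (\<lambda>z. b (fst z) (fst (snd z)) (snd (snd z)))"
  shows "computable (\<lambda>x. case l x of [] \<Rightarrow> a x | y # ys \<Rightarrow> b x y ys)"
proof -
  from l a b obtain l' a' b' where
    l': "recursive1 l'" "\<And>x. l' (enc x) = enc (l x)" and
    a': "recursive1 a'" "\<And>x. a' (enc x) = enc (a x)" and
    b': "recursive1 b'" "\<And>z. b' (enc z) = enc (b (fst z) (fst (snd z)) (snd (snd z)))"
    unfolding computable_def by blast
  \<comment> \<open>The empty list has code 0, and \<open>y # ys\<close> has the successor of the
    code of \<open>(y, ys)\<close>. So \<open>1 - l' n\<close> tests for the empty list, and the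
    predecessor of a nonzero code is the pair of head and tail.\<close>
  let ?h = "\<lambda>n. (1 - l' n) * a' n + (1 - (1 - l' n)) * b' (prod_encode (n, l' n - 1))"
  have "recursive (Suc 0) (\<lambda>xs. ?h (xs ! 0))"
    by (intro recursive_add recursive_mult recursive_diff recursive_const recursive1D[OF l'(1)]
        recursive1D[OF a'(1)] recursive1D[OF b'(1)] recursive_prod_encode recursive_arg)
  then show ?thesis
    by (rule computableI)
      (use l'(2) a'(2) b'(2)[of "(x, y, ys)" for x y ys] in \<open>simp split: list.split\<close>)
qed

lemma computable_Cons [computable_intros]:
  assumes "computable f" "computable g"
  shows "computable (\<lambda>x. f x # g x)"
proof -
  from assms obtain f' g' where
    "recursive1 f'" "\<And>x. f' (enc x) = enc (f x)"
    "recursive1 g'" "\<And>x. g' (enc x) = enc (g x)"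
    unfolding computable_def by blast
  then show ?thesis
    by (intro computableI[of "\<lambda>n. Suc (prod_encode (f' n, g' n))"] recursive_prod_encode recursive_Suc)
      (auto intro: recursive1D recursive_arg)
qed

text \<open>Iterates on the pair of remaining list and accumulator. The step is idle once the list
  is used up, so it may be run \<open>enc (l x)\<close> times, which is at least the length.\<close>

lemma computable_fold:
  assumes f: "computable (\<lambda>z. f (fst z) (fst (snd z)) (snd (snd z)))"
    and l: "computable l" and a: "computable a"
  shows "computable (\<lambda>x. fold (f x) (l x) (a x))"
proof -
  let ?step = "\<lambda>x z. case fst z of [] \<Rightarrow> z | y # ys \<Rightarrow> (ys, f x y (snd z))"
  have "rec_nat (xs, r) (\<lambda>i. ?step x) k = (drop k xs, fold (f x) (take k xs) r)" for x xs r k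
  proof (induction k)
    case (Suc k)
    show ?case
    proof (cases "k < length xs")
      case True
      then have "drop k xs = xs ! k # drop (Suc k) xs" by (rule Cons_nth_drop_Suc[symmetric])
      with True Suc show ?thesis by (simp add: take_Suc_conv_app_nth)
    qed (use Suc in simp)
  qed simp
  then have "fold (f x) xs r = snd (rec_nat (xs, r) (\<lambda>i. ?step x) (enc xs))" for x xs r
    by (simp add: length_le_enc)
  then have "(\<lambda>x. fold (f x) (l x) (a x)) = (\<lambda>x. snd (rec_nat (l x, a x) (\<lambda>i. ?step x) (enc (l x))))"
    by blast
  moreover have "computable \<dots>"
    by (intro computable_intros computable_compose3[OF f] assms)
  ultimately show ?thesis by simp
qed

lemma computable_rev [computable_intros]:
  assumes "computable l" shows "computable (\<lambda>x. rev (l x))"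
proof -
  have "rev xs = fold (\<lambda>y ys. y # ys) xs []" for xs :: "'b list" by (simp add: rev_conv_fold)
  then show ?thesis
    by (simp only:) (intro computable_fold computable_intros assms)
qed

lemma computable_foldr [computable_intros]:
  assumes f: "computable (\<lambda>z. f (fst z) (fst (snd z)) (snd (snd z)))"
    and l: "computable l" and a: "computable a"
  shows "computable (\<lambda>x. foldr (f x) (l x) (a x))"
  unfolding foldr_conv_fold by (intro computable_fold computable_intros assms)

lemma computable_map [computable_intros]:
  assumes f: "computable (\<lambda>z. f (fst z) (snd z))" and l: "computable l"
  shows "computable (\<lambda>x. map (f x) (l x))"
proof -
  have "map g xs = foldr (\<lambda>y ys. g y # ys) xs []" for g :: "'b \<Rightarrow> 'c" and xs
    by (induction xs) auto
  then show ?thesis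
    by (simp only:) (intro computable_intros computable_compose2[OF f] l)
qed

lemma computable_append [computable_intros]:
  assumes "computable f" "computable g" shows "computable (\<lambda>x. f x @ g x)"
proof -
  have "xs @ ys = foldr (\<lambda>z zs. z # zs) xs ys" for xs ys :: "'b list"
    by (induction xs) auto
  then show ?thesis by (simp only:) (intro computable_intros assms)
qed

lemma computable_concat [computable_intros]:
  assumes "computable f" shows "computable (\<lambda>x. concat (f x))"
proof -
  have "concat xs = foldr (\<lambda>z zs. z @ zs) xs []" for xs :: "'b list list"
    by (induction xs) auto
  then show ?thesis by (simp only:) (intro computable_intros assms)
qed

lemma computable_filter [computable_intros]:
  assumes P: "computable (\<lambda>z. P (fst z) (snd z))" and l: "computable l"
  shows "computable (\<lambda>x. filter (P x) (l x))"
proof -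
  have "filter Q xs = foldr (\<lambda>y ys. if Q y then y # ys else ys) xs []" for Q :: "'b \<Rightarrow> bool" and xs
    by (induction xs) auto
  then show ?thesis
    by (simp only:) (intro computable_intros computable_compose2[OF P] l)
qed

lemma computable_Ball [computable_intros]:
  assumes P: "computable (\<lambda>z. P (fst z) (snd z))" and l: "computable l"
  shows "computable (\<lambda>x. \<forall>y\<in>set (l x). P x y)"
proof -
  have "(\<forall>y\<in>set xs. Q y) = foldr (\<lambda>y r. Q y \<and> r) xs True" for Q :: "'b \<Rightarrow> bool" and xs
    by (induction xs) auto
  then show ?thesis
    by (simp only:) (intro computable_intros computable_compose2[OF P] l)
qed

lemma computable_Bex [computable_intros]:
  assumes P: "computable (\<lambda>z. P (fst z) (snd z))" and l: "computable l"
  shows "computable (\<lambda>x. \<exists>y\<in>set (l x). P x y)"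
proof -
  have "(\<exists>y\<in>set xs. Q y) = foldr (\<lambda>y r. Q y \<or> r) xs False" for Q :: "'b \<Rightarrow> bool" and xs
    by (induction xs) auto
  then show ?thesis
    by (simp only:) (intro computable_intros computable_compose2[OF P] l)
qed

lemma computable_in_set [computable_intros]:
  assumes "computable f" "computable l" shows "computable (\<lambda>x. f x \<in> set (l x))"
proof -
  have "(\<lambda>x. f x \<in> set (l x)) = (\<lambda>x. \<exists>y\<in>set (l x). y = f x)" by auto
  then show ?thesis
    by (simp only:) (intro computable_intros computable_compose[OF assms(1)] assms)
qed

lemma computable_length [computable_intros]:
  assumes "computable l" shows "computable (\<lambda>x. length (l x))"
proof -
  have "length xs = foldr (\<lambda>y r. Suc r) xs 0" for xs :: "'b list"
    by (induction xs) auto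
  then show ?thesis by (simp only:) (intro computable_intros assms)
qed

lemma computable_sum_list [computable_intros]:
  fixes l :: "_ \<Rightarrow> nat list"
  assumes "computable l" shows "computable (\<lambda>x. sum_list (l x))"
proof -
  have "sum_list xs = foldr (\<lambda>y r. y + r) xs 0" for xs :: "nat list"
    by (induction xs) auto
  then show ?thesis by (simp only:) (intro computable_intros assms)
qed

lemma computable_prod_list [computable_intros]:
  fixes l :: "_ \<Rightarrow> nat list"
  assumes "computable l" shows "computable (\<lambda>x. prod_list (l x))"
proof -
  have "prod_list xs = foldr (\<lambda>y r. y * r) xs 1" for xs :: "nat list"
    by (induction xs) auto
  then show ?thesis by (simp only:) (intro computable_intros assms)
qed

lemma computable_upt [computable_intros]:
  assumes "computable n" shows "computable (\<lambda>x. [0..<n x])"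
proof -
  have "[0..<k] = rec_nat [] (\<lambda>i r. r @ [i]) k" for k
    by (induction k) auto
  then show ?thesis by (simp only:) (intro computable_intros assms)
qed

lemma computable_drop [computable_intros]:
  assumes "computable n" "computable l" shows "computable (\<lambda>x. drop (n x) (l x))"
proof -
  have "drop k xs = rec_nat xs (\<lambda>i r. case r of [] \<Rightarrow> [] | y # ys \<Rightarrow> ys) k" for k and xs :: "'b list"
  proof (induction k)
    case (Suc k)
    have "drop (Suc k) xs = tl (drop k xs)" by (simp add: drop_Suc tl_drop)
    also have "\<dots> = (case drop k xs of [] \<Rightarrow> [] | y # ys \<Rightarrow> ys)" by (simp split: list.split)
    finally show ?case using Suc by simp
  qed simp
  then show ?thesis by (simp only:) (intro computable_intros assms)
qed

lemma computable_nth_default [computable_intros]: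
  assumes "computable d" "computable l" "computable n"
  shows "computable (\<lambda>x. nth_default (d x) (l x) (n x))"
proof -
  have "nth_default e xs k = (case drop k xs of [] \<Rightarrow> e | y # ys \<Rightarrow> y)" for e :: 'b and xs k
  proof (cases "k < length xs")
    case True
    from Cons_nth_drop_Suc[OF this, symmetric] True show ?thesis by (simp add: nth_default_def)
  qed (simp add: nth_default_def)
  then show ?thesis by (simp only:) (intro computable_intros assms)
qed

lemma computable_prod_decode [computable_intros]:
  assumes "computable f" shows "computable (\<lambda>x. prod_decode (f x))"
proof -
  have "enc (prod_decode n) = n" for n
    using prod_decode_inverse[of n] by (simp del: prod_decode_inverse)
  then have "computable prod_decode"
    by (intro computableI[of "\<lambda>n. n"]) (simp_all add: recursive_arg del: enc_prod_def)
  from computable_compose[OF this assms] show ?thesis .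
qed

lemma computable_list_decode [computable_intros]:
  assumes "computable f" shows "computable (\<lambda>x. list_decode (f x))"
proof -
  have "computable list_decode"
    by (intro computableI[of "\<lambda>n. n"]) (simp_all add: recursive_arg enc_nat_list)
  from computable_compose[OF this assms] show ?thesis .
qed

section \<open>Course-of-values recursion\<close>

function course_rec :: "(nat \<Rightarrow> 'a list \<Rightarrow> 'a) \<Rightarrow> nat \<Rightarrow> 'a" where
  "course_rec G n = G n (map (course_rec G) [0..<n])"
  by auto
termination by (relation "inv_image less_than snd") auto

declare course_rec.simps [simp del]

lemma nth_default_course_rec:
  "i < n \<Longrightarrow> nth_default d (map (course_rec G) [0..<n]) i = course_rec G i"
  by (simp add: nth_default_def)

text \<open>Appending one value per round builds the table of all earlier values by primitive
  recursion. This carries recursion over formulae to their codes.\<close>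

lemma computable_course_rec [computable_intros]:
  assumes G: "computable (\<lambda>z. G (fst z) (fst (snd z)) (snd (snd z)))" and n: "computable n"
  shows "computable (\<lambda>x. course_rec (G x) (n x))"
proof -
  have "map (course_rec H) [0..<k] = rec_nat [] (\<lambda>i r. r @ [H i r]) k" for H :: "nat \<Rightarrow> 'b list \<Rightarrow> 'b" and k
  proof (induction k)
    case (Suc k)
    then show ?case by (simp add: course_rec.simps[of H k])
  qed simp
  then have "course_rec H k = H k (rec_nat [] (\<lambda>i r. r @ [H i r]) k)" for H :: "nat \<Rightarrow> 'b list \<Rightarrow> 'b" and k
    by (subst course_rec.simps) simp
  then show ?thesis
    by (simp only:) (intro computable_intros computable_compose3[OF G] n)
qed

text \<open>The set is the domain of an unbounded search for a \<open>k\<close> at which the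
  characteristic function of \<open>D x\<close> vanishes; since \<open>D\<close> is decidable, the
  search never gets stuck on the way.\<close>

lemma RE_Collect_not_all:
  fixes D :: "nat \<Rightarrow> nat \<Rightarrow> bool"
  assumes "computable (\<lambda>z. D (fst z) (snd z))"
  shows "RE {x. \<exists>k. \<not> D x k}"
proof -
  from assms obtain d where d: "recursive1 d" "\<And>z. d (enc z) = enc (D (fst z) (snd z))"
    unfolding computable_def by blast
  \<comment> \<open>\<open>Mu\<close> puts the search variable first, so the argument list is
    \<open>[k, x]\<close>.\<close>
  have "recursive 2 (\<lambda>xs. d (prod_encode (xs ! 1, xs ! 0)))"
    by (intro recursive1D[OF d(1)] recursive_prod_encode recursive_nth) auto
  then obtain r where "\<And>xs. length xs = 2 \<Longrightarrow> rec_eval r xs (d (prod_encode (xs ! 1, xs ! 0)))"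
    unfolding recursive_def by blast
  from this[of "[k, x]" for k x] have r: "rec_eval r [k, x] (of_bool (D x k))" for k x
    using d(2)[of "(x, k)"] by (metis One_nat_def enc_bool_def enc_nat_def enc_prod_def fst_conv
      length_Cons list.size(3) nth_Cons_0 nth_Cons_Suc numeral_2_eq_2 snd_conv)
  have "(\<exists>y. rec_eval (Mu r) [x] y) \<longleftrightarrow> (\<exists>k. \<not> D x k)" for x
  proof
    assume "\<exists>y. rec_eval (Mu r) [x] y"
    then obtain k where "rec_eval r [k, x] 0" by (auto elim: rec_evalE)
    from rec_eval_deterministic[OF this r] have "\<not> D x k" by auto
    then show "\<exists>k. \<not> D x k" ..
  next
    assume ex: "\<exists>k. \<not> D x k"
    define k where "k = (LEAST k. \<not> D x k)"
    have "\<not> D x k" unfolding k_def using ex by (rule LeastI_ex)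
    then have "rec_eval r [k, x] 0" using r[of k x] by simp
    moreover have "rec_eval r [i, x] (Suc 0)" if "i < k" for i
      using not_less_Least[OF that[unfolded k_def]] r[of i x] by simp
    ultimately show "\<exists>y. rec_eval (Mu r) [x] y" by (blast intro: rec_eval.Mu)
  qed
  then show ?thesis unfolding RE_def by blast
qed

section \<open>Linear constraint systems with countably many unknowns\<close>

text \<open>A linear form is a list of triples \<open>(p, q, v)\<close>, each standing for \<open>(p - q) v\<close>; it
  denotes the constraint that its value is nonnegative. Boolean combinations of constraints are
  kept in disjunctive normal form.\<close>

type_synonym 'v linear = "(nat \<times> nat \<times> 'v) list"
type_synonym 'v dnf = "'v linear list list"

definition linear_value :: "('v \<Rightarrow> real) \<Rightarrow> 'v linear \<Rightarrow> real" where
  "linear_value m l = (\<Sum>x\<leftarrow>l. (real (fst x) - real (fst (snd x))) * m (snd (snd x)))"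

text \<open>Here \<open>y\<close> stands for masses scaled by \<open>K\<close>, so the permitted
  violation is the plain sum of the coefficient parts. Negative terms stand on the left to keep the
  test within the natural numbers.\<close>

definition relaxed :: "('v \<Rightarrow> nat) \<Rightarrow> 'v linear \<Rightarrow> bool" where
  "relaxed y l \<longleftrightarrow> (\<Sum>x\<leftarrow>l. fst (snd x) * y (snd (snd x))) \<le>
     (\<Sum>x\<leftarrow>l. fst x * y (snd (snd x)) + fst x + fst (snd x))"

definition dnf_sat :: "('v \<Rightarrow> real) \<Rightarrow> 'v dnf \<Rightarrow> bool" where
  "dnf_sat m d \<longleftrightarrow> (\<exists>c\<in>set d. \<forall>l\<in>set c. 0 \<le> linear_value m l)"

definition dnf_relaxed :: "('v \<Rightarrow> nat) \<Rightarrow> 'v dnf \<Rightarrow> bool" where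
  "dnf_relaxed y d \<longleftrightarrow> (\<exists>c\<in>set d. \<forall>l\<in>set c. relaxed y l)"

lemma linear_value_Nil [simp]: "linear_value m [] = 0"
  and linear_value_Cons [simp]:
    "linear_value m ((p, q, v) # l) = (real p - real q) * m v + linear_value m l"
  and linear_value_append: "linear_value m (l @ l') = linear_value m l + linear_value m l'"
  by (simp_all add: linear_value_def)

lemma linear_value_divide: "linear_value (\<lambda>v. m v / c) l = linear_value m l / c"
  by (induction l) (auto simp: add_divide_distrib)

lemma relaxed_iff:
  "relaxed y l \<longleftrightarrow>
     0 \<le> linear_value (\<lambda>v. real (y v)) l + real (\<Sum>x\<leftarrow>l. fst x + fst (snd x))"
proof -
  have "linear_value (\<lambda>v. real (y v)) l + real (\<Sum>x\<leftarrow>l. fst x + fst (snd x)) =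
      real (\<Sum>x\<leftarrow>l. fst x * y (snd (snd x)) + fst x + fst (snd x)) -
      real (\<Sum>x\<leftarrow>l. fst (snd x) * y (snd (snd x)))"
    by (induction l) (auto simp: algebra_simps)
  then show ?thesis by (simp only: relaxed_def diff_ge_0_iff_ge of_nat_le_iff)
qed

text \<open>With \<open>y \<le> K * m v \<le> y + 1\<close>, a positive part \<open>p\<close> loses
  at most \<open>p\<close> by rounding down, while a negative part errs on the safe side.\<close>

lemma relaxed_floor:
  assumes m: "\<And>v. 0 \<le> m v" and l: "0 \<le> linear_value m l"
  shows "relaxed (\<lambda>v. nat \<lfloor>real K * m v\<rfloor>) l"
proof -
  have "real K * linear_value m l \<le> linear_value (\<lambda>v. real (nat \<lfloor>real K * m v\<rfloor>)) l +
      real (\<Sum>x\<leftarrow>l. fst x + fst (snd x))"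
  proof (induction l)
    case (Cons x l)
    obtain p q v where x: "x = (p, q, v)" by (cases x)
    let ?y = "real (nat \<lfloor>real K * m v\<rfloor>)"
    have y: "?y \<le> real K * m v" "real K * m v \<le> ?y + 1"
      using m[of v] by auto
    have "real p * (real K * m v) \<le> real p * (?y + 1)" "real q * ?y \<le> real q * (real K * m v)"
      using y by (auto intro!: mult_left_mono simp del: of_nat_nat)
    then have "real K * ((real p - real q) * m v) \<le> (real p - real q) * ?y + real p + real q"
      by (simp add: algebra_simps)
    with Cons show ?case by (simp add: x distrib_left)
  qed simp
  moreover have "0 \<le> real K * linear_value m l" using l by simp
  ultimately show ?thesis unfolding relaxed_iff by linarith
qed

lemma tendsto_linear_value:
  assumes "\<And>v. (\<lambda>n. f n v) \<longlonglongrightarrow> m v"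
  shows "(\<lambda>n. linear_value (f n) l) \<longlonglongrightarrow> linear_value m l"
  by (induction l) (auto intro!: tendsto_intros assms)

text \<open>Tychonoff's theorem gives compactness. With countably many coordinates the product is
  metrisable, so compactness is sequential, and convergence is coordinatewise.\<close>

lemma convergent_subsequence_cube:
  fixes f :: "nat \<Rightarrow> 'v :: countable \<Rightarrow> real"
  assumes f: "\<And>n v. 0 \<le> f n v" "\<And>n v. f n v \<le> 1"
  obtains r m where "strict_mono (r :: nat \<Rightarrow> nat)" "\<And>v. 0 \<le> m v \<and> m v \<le> 1"
    "\<And>v. (\<lambda>n. f (r n) v) \<longlonglongrightarrow> m v"
proof -
  have "compact (PiE UNIV (\<lambda>_ :: 'v. {0 .. 1 :: real}))"
    unfolding compactin_euclidean_iff[symmetric] euclidean_product_topology[symmetric] compactin_PiE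
    by simp
  then have "seq_compact (PiE UNIV (\<lambda>_ :: 'v. {0 .. 1 :: real}))"
    by (simp add: compact_eq_seq_compact_metric)
  moreover have "\<forall>n. f n \<in> PiE UNIV (\<lambda>_. {0 .. 1})" using f by auto
  ultimately obtain m r where m: "m \<in> PiE UNIV (\<lambda>_ :: 'v. {0 .. 1 :: real})"
    and r: "strict_mono (r :: nat \<Rightarrow> nat)" and lim: "(f \<circ> r) \<longlonglongrightarrow> m"
    by (rule seq_compactE)
  have "(\<lambda>n. f (r n) v) \<longlonglongrightarrow> m v" for v
    using continuous_on_tendsto_compose[OF continuous_on_product_coordinates[of v] lim] by simp
  with r m show ?thesis by (intro that[of r m]) (auto simp: PiE_iff)
qed

theorem satisfiable_iff_relaxed:
  fixes S :: "nat \<Rightarrow> 'v :: countable dnf list"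
  shows "(\<exists>m. (\<forall>v. 0 \<le> m v \<and> m v \<le> 1) \<and> m v\<^sub>0 = 1 \<and> (\<forall>n. \<forall>d\<in>set (S n). dnf_sat m d)) \<longleftrightarrow>
    (\<forall>K. \<exists>y. (\<forall>v. y v \<le> K) \<and> y v\<^sub>0 = K \<and> (\<forall>n\<le>K. \<forall>d\<in>set (S n). dnf_relaxed y d))"
    (is "?L \<longleftrightarrow> ?R")
proof
  assume ?L
  then obtain m where m: "\<And>v. 0 \<le> m v" "\<And>v. m v \<le> 1" "m v\<^sub>0 = 1"
    and sat: "\<And>n d. d \<in> set (S n) \<Longrightarrow> dnf_sat m d" by blast
  show ?R
  proof
    fix K
    let ?y = "\<lambda>v. nat \<lfloor>real K * m v\<rfloor>"
    have "?y v \<le> K" for v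
      using mult_left_mono[OF m(2)[of v], of "real K"] by (simp add: nat_le_iff floor_le_iff)
    moreover have "dnf_relaxed ?y d" if "d \<in> set (S n)" for n d
      using sat[OF that] relaxed_floor[of m, OF m(1)] unfolding dnf_sat_def dnf_relaxed_def by blast
    ultimately show "\<exists>y. (\<forall>v. y v \<le> K) \<and> y v\<^sub>0 = K \<and> (\<forall>n\<le>K. \<forall>d\<in>set (S n). dnf_relaxed y d)"
      by (intro exI[of _ ?y]) (simp add: m(3))
  qed
next
  assume ?R
  then obtain y where y: "\<And>K v. y K v \<le> K" "\<And>K. y K v\<^sub>0 = K"
    "\<And>K n d. n \<le> K \<Longrightarrow> d \<in> set (S n) \<Longrightarrow> dnf_relaxed (y K) d" by metis
  \<comment> \<open>The index is shifted by one so that the divisor is never 0.\<close>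
  define f where "f K v = real (y (Suc K) v) / real (Suc K)" for K v
  have f01: "0 \<le> f n v" "f n v \<le> 1" for n v
    using y(1)[of "Suc n" v] by (simp_all add: f_def)
  obtain r m where r: "strict_mono r" and m: "\<And>v. 0 \<le> m v \<and> m v \<le> 1"
    and lim: "\<And>v. (\<lambda>n. f (r n) v) \<longlonglongrightarrow> m v"
    by (rule convergent_subsequence_cube[of f]) (use f01 in auto)
  have "f n v\<^sub>0 = 1" for n by (simp add: f_def y(2))
  then have "m v\<^sub>0 = 1" using lim[of v\<^sub>0] by (simp add: LIMSEQ_const_iff)
  moreover have "dnf_sat m d" if d: "d \<in> set (S n)" for n d
  proof (rule ccontr)
    assume "\<not> dnf_sat m d"
    \<comment> \<open>Every disjunct \<open>c\<close> contains an inequality \<open>l c\<close> that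
      the limit violates strictly, by a margin that the vanishing slack cannot bridge. As there are
      finitely many disjuncts, all of them fail from some index on, hence also at an index beyond
      \<open>n\<close>.\<close>
    then obtain l where l: "\<And>c. c \<in> set d \<Longrightarrow> l c \<in> set c \<and> linear_value m (l c) < 0"
      unfolding dnf_sat_def by (metis not_le)
    have "\<forall>\<^sub>F k in sequentially. \<forall>c\<in>set d. \<not> relaxed (y (Suc (r k))) (l c)"
    proof (rule eventually_ball_finite, simp, intro ballI)
      fix c assume c: "c \<in> set d"
      let ?s = "real (\<Sum>x\<leftarrow>l c. fst x + fst (snd x))"
      have "filterlim (\<lambda>k. real (Suc (r k))) at_top sequentially"
        by (intro filterlim_compose[OF filterlim_real_sequentially] filterlim_compose[OF filterlim_Suc]
            filterlim_subseq r)
      then have "(\<lambda>k. ?s / real (Suc (r k))) \<longlonglongrightarrow> 0"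
        by (intro tendsto_divide_0[OF tendsto_const] filterlim_at_top_imp_at_infinity)
      then have "(\<lambda>k. linear_value (f (r k)) (l c) + ?s / real (Suc (r k))) \<longlonglongrightarrow> linear_value m (l c) + 0"
        by (intro tendsto_add tendsto_linear_value lim)
      then have "\<forall>\<^sub>F k in sequentially. linear_value (f (r k)) (l c) + ?s / real (Suc (r k)) < 0"
        using l[OF c] by (intro order_tendstoD(2)) auto
      moreover have "linear_value (f k) l + t / real (Suc k) =
          (linear_value (\<lambda>v. real (y (Suc k) v)) l + t) / real (Suc k)" for k l t
        unfolding f_def[abs_def] linear_value_divide by (simp only: add_divide_distrib)
      ultimately show "\<forall>\<^sub>F k in sequentially. \<not> relaxed (y (Suc (r k))) (l c)"
        unfolding relaxed_iff by (simp add: divide_less_0_iff not_le)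
    qed
    then obtain k where k: "k \<ge> n" "\<forall>c\<in>set d. \<not> relaxed (y (Suc (r k))) (l c)"
      unfolding eventually_sequentially by (meson nle_le order_trans)
    have "n \<le> Suc (r k)" using k(1) strict_mono_imp_increasing[OF r, of k] by simp
    from y(3)[OF this d] k(2) l show False unfolding dnf_relaxed_def by blast
  qed
  ultimately show ?L using m by blast
qed

section \<open>The constraint system of an encoded instance\<close>

text \<open>Computes \<open>set_decode n\<close>. Positions below \<open>n\<close> suffice, since an
  element \<open>i\<close> forces \<open>i < 2 ^ i \<le> n\<close>.\<close>

definition bits :: "nat \<Rightarrow> nat list" where
  "bits n = filter (\<lambda>i. (n div 2 ^ i) mod 2 = 1) [0..<n]"

definition field :: "nat \<Rightarrow> nat \<Rightarrow> nat" where
  "field n i = nth_default 0 (list_decode n) i"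

definition code_states :: "nat \<Rightarrow> nat list" where "code_states m = bits (field m 0)"
definition code_actions :: "nat \<Rightarrow> nat list" where "code_actions m = bits (field m 1)"
definition code_init :: "nat \<Rightarrow> nat" where "code_init m = field m 2"
definition code_trans :: "nat \<Rightarrow> nat list list" where "code_trans m = map list_decode (bits (field m 3))"
definition code_ap :: "nat \<Rightarrow> nat list" where "code_ap m = bits (field m 4)"
definition code_label :: "nat \<Rightarrow> nat list list" where "code_label m = map list_decode (bits (field m 5))"

text \<open>Comparing \<open>e\<close> with a list that contains its own fourth entry says that
  \<open>e\<close> has exactly four entries and the required first three. In a valid code the
  default 0 is never met on the carriers.\<close>

definition code_prob :: "nat \<Rightarrow> nat \<Rightarrow> nat \<times> nat \<Rightarrow> nat" where
  "code_prob m s z = (case filter (\<lambda>e. e = [s, fst z, snd z, nth_default 0 e 3]) (code_trans m) of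
     [] \<Rightarrow> 0 | e # _ \<Rightarrow> nth_default 0 e 3)"

definition code_num :: "nat \<Rightarrow> nat \<Rightarrow> nat \<times> nat \<Rightarrow> nat" where
  "code_num m s z = fst (prod_decode (code_prob m s z))"

definition code_den :: "nat \<Rightarrow> nat \<Rightarrow> nat \<times> nat \<Rightarrow> nat" where
  "code_den m s z = snd (prod_decode (code_prob m s z))"

text \<open>Describes exactly the codes of decision processes. Stating each transition entry through
  \<open>code_prob\<close> makes the table the graph of a function; fractions have to be reduced, as
  \<open>encode_prob\<close> yields them; that probabilities sum to 1 is tested after multiplication
  by the product of the denominators.\<close>

definition valid_mdp :: "nat \<Rightarrow> bool" where
  "valid_mdp m \<longleftrightarrow> length (list_decode m) = 6 \<and> code_init m \<in> set (code_states m) \<and> code_ap m \<noteq> [] \<and>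
     (\<forall>e\<in>set (code_label m). \<exists>s\<in>set (code_states m). \<exists>p\<in>set (code_ap m). e = [s, p]) \<and>
     (\<forall>e\<in>set (code_trans m). \<exists>s\<in>set (code_states m). \<exists>a\<in>set (code_actions m).
        \<exists>t\<in>set (code_states m). e = [s, a, t, code_prob m s (a, t)]) \<and>
     (\<forall>s\<in>set (code_states m). \<forall>a\<in>set (code_actions m).
        (\<forall>t\<in>set (code_states m). [s, a, t, code_prob m s (a, t)] \<in> set (code_trans m) \<and>
           0 < code_den m s (a, t) \<and>
           (\<forall>i\<in>set [0..<Suc (code_den m s (a, t))].
              code_num m s (a, t) mod i = 0 \<and> code_den m s (a, t) mod i = 0 \<longrightarrow> i = 1)) \<and>
        (\<Sum>t\<leftarrow>code_states m. code_num m s (a, t) *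
           (prod_list (map (\<lambda>t. code_den m s (a, t)) (code_states m)) div code_den m s (a, t))) =
        prod_list (map (\<lambda>t. code_den m s (a, t)) (code_states m)))"

text \<open>A word lists the actions and states of a path from the initial state, latest step first.\<close>

type_synonym word = "(nat \<times> nat) list"

section \<open>Words and the evaluation of formulae along them\<close>

definition letters :: "nat \<Rightarrow> (nat \<times> nat) list" where
  "letters m = concat (map (\<lambda>a. map (\<lambda>t. (a, t)) (code_states m)) (code_actions m))"

definition words :: "nat \<Rightarrow> nat \<Rightarrow> word list" where
  "words m n = rec_nat [[]] (\<lambda>i W. concat (map (\<lambda>z. map (\<lambda>w. z # w) W) (letters m))) n"

definition last_state :: "nat \<Rightarrow> word \<Rightarrow> nat" where
  "last_state m w = (case w of [] \<Rightarrow> code_init m | z # _ \<Rightarrow> snd z)"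

text \<open>The window \<open>e\<close> continues \<open>w\<close> and has its latest step first, so
  cutting off \<open>length e - i\<close> steps leaves the history after \<open>i\<close> steps of
  the window; position 0 is the end of \<open>w\<close>.\<close>

definition state_at :: "nat \<Rightarrow> word \<Rightarrow> word \<Rightarrow> nat \<Rightarrow> nat" where
  "state_at m w e i = last_state m (drop (length e - i) (e @ w))"

text \<open>A formula without probabilities is decided by the state alone, whatever the strategy
  does.\<close>

definition state_sat :: "nat \<Rightarrow> nat \<Rightarrow> nat \<Rightarrow> bool" where
  "state_sat m s f = course_rec (\<lambda>n h.
     if field n 0 = 0 then [s, field n 1] \<in> set (code_label m)
     else if field n 0 = 1 then [s, field n 1] \<notin> set (code_label m)
     else if field n 0 = 2 then nth_default False h (field n 1) \<and> nth_default False h (field n 2)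
     else nth_default False h (field n 1) \<or> nth_default False h (field n 2)) f"

text \<open>A finite bound \<open>k\<close> is stored as \<open>Suc k\<close>, the number 0 being
  reserved for the infinite one.\<close>

definition horizon :: "nat \<Rightarrow> nat" where
  "horizon f = (if field f 0 = 0 then field f 1 else field f 2 - 1)"

definition path_sat :: "nat \<Rightarrow> word \<times> word \<Rightarrow> nat \<Rightarrow> bool" where
  "path_sat m z f =
     (if field f 0 = 0 then state_sat m (state_at m (fst z) (snd z) (field f 1)) (field f 2)
      else if field f 0 = 1 then
        \<exists>j\<in>set [0..<Suc (horizon f)]. state_sat m (state_at m (fst z) (snd z) j) (field f 3) \<and>
          (\<forall>i\<in>set [0..<j]. state_sat m (state_at m (fst z) (snd z) i) (field f 1))
      else \<forall>j\<in>set [0..<Suc (horizon f)]. state_sat m (state_at m (fst z) (snd z) j) (field f 1) \<or>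
          state_sat m (state_at m (fst z) (snd z) j) (field f 3) \<or>
          (\<exists>i\<in>set [0..<j]. state_sat m (state_at m (fst z) (snd z) i) (field f 3)))"

definition sat_words :: "nat \<Rightarrow> word \<Rightarrow> nat \<Rightarrow> word list" where
  "sat_words m w f = filter (\<lambda>e. path_sat m (w, e) f) (words m (horizon f))"

text \<open>\<open>int_encode\<close> maps nonnegative integers to even numbers and
  \<open>- (k + 1)\<close> to \<open>2 * k + 1\<close>. Together with \<open>neg_part\<close> this
  writes the integer as a difference of natural numbers.\<close>

definition pos_part :: "nat \<Rightarrow> nat" where
  "pos_part c = (if c mod 2 = 0 then c div 2 else 0)"

definition neg_part :: "nat \<Rightarrow> nat" where
  "neg_part c = (if c mod 2 = 0 then 0 else Suc (c div 2))"

text \<open>The probability of continuing \<open>w\<close> by \<open>e\<close>, times the mass of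
  \<open>w\<close>, is the mass of \<open>e @ w\<close>. The bound contributes
  \<open>- c\<^sub>0\<close> times the mass of \<open>w\<close>, hence its two parts are
  swapped.\<close>

definition psum_linear :: "nat \<Rightarrow> word \<Rightarrow> nat \<Rightarrow> word linear" where
  "psum_linear m w n = (neg_part (field n 3), pos_part (field n 3), w) #
     concat (map (\<lambda>z. map (\<lambda>e. (pos_part (fst (prod_decode z)), neg_part (fst (prod_decode z)), e @ w))
       (sat_words m w (snd (prod_decode z)))) (list_decode (field n 1)))"

text \<open>An atomic constraint that fails in the last state of \<open>w\<close> demands that \<open>w\<close> has mass 0.\<close>

definition formula_dnf :: "nat \<Rightarrow> word \<Rightarrow> nat \<Rightarrow> word dnf" where
  "formula_dnf m w f = course_rec (\<lambda>n h.
     if field n 0 = 0 then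
       if [last_state m w, field n 1] \<in> set (code_label m) then [[]] else [[[(0, 1, w)]]]
     else if field n 0 = 1 then
       if [last_state m w, field n 1] \<notin> set (code_label m) then [[]] else [[[(0, 1, w)]]]
     else if field n 0 = 2 then
       concat (map (\<lambda>c. map (\<lambda>c'. c @ c') (nth_default [] h (field n 2))) (nth_default [] h (field n 1)))
     else if field n 0 = 3 then nth_default [] h (field n 1) @ nth_default [] h (field n 2)
     else [[psum_linear m w n]]) f"

text \<open>The mass of \<open>w\<close> is the sum of the masses of its successors, and the successors under
  one action divide their mass in the ratio of the transition probabilities.\<close>

definition flow :: "nat \<Rightarrow> word \<Rightarrow> word linear list" where
  "flow m w =
     ((0, 1, w) # map (\<lambda>z. (1, 0, z # w)) (letters m)) #
     ((1, 0, w) # map (\<lambda>z. (0, 1, z # w)) (letters m)) #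
     map (\<lambda>z. (code_den m (last_state m w) z, 0, z # w) #
       map (\<lambda>t. (0, code_num m (last_state m w) z, (fst z, t) # w)) (code_states m)) (letters m) @
     map (\<lambda>z. (0, code_den m (last_state m w) z, z # w) #
       map (\<lambda>t. (code_num m (last_state m w) z, 0, (fst z, t) # w)) (code_states m)) (letters m)"

text \<open>The constraints are grouped by the length of the word they belong to; their unknowns are
  longer by up to one letter or up to the horizon.\<close>

definition stage :: "nat \<Rightarrow> nat \<Rightarrow> nat \<Rightarrow> word dnf list" where
  "stage m f n = concat (map (\<lambda>w. [[flow m w], formula_dnf m w f]) (words m n))"

section \<open>Exhaustive search over grid assignments\<close>

definition table_lookup :: "('v \<times> nat) list \<Rightarrow> 'v \<Rightarrow> nat" where
  "table_lookup \<tau> w = foldr (\<lambda>p r. if fst p = w then snd p else r) \<tau> 0"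

text \<open>A word may be listed repeatedly: a lookup takes the first entry, so conflicting later
  entries do no harm.\<close>

definition tables :: "nat \<Rightarrow> 'v list \<Rightarrow> ('v \<times> nat) list list" where
  "tables K W = foldr (\<lambda>w T. concat (map (\<lambda>\<tau>. map (\<lambda>v. (w, v) # \<tau>) [0..<Suc K]) T)) W [[]]"

definition stage_words :: "nat \<Rightarrow> nat \<Rightarrow> nat \<Rightarrow> word list" where
  "stage_words m f n = map (\<lambda>x. snd (snd x)) (concat (concat (concat (stage m f n))))"

text \<open>\<open>K\<close> is at once the scaling factor, hence the value standing for mass 1 at
  the empty word, and the last stage considered.\<close>

definition feasible :: "nat \<Rightarrow> nat \<Rightarrow> nat \<Rightarrow> bool" where
  "feasible m f K \<longleftrightarrow>
     (\<exists>\<tau>\<in>set (tables K ([] # concat (map (stage_words m f) [0..<Suc K]))).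
        table_lookup \<tau> [] = K \<and>
        (\<forall>n\<in>set [0..<Suc K]. \<forall>d\<in>set (stage m f n). dnf_relaxed (table_lookup \<tau>) d))"

section \<open>Decidable syntax of flat, non-strict window formulae\<close>

definition valid_state_formula :: "nat \<Rightarrow> nat \<Rightarrow> bool" where
  "valid_state_formula m f = course_rec (\<lambda>n h.
     if field n 0 < 2 then length (list_decode n) = 2 \<and> field n 1 \<in> set (code_ap m)
     else field n 0 < 4 \<and> length (list_decode n) = 3 \<and>
       nth_default False h (field n 1) \<and> nth_default False h (field n 2)) f"

text \<open>\<open>0 < field f 2\<close> excludes the code of the infinite horizon.\<close>

definition valid_path_formula :: "nat \<Rightarrow> nat \<Rightarrow> bool" where
  "valid_path_formula m f =
     (if field f 0 = 0 then length (list_decode f) = 3 \<and> valid_state_formula m (field f 2)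
      else field f 0 < 3 \<and> length (list_decode f) = 4 \<and> 0 < field f 2 \<and>
        valid_state_formula m (field f 1) \<and> valid_state_formula m (field f 3))"

text \<open>Within a sum, \<open>field n 2 = 0\<close> is the code of \<open>Ge\<close>, and
  flatness is enforced by allowing only path formulae over probability-free arguments.\<close>

definition valid_formula :: "nat \<Rightarrow> nat \<Rightarrow> bool" where
  "valid_formula m f = course_rec (\<lambda>n h.
     if field n 0 < 2 then length (list_decode n) = 2 \<and> field n 1 \<in> set (code_ap m)
     else if field n 0 < 4 then length (list_decode n) = 3 \<and>
       nth_default False h (field n 1) \<and> nth_default False h (field n 2)
     else field n 0 = 4 \<and> length (list_decode n) = 4 \<and> list_decode (field n 1) \<noteq> [] \<and> field n 2 = 0 \<and>
       (\<forall>z\<in>set (list_decode (field n 1)). valid_path_formula m (snd (prod_decode z)))) f"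

text \<open>A number that is no valid code is rejected for every \<open>K\<close>, and so falls into
  the complement.\<close>

definition accepts :: "nat \<Rightarrow> nat \<Rightarrow> bool" where
  "accepts x K \<longleftrightarrow> valid_mdp (fst (prod_decode x)) \<and>
     valid_formula (fst (prod_decode x)) (snd (prod_decode x)) \<and>
     feasible (fst (prod_decode x)) (snd (prod_decode x)) K"

subsection \<open>Computability\<close>

text \<open>All definitions are treated alike: the arguments are packed into one tuple, the body is
  unfolded, and the rules follow its syntax. This works because every quantifier ranges over a
  list.\<close>

lemma computable_bits [computable_intros]:
  assumes "computable a"
  shows "computable (\<lambda>x. bits (a x))"
  by (rule computable_compose[of bits, OF _ assms])
    (unfold bits_def[abs_def], intro computable_intros)

lemma computable_field [computable_intros]:
  assumes "computable a" "computable b"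
  shows "computable (\<lambda>x. field (a x) (b x))"
  by (rule computable_compose2[of field, OF _ assms])
    (unfold field_def, intro computable_intros)

lemma computable_code_states [computable_intros]:
  assumes "computable a"
  shows "computable (\<lambda>x. code_states (a x))"
  by (rule computable_compose[of code_states, OF _ assms])
    (unfold code_states_def[abs_def], intro computable_intros)

lemma computable_code_actions [computable_intros]:
  assumes "computable a"
  shows "computable (\<lambda>x. code_actions (a x))"
  by (rule computable_compose[of code_actions, OF _ assms])
    (unfold code_actions_def[abs_def], intro computable_intros)

lemma computable_code_init [computable_intros]:
  assumes "computable a"
  shows "computable (\<lambda>x. code_init (a x))"
  by (rule computable_compose[of code_init, OF _ assms])
    (unfold code_init_def[abs_def], intro computable_intros)

lemma computable_code_trans [computable_intros]:
  assumes "computable a"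
  shows "computable (\<lambda>x. code_trans (a x))"
  by (rule computable_compose[of code_trans, OF _ assms])
    (unfold code_trans_def[abs_def], intro computable_intros)

lemma computable_code_ap [computable_intros]:
  assumes "computable a"
  shows "computable (\<lambda>x. code_ap (a x))"
  by (rule computable_compose[of code_ap, OF _ assms])
    (unfold code_ap_def[abs_def], intro computable_intros)

lemma computable_code_label [computable_intros]:
  assumes "computable a"
  shows "computable (\<lambda>x. code_label (a x))"
  by (rule computable_compose[of code_label, OF _ assms])
    (unfold code_label_def[abs_def], intro computable_intros)

lemma computable_code_prob [computable_intros]:
  assumes "computable a" "computable b" "computable c"
  shows "computable (\<lambda>x. code_prob (a x) (b x) (c x))"
  by (rule computable_compose3[of code_prob, OF _ assms])
    (unfold code_prob_def, intro computable_intros)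

lemma computable_code_num [computable_intros]:
  assumes "computable a" "computable b" "computable c"
  shows "computable (\<lambda>x. code_num (a x) (b x) (c x))"
  by (rule computable_compose3[of code_num, OF _ assms])
    (unfold code_num_def, intro computable_intros)

lemma computable_code_den [computable_intros]:
  assumes "computable a" "computable b" "computable c"
  shows "computable (\<lambda>x. code_den (a x) (b x) (c x))"
  by (rule computable_compose3[of code_den, OF _ assms])
    (unfold code_den_def, intro computable_intros)

lemma computable_valid_mdp [computable_intros]:
  assumes "computable a"
  shows "computable (\<lambda>x. valid_mdp (a x))"
  by (rule computable_compose[of valid_mdp, OF _ assms])
    (unfold valid_mdp_def[abs_def], intro computable_intros)

lemma computable_letters [computable_intros]:
  assumes "computable a"
  shows "computable (\<lambda>x. letters (a x))"
  by (rule computable_compose[of letters, OF _ assms])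
    (unfold letters_def[abs_def], intro computable_intros)

lemma computable_words [computable_intros]:
  assumes "computable a" "computable b"
  shows "computable (\<lambda>x. words (a x) (b x))"
  by (rule computable_compose2[of words, OF _ assms])
    (unfold words_def, intro computable_intros)

lemma computable_last_state [computable_intros]:
  assumes "computable a" "computable b"
  shows "computable (\<lambda>x. last_state (a x) (b x))"
  by (rule computable_compose2[of last_state, OF _ assms])
    (unfold last_state_def, intro computable_intros)

lemma computable_state_at [computable_intros]:
  assumes "computable a" "computable b" "computable c" "computable d"
  shows "computable (\<lambda>x. state_at (a x) (b x) (c x) (d x))"
  by (rule computable_compose4[of state_at, OF _ assms])
    (unfold state_at_def, intro computable_intros)

lemma computable_state_sat [computable_intros]:
  assumes "computable a" "computable b" "computable c"
  shows "computable (\<lambda>x. state_sat (a x) (b x) (c x))"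
  by (rule computable_compose3[of state_sat, OF _ assms])
    (unfold state_sat_def, intro computable_intros)

lemma computable_horizon [computable_intros]:
  assumes "computable a"
  shows "computable (\<lambda>x. horizon (a x))"
  by (rule computable_compose[of horizon, OF _ assms])
    (unfold horizon_def[abs_def], intro computable_intros)

lemma computable_path_sat [computable_intros]:
  assumes "computable a" "computable b" "computable c"
  shows "computable (\<lambda>x. path_sat (a x) (b x) (c x))"
  by (rule computable_compose3[of path_sat, OF _ assms])
    (unfold path_sat_def, intro computable_intros)

lemma computable_sat_words [computable_intros]:
  assumes "computable a" "computable b" "computable c"
  shows "computable (\<lambda>x. sat_words (a x) (b x) (c x))"
  by (rule computable_compose3[of sat_words, OF _ assms])
    (unfold sat_words_def, intro computable_intros)

lemma computable_pos_part [computable_intros]: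
  assumes "computable a"
  shows "computable (\<lambda>x. pos_part (a x))"
  by (rule computable_compose[of pos_part, OF _ assms])
    (unfold pos_part_def[abs_def], intro computable_intros)

lemma computable_neg_part [computable_intros]:
  assumes "computable a"
  shows "computable (\<lambda>x. neg_part (a x))"
  by (rule computable_compose[of neg_part, OF _ assms])
    (unfold neg_part_def[abs_def], intro computable_intros)

lemma computable_psum_linear [computable_intros]:
  assumes "computable a" "computable b" "computable c"
  shows "computable (\<lambda>x. psum_linear (a x) (b x) (c x))"
  by (rule computable_compose3[of psum_linear, OF _ assms])
    (unfold psum_linear_def, intro computable_intros)

lemma computable_formula_dnf [computable_intros]:
  assumes "computable a" "computable b" "computable c"
  shows "computable (\<lambda>x. formula_dnf (a x) (b x) (c x))"
  by (rule computable_compose3[of formula_dnf, OF _ assms])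
    (unfold formula_dnf_def, intro computable_intros)

lemma computable_flow [computable_intros]:
  assumes "computable a" "computable b"
  shows "computable (\<lambda>x. flow (a x) (b x))"
  by (rule computable_compose2[of flow, OF _ assms])
    (unfold flow_def, intro computable_intros)

lemma computable_stage [computable_intros]:
  assumes "computable a" "computable b" "computable c"
  shows "computable (\<lambda>x. stage (a x) (b x) (c x))"
  by (rule computable_compose3[of stage, OF _ assms])
    (unfold stage_def, intro computable_intros)

lemma computable_table_lookup [computable_intros]:
  assumes "computable a" "computable b"
  shows "computable (\<lambda>x. table_lookup (a x) (b x))"
  by (rule computable_compose2[of table_lookup, OF _ assms])
    (unfold table_lookup_def, intro computable_intros)

lemma computable_tables [computable_intros]:
  assumes "computable a" "computable b"
  shows "computable (\<lambda>x. tables (a x) (b x))"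
  by (rule computable_compose2[of tables, OF _ assms])
    (unfold tables_def, intro computable_intros)

lemma computable_stage_words [computable_intros]:
  assumes "computable a" "computable b" "computable c"
  shows "computable (\<lambda>x. stage_words (a x) (b x) (c x))"
  by (rule computable_compose3[of stage_words, OF _ assms])
    (unfold stage_words_def, intro computable_intros)

lemma computable_feasible [computable_intros]:
  assumes "computable a" "computable b" "computable c"
  shows "computable (\<lambda>x. feasible (a x) (b x) (c x))"
  by (rule computable_compose3[of feasible, OF _ assms])
    (unfold feasible_def dnf_relaxed_def relaxed_def, intro computable_intros)

lemma computable_valid_state_formula [computable_intros]:
  assumes "computable a" "computable b"
  shows "computable (\<lambda>x. valid_state_formula (a x) (b x))"
  by (rule computable_compose2[of valid_state_formula, OF _ assms])
    (unfold valid_state_formula_def, intro computable_intros)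

lemma computable_valid_path_formula [computable_intros]:
  assumes "computable a" "computable b"
  shows "computable (\<lambda>x. valid_path_formula (a x) (b x))"
  by (rule computable_compose2[of valid_path_formula, OF _ assms])
    (unfold valid_path_formula_def, intro computable_intros)

lemma computable_valid_formula [computable_intros]:
  assumes "computable a" "computable b"
  shows "computable (\<lambda>x. valid_formula (a x) (b x))"
  by (rule computable_compose2[of valid_formula, OF _ assms])
    (unfold valid_formula_def, intro computable_intros)

lemma computable_accepts [computable_intros]:
  assumes "computable a" "computable b"
  shows "computable (\<lambda>x. accepts (a x) (b x))"
  by (rule computable_compose2[of accepts, OF _ assms])
    (unfold accepts_def, intro computable_intros)

section \<open>Strategies and path masses\<close>

lemma sum_list_map_filter_distinct:
  "distinct xs \<Longrightarrow> sum_list (map f (filter P xs)) = sum f {x \<in> set xs. P x}"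
  by (simp add: sum_list_distinct_conv_sum_set)

lemma distinct_bits: "distinct (bits n)"
  by (simp add: bits_def)

lemma set_bits: "set (bits n) = set_decode n"
proof -
  have "i < n" if "i \<in> set_decode n" for i
  proof -
    have "set_decode (2 ^ i) = {i}" using set_decode_plus_power_2[of i 0] by simp
    then have "2 ^ i \<le> n" using that by (intro subset_decode_imp_le) simp
    then show ?thesis using less_exp[of i] by linarith
  qed
  then show ?thesis by (auto simp: bits_def set_decode_def odd_iff_mod_2_eq_one)
qed

text \<open>Hence the parts of a formula have smaller codes than the formula, and their values are
  found in the history supplied by \<open>course_rec\<close>.\<close>

lemma less_list_encode: "x \<in> set l \<Longrightarrow> x < list_encode l"
proof (induction l)
  case (Cons y l)
  then show ?case
    using le_prod_encode_1[of y "list_encode l"] le_prod_encode_2[of "list_encode l" y] by fastforce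
qed simp

lemma field_list_encode [simp]: "field (list_encode l) i = nth_default 0 l i"
  by (simp add: field_def)

lemma nth_default_numeral [simp]:
  "nth_default d (x # xs) (numeral k) = nth_default d xs (pred_numeral k)"
  by (simp add: numeral_eq_Suc)

lemma state_sat_simps:
  "state_sat m s (encode_sf (Atom p)) \<longleftrightarrow> [s, p] \<in> set (code_label m)"
  "state_sat m s (encode_sf (NegAtom p)) \<longleftrightarrow> [s, p] \<notin> set (code_label m)"
  "state_sat m s (encode_sf (Conj \<Phi> \<Psi>)) \<longleftrightarrow> state_sat m s (encode_sf \<Phi>) \<and> state_sat m s (encode_sf \<Psi>)"
  "state_sat m s (encode_sf (Disj \<Phi> \<Psi>)) \<longleftrightarrow> state_sat m s (encode_sf \<Phi>) \<or> state_sat m s (encode_sf \<Psi>)"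
  unfolding state_sat_def
  by (subst course_rec.simps; simp add: nth_default_course_rec less_list_encode del: list_encode.simps)+

lemma formula_dnf_simps:
  "formula_dnf m w (encode_sf (Atom p)) =
     (if [last_state m w, p] \<in> set (code_label m) then [[]] else [[[(0, 1, w)]]])"
  "formula_dnf m w (encode_sf (NegAtom p)) =
     (if [last_state m w, p] \<notin> set (code_label m) then [[]] else [[[(0, 1, w)]]])"
  "formula_dnf m w (encode_sf (Conj \<Phi> \<Psi>)) =
     concat (map (\<lambda>c. map (\<lambda>c'. c @ c') (formula_dnf m w (encode_sf \<Psi>))) (formula_dnf m w (encode_sf \<Phi>)))"
  "formula_dnf m w (encode_sf (Disj \<Phi> \<Psi>)) = formula_dnf m w (encode_sf \<Phi>) @ formula_dnf m w (encode_sf \<Psi>)"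
  "formula_dnf m w (encode_sf (PSum cs R c\<^sub>0)) = [[psum_linear m w (encode_sf (PSum cs R c\<^sub>0))]]"
  unfolding formula_dnf_def
  by (subst course_rec.simps; simp add: nth_default_course_rec less_list_encode del: list_encode.simps)+

lemma int_decode_parts: "int (pos_part c) - int (neg_part c) = int_decode c"
  by (auto simp: pos_part_def neg_part_def int_decode_def sum_decode_def even_iff_mod_2_eq_zero)

lemma distinct_concat_map_Cons:
  assumes "distinct xs" "distinct ys"
  shows "distinct (concat (map (\<lambda>x. map (\<lambda>y. x # y) ys) xs))"
  using assms by (induction xs) (auto simp: distinct_map inj_on_def)

lemma distinct_letters: "distinct (letters m)"
proof -
  have "distinct (concat (map (\<lambda>a. map (\<lambda>t. (a, t)) ys) xs))"
    if "distinct xs" "distinct ys" for xs ys :: "nat list"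
    using that by (induction xs) (auto simp: distinct_map inj_on_def)
  then show ?thesis by (simp add: letters_def code_states_def code_actions_def distinct_bits)
qed

lemma set_letters: "set (letters m) = set (code_actions m) \<times> set (code_states m)"
  by (auto simp: letters_def)

lemma words_0: "words m 0 = [[]]"
  and words_Suc: "words m (Suc n) = concat (map (\<lambda>z. map (\<lambda>w. z # w) (words m n)) (letters m))"
  by (simp_all add: words_def)

lemma set_words: "set (words m n) = {w. length w = n \<and> set w \<subseteq> set (letters m)}"
  by (induction n) (auto simp: words_0 words_Suc length_Suc_conv image_iff)

lemma distinct_words: "distinct (words m n)"
  by (induction n) (auto simp: words_0 words_Suc intro!: distinct_concat_map_Cons distinct_letters)

lemma sum_words_Suc:
  "(\<Sum>w\<in>set (words m (Suc n)). f w) = (\<Sum>w\<in>set (words m n). \<Sum>z\<in>set (letters m). f (z # w))"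
proof -
  have "sum f (set (words m (Suc n))) =
      sum (\<lambda>(w, z). f (z # w)) (set (words m n) \<times> set (letters m))"
    by (rule sum.reindex_bij_witness[of _ "\<lambda>(w, z). z # w" "\<lambda>w. (tl w, hd w)"])
      (auto simp: words_Suc)
  then show ?thesis by (simp add: sum.cartesian_product)
qed

section \<open>Words as finite paths\<close>

fun path_of :: "nat \<Rightarrow> word \<Rightarrow> (nat, nat) fpath" where
  "path_of s [] = Start s"
| "path_of s (z # w) = Step (path_of s w) (fst z) (snd z)"

text \<open>Forgetting the start state gives a left inverse of \<open>path_of s\<close> for every
  \<open>s\<close>; it turns data indexed by words into a strategy.\<close>

fun word_of :: "(nat, nat) fpath \<Rightarrow> word" where
  "word_of (Start s) = []"
| "word_of (Step \<rho> a s) = (a, s) # word_of \<rho>"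

lemma word_of_path_of [simp]: "word_of (path_of s w) = w"
  by (induction w) auto

lemma path_of_eq_iff [simp]: "path_of s w = path_of s w' \<longleftrightarrow> w = w'"
  by (metis word_of_path_of)

lemma fpath_last_path_of [simp]: "fpath_last (path_of (code_init m) w) = last_state m w"
  by (cases w) (auto simp: last_state_def)

text \<open>Image measures preserve total mass, and the marginal on the empty set of coordinates is
  a probability measure by construction.\<close>

lemma prob_space_path_measure:
  fixes D :: "('s :: countable, 'p) mc"
  shows "prob_space (path_measure D s)"
proof -
  interpret Ionescu_Tulcea "path_kernel D s" "\<lambda>_. count_space UNIV"
    by (rule Ionescu_Tulcea_path_kernel)
  show ?thesis
    unfolding path_measure_def
  proof (rule prob_space_distrD)
    show "prob_space (distr PF.lim (PiM {} (\<lambda>_. count_space UNIV)) (\<lambda>x. restrict x {}))"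
      by (subst distr_lim) (auto intro: PF.prob_space_P)
  qed (simp add: measurable_cong_sets[OF PF.sets_lim refl])
qed

lemma horizon_simps [simp]:
  "horizon (encode_pf (Next l \<Phi>)) = l"
  "horizon (encode_pf (Until \<Phi> (enat k) \<Psi>)) = k"
  "horizon (encode_pf (WeakUntil \<Phi> (enat k) \<Psi>)) = k"
  by (simp_all add: horizon_def del: list_encode.simps)

lemma dnf_sat_conj:
  "dnf_sat \<mu> (concat (map (\<lambda>c. map (\<lambda>c'. c @ c') D') D)) \<longleftrightarrow> dnf_sat \<mu> D \<and> dnf_sat \<mu> D'"
proof -
  have "(\<exists>c\<in>set (concat (map (\<lambda>c. map (\<lambda>c'. c @ c') D') D)). P c) \<longleftrightarrow> (\<exists>c\<in>set D. \<exists>c'\<in>set D'. P (c @ c'))" for P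
    by auto
  then show ?thesis by (simp only: dnf_sat_def set_append ball_Un) blast
qed

lemma dnf_sat_disj: "dnf_sat \<mu> (D @ D') \<longleftrightarrow> dnf_sat \<mu> D \<or> dnf_sat \<mu> D'"
  by (auto simp: dnf_sat_def)

lemma linear_value_map:
  "linear_value \<mu> (map (\<lambda>x. (p, q, g x)) xs) = (real p - real q) * (\<Sum>x\<leftarrow>xs. \<mu> (g x))"
  by (induction xs) (auto simp: distrib_left)

lemma linear_value_concat: "linear_value \<mu> (concat ls) = (\<Sum>l\<leftarrow>ls. linear_value \<mu> l)"
  by (induction ls) (auto simp: linear_value_append)

lemma real_parts: "real (pos_part (int_encode c)) - real (neg_part (int_encode c)) = of_int c"
proof -
  have "real_of_int (int (pos_part (int_encode c)) - int (neg_part (int_encode c))) = of_int c"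
    by (simp only: int_decode_parts int_encode_inverse)
  then show ?thesis by simp
qed

lemma linear_value_psum:
  "linear_value \<mu> (psum_linear m w (encode_sf (PSum cs R c\<^sub>0))) =
    (\<Sum>x\<leftarrow>cs. of_int (fst x) *
      (\<Sum>e | e \<in> set (words m (horizon (encode_pf (snd x)))) \<and> path_sat m (w, e) (encode_pf (snd x)). \<mu> (e @ w))) -
    of_int c\<^sub>0 * \<mu> w"
proof -
  have "real (neg_part (int_encode c)) - real (pos_part (int_encode c)) = - of_int c" for c
    using real_parts[of c] by linarith
  then show ?thesis
    by (simp add: psum_linear_def linear_value_concat linear_value_map real_parts comp_def sat_words_def
        sum_list_map_filter_distinct[OF distinct_words] del: list_encode.simps)
qed

lemma pmf_with_finite_support:
  fixes f :: "'a \<Rightarrow> real"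
  assumes A: "finite A" and f: "\<And>a. a \<in> A \<Longrightarrow> 0 \<le> f a" "(\<Sum>a\<in>A. f a) = 1"
  shows "\<exists>p. \<forall>a. pmf p a = (if a \<in> A then f a else 0)"
proof -
  let ?f = "\<lambda>a. if a \<in> A then f a else 0"
  have "(\<integral>\<^sup>+a. ennreal (?f a) \<partial>count_space UNIV) = (\<Sum>a\<in>A. ennreal (?f a))"
    using A by (intro nn_integral_count_space') auto
  also have "\<dots> = 1" using f by simp
  finally have "pmf (embed_pmf ?f) a = ?f a" for a
    using f(1) by (intro pmf_embed_pmf) auto
  then show ?thesis by blast
qed

text \<open>The interface between a number and the decision process it stands for;
  \<open>encode_mdp_valid\<close> establishes it for actual codes.\<close>

locale encoded_mdp =
  fixes m :: nat and M :: "(nat, nat, nat) mdp"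
  assumes mdp: "markov_decision_process M"
    and states: "set (code_states m) = mdp_states M"
    and actions: "set (code_actions m) = mdp_actions M"
    and init: "code_init m = mdp_init M"
    and ap: "set (code_ap m) = mdp_ap M"
    and label: "s \<in> mdp_states M \<Longrightarrow> [s, p] \<in> set (code_label m) \<longleftrightarrow> p \<in> mdp_label M s"
    and den_pos: "s \<in> mdp_states M \<Longrightarrow> a \<in> mdp_actions M \<Longrightarrow> t \<in> mdp_states M \<Longrightarrow> 0 < code_den m s (a, t)"
    and prob: "s \<in> mdp_states M \<Longrightarrow> a \<in> mdp_actions M \<Longrightarrow> t \<in> mdp_states M \<Longrightarrow>
      pmf (mdp_trans M s a) t = real (code_num m s (a, t)) / real (code_den m s (a, t))"
begin

abbreviation "L \<equiv> set (letters m)"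

lemma L_eq: "L = mdp_actions M \<times> mdp_states M"
  by (simp add: set_letters states actions)

lemma finite_actions: "finite (mdp_actions M)"
  using mdp by (auto simp: markov_decision_process_def)

lemma last_state_in: "set w \<subseteq> L \<Longrightarrow> last_state m w \<in> mdp_states M"
  using mdp by (cases w) (auto simp: last_state_def init markov_decision_process_def L_eq)

lemma state_at_in: "set w \<subseteq> L \<Longrightarrow> set e \<subseteq> L \<Longrightarrow> state_at m w e i \<in> mdp_states M"
  unfolding state_at_def by (intro last_state_in) (use set_drop_subset[of _ "e @ w"] in auto)

lemma sum_trans: "s \<in> mdp_states M \<Longrightarrow> a \<in> mdp_actions M \<Longrightarrow>
    (\<Sum>t\<in>mdp_states M. pmf (mdp_trans M s a) t) = 1"
  using mdp by (intro sum_pmf_eq_1) (auto simp: markov_decision_process_def)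

abbreviation "hist \<equiv> path_of (code_init m)"

lemma linear_value_letters:
  "linear_value \<mu> (map (\<lambda>z. (p, q, z # w)) (letters m)) = (real p - real q) * (\<Sum>z\<in>L. \<mu> (z # w))"
  by (simp add: linear_value_map sum_list_distinct_conv_sum_set distinct_letters)

lemma linear_value_states:
  "linear_value \<mu> (map (\<lambda>t. (p, q, (a, t) # w)) (code_states m)) =
    (real p - real q) * (\<Sum>t\<in>mdp_states M. \<mu> ((a, t) # w))"
  by (simp add: linear_value_map sum_list_distinct_conv_sum_set code_states_def distinct_bits
      states[unfolded code_states_def])

text \<open>Opposite inequalities combine to equations. The sum over \<open>t\<close> is the mass
  with which \<open>a\<close> is played after \<open>w\<close>, so no separate unknown for actions
  arises; multiplying by the denominator gives coefficients in the natural numbers.\<close>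

lemma dnf_sat_flow:
  assumes w: "set w \<subseteq> L"
  shows "dnf_sat \<mu> [flow m w] \<longleftrightarrow> (\<Sum>z\<in>L. \<mu> (z # w)) = \<mu> w \<and>
    (\<forall>a\<in>mdp_actions M. \<forall>t\<in>mdp_states M. \<mu> ((a, t) # w) =
      pmf (mdp_trans M (last_state m w) a) t * (\<Sum>t\<in>mdp_states M. \<mu> ((a, t) # w)))"
proof -
  let ?s = "last_state m w"
  have "\<mu> ((a, t) # w) = pmf (mdp_trans M ?s a) t * (\<Sum>t\<in>mdp_states M. \<mu> ((a, t) # w)) \<longleftrightarrow>
      real (code_den m ?s (a, t)) * \<mu> ((a, t) # w) =
      real (code_num m ?s (a, t)) * (\<Sum>t\<in>mdp_states M. \<mu> ((a, t) # w))"
    if "a \<in> mdp_actions M" "t \<in> mdp_states M" for a t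
    unfolding prob[OF last_state_in[OF w] that]
    using den_pos[OF last_state_in[OF w] that] by (auto simp: divide_simps mult.commute)
  note eq = this
  have "dnf_sat \<mu> [flow m w] \<longleftrightarrow> (\<Sum>z\<in>L. \<mu> (z # w)) = \<mu> w \<and>
    (\<forall>z\<in>L. real (code_den m ?s z) * \<mu> (z # w) =
      real (code_num m ?s z) * (\<Sum>t\<in>mdp_states M. \<mu> ((fst z, t) # w)))"
    by (auto simp: dnf_sat_def flow_def ball_Un linear_value_letters linear_value_states intro: antisym)
  then show ?thesis using eq by (auto simp: L_eq)
qed

end

section \<open>The masses induced by a strategy\<close>

locale encoded_strategy = encoded_mdp +
  fixes \<sigma> :: "(nat, nat) fpath \<Rightarrow> nat pmf"
  assumes strategy: "strategy M \<sigma>"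
begin

abbreviation "C \<equiv> induced_mc M \<sigma>"

fun mass :: "word \<Rightarrow> real" where
  "mass [] = 1"
| "mass (z # w) = mass w * (pmf (\<sigma> (hist w)) (fst z) * pmf (mdp_trans M (last_state m w) (fst z)) (snd z))"

lemma mass_Cons_trans: "mass (z # w) = mass w * pmf (mc_trans C (hist w)) (hist (z # w))"
  by (simp add: pmf_induced_mc)

declare mass.simps(2) [simp del]

lemma mass_nonneg [simp]: "0 \<le> mass w"
  by (induction w) (auto simp: mass.simps(2))

lemma mass_le_0_iff [simp]: "mass w \<le> 0 \<longleftrightarrow> mass w = 0"
  using mass_nonneg[of w] by linarith

lemma mass_le_1: "mass w \<le> 1"
  by (induction w) (auto simp: mass.simps(2) intro!: mult_le_one pmf_le_1)

lemma mass_append_0: "mass w = 0 \<Longrightarrow> mass (e @ w) = 0"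
  by (induction e) (auto simp: mass.simps(2))

text \<open>A strategy is known to play actions of \<open>M\<close> only on finite paths, so both
  claims have to be carried through one induction.\<close>

lemma path_in_finite_paths:
  "0 < mass w \<Longrightarrow> set w \<subseteq> L \<and> hist w \<in> finite_paths M"
proof (induction w)
  case Nil
  then show ?case using mdp by (auto simp: init markov_decision_process_def intro: finite_paths.Start)
next
  case (Cons z w)
  then have pos: "0 < mass w" "0 < pmf (\<sigma> (hist w)) (fst z)"
    "0 < pmf (mdp_trans M (last_state m w) (fst z)) (snd z)"
    by (auto simp: mass.simps(2) less_le)
  then have w: "set w \<subseteq> L" "hist w \<in> finite_paths M" using Cons.IH by auto
  have a: "fst z \<in> mdp_actions M"
    using strategy w(2) pos(2) by (force simp: strategy_def set_pmf_iff)
  have "snd z \<in> set_pmf (mdp_trans M (last_state m w) (fst z))"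
    using pos(3) by (simp add: set_pmf_iff)
  then have "snd z \<in> mdp_states M"
    using mdp last_state_in[OF w(1)] a unfolding markov_decision_process_def by blast
  with a w pos show ?case
    by (auto simp: L_eq mem_Times_iff intro!: finite_paths.Step)
qed

text \<open>A state of the induced chain records its whole past: every successor of
  \<open>hist w\<close> is some \<open>hist (z # w)\<close>, and positive mass means that each step
  has positive probability.\<close>

lemma reachable_iff: "mc_reachable C (mc_init C) \<rho> \<longleftrightarrow> (\<exists>w. 0 < mass w \<and> \<rho> = hist w)"
proof
  have trans: "\<exists>z. \<rho>' = hist (z # w)" if "\<rho>' \<in> set_pmf (mc_trans C (hist w))" for \<rho>' w
    using that by (auto simp: induced_mc_def)
  assume "mc_reachable C (mc_init C) \<rho>"
  then have "(\<lambda>s t. t \<in> set_pmf (mc_trans C s))\<^sup>*\<^sup>* (mc_init C) \<rho>" by (simp add: mc_reachable_def)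
  then show "\<exists>w. 0 < mass w \<and> \<rho> = hist w"
  proof (induction rule: rtranclp_induct)
    case base
    show ?case by (rule exI[of _ "[]"]) (simp add: induced_mc_def init)
  next
    case (step \<rho> \<rho>')
    then obtain w where w: "0 < mass w" "\<rho> = hist w" by blast
    from trans[of \<rho>' w] step(2) w(2) obtain z where z: "\<rho>' = hist (z # w)" by blast
    have "0 < mass (z # w)"
      unfolding mass_Cons_trans using step(2) w z by (intro mult_pos_pos pmf_positive) auto
    with z show ?case by blast
  qed
next
  assume "\<exists>w. 0 < mass w \<and> \<rho> = hist w"
  then obtain w where "0 < mass w" "\<rho> = hist w" by blast
  then show "mc_reachable C (mc_init C) \<rho>"
  proof (induction w arbitrary: \<rho>)
    case Nil
    then show ?case by (simp add: mc_reachable_def induced_mc_def init)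
  next
    case (Cons z w)
    then have "0 < mass w" "hist (z # w) \<in> set_pmf (mc_trans C (hist w))"
      using mass_nonneg[of w] by (auto simp: mass_Cons_trans zero_less_mult_iff set_pmf_iff)
    with Cons show ?case unfolding mc_reachable_def by (meson rtranclp.rtrancl_into_rtrancl)
  qed
qed

lemma mass_flow_action:
  assumes w: "set w \<subseteq> L" and a: "a \<in> mdp_actions M"
  shows "(\<Sum>t\<in>mdp_states M. mass ((a, t) # w)) = mass w * pmf (\<sigma> (hist w)) a"
  using sum_trans[OF last_state_in[OF w] a]
  by (simp add: mass.simps(2) sum_distrib_left[symmetric])

lemma mass_flow:
  assumes w: "set w \<subseteq> L"
  shows "(\<Sum>z\<in>L. mass (z # w)) = mass w"
\<comment> \<open>The support of the strategy is controlled only on finite paths; on words of mass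
  0, which may be none, both sides vanish.\<close>
proof (cases "mass w = 0")
  case False
  then have "hist w \<in> finite_paths M"
    using path_in_finite_paths[of w] mass_nonneg[of w] by simp
  then have "(\<Sum>a\<in>mdp_actions M. pmf (\<sigma> (hist w)) a) = 1"
    using strategy finite_actions by (intro sum_pmf_eq_1) (auto simp: strategy_def)
  moreover have "(\<Sum>z\<in>L. mass (z # w)) = (\<Sum>a\<in>mdp_actions M. \<Sum>t\<in>mdp_states M. mass ((a, t) # w))"
    by (simp add: L_eq sum.cartesian_product case_prod_unfold)
  ultimately show ?thesis
    by (simp add: mass_flow_action[OF w] sum_distrib_left[symmetric])
qed (simp add: mass.simps(2))

lemma sum_mass_words:
  assumes w: "set w \<subseteq> L"
  shows "(\<Sum>e\<in>set (words m n). mass (e @ w)) = mass w"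
proof (induction n)
  case (Suc n)
  have "(\<Sum>e\<in>set (words m n). \<Sum>z\<in>L. mass (z # e @ w)) = (\<Sum>e\<in>set (words m n). mass (e @ w))"
    by (intro sum.cong refl mass_flow) (use w in \<open>auto simp: set_words\<close>)
  with Suc show ?case by (simp add: sum_words_Suc)
qed (simp add: words_0)

text \<open>The truncated difference makes the sequence stay at \<open>hist (e @ w)\<close> once
  \<open>e\<close> is used up. So \<open>run w e\<close> is an infinite sequence to which path
  formulae can be applied.\<close>

definition run :: "word \<Rightarrow> word \<Rightarrow> nat \<Rightarrow> (nat, nat) fpath" where
  "run w e i = hist (drop (length e - i) (e @ w))"

text \<open>Puts the quotient of the two masses into the form of a cylinder probability.\<close>

lemma mass_append_prod:
  "mass (e @ w) = mass w * (\<Prod>i<length e. pmf (mc_trans C (run w e i)) (run w e (Suc i)))"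
proof (induction e)
  case (Cons z e)
  have "run w (z # e) i = run w e i" if "i \<le> length e" for i
    using that by (simp add: run_def Suc_diff_le)
  then have "(\<Prod>i<length e. pmf (mc_trans C (run w (z # e) i)) (run w (z # e) (Suc i))) =
      (\<Prod>i<length e. pmf (mc_trans C (run w e i)) (run w e (Suc i)))"
    by (intro prod.cong) auto
  moreover have "run w (z # e) (length e) = hist (e @ w)" "run w (z # e) (Suc (length e)) = hist (z # e @ w)"
    by (simp_all add: run_def)
  ultimately show ?case
    using Cons mass_Cons_trans[of z "e @ w"] by simp
qed simp

lemma sets_path_measure_C: "sets (path_measure C \<rho>) = sets (PiM UNIV (\<lambda>_. count_space UNIV))"
  by (rule sets_path_measure)

lemma space_path_measure_C [simp]: "space (path_measure C \<rho>) = UNIV"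
  using sets_eq_imp_space_eq[OF sets_path_measure_C] by (simp add: space_PiM)

lemma measurable_coordinate:
  "(\<lambda>\<omega>. \<omega> i) \<in> measurable (path_measure C \<rho>) (count_space UNIV)"
  by (subst measurable_cong_sets[OF sets_path_measure_C refl]) (rule measurable_component_singleton, simp)

lemma cylinder_sets: "{\<omega>. \<forall>i\<le>n. \<omega> i = x i} \<in> sets (path_measure C \<rho>)"
proof -
  note measurable_coordinate[measurable]
  have "{\<omega> \<in> space (path_measure C \<rho>). \<forall>i\<in>{..n}. \<omega> i = x i} \<in> sets (path_measure C \<rho>)"
    by measurable
  then show ?thesis by (simp add: Ball_def)
qed

text \<open>An event depending on coordinates up to \<open>n\<close> is, up to a null set, the
  disjoint union of the cylinders of the words of length \<open>n\<close> whose run satisfies it.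
  That the rest is a null set follows by counting: by the flow equations these cylinders already
  have total probability 1.\<close>

lemma measure_window:
  assumes w: "set w \<subseteq> L" and pos: "0 < mass w"
    and P: "{\<omega>. P \<omega>} \<in> sets (path_measure C (hist w))"
    and window: "\<And>\<omega> \<omega>'. (\<And>i. i \<le> n \<Longrightarrow> \<omega> i = \<omega>' i) \<Longrightarrow> P \<omega> = P \<omega>'"
  shows "mass w * measure (path_measure C (hist w)) {\<omega>. P \<omega>} =
    (\<Sum>e | e \<in> set (words m n) \<and> P (run w e). mass (e @ w))"
proof -
  interpret prob_space "path_measure C (hist w)" by (rule prob_space_path_measure)
  let ?cyl = "\<lambda>e. {\<omega>. \<forall>i\<le>n. \<omega> i = run w e i}"
  let ?W = "set (words m n)"
  have cyl: "?cyl e \<in> events" for e by (rule cylinder_sets)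
  have len: "length e = n" if "e \<in> ?W" for e using that by (simp add: set_words)
  have prob_cyl: "mass w * prob (?cyl e) = mass (e @ w)" if "e \<in> ?W" for e
  proof -
    have "run w e 0 = hist w" by (simp add: run_def)
    then have "emeasure (path_measure C (hist w)) (?cyl e) =
        ennreal (\<Prod>i<n. pmf (mc_trans C (run w e i)) (run w e (Suc i)))"
      by (simp add: emeasure_path_measure_cylinder)
    then have "prob (?cyl e) = (\<Prod>i<n. pmf (mc_trans C (run w e i)) (run w e (Suc i)))"
      by (simp add: measure_def prod_nonneg)
    with mass_append_prod[of e w] len[OF that] show ?thesis by simp
  qed
  have disj: "disjoint_family_on ?cyl ?W"
  proof (unfold disjoint_family_on_def, intro ballI impI)
    fix e e' assume e: "e \<in> ?W" "e' \<in> ?W" "e \<noteq> e'"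
    \<comment> \<open>The states are whole histories, so coordinate \<open>n\<close> alone separates
      different words.\<close>
    have "run w e n \<noteq> run w e' n" using e(3) len[OF e(1)] len[OF e(2)] by (simp add: run_def)
    then show "?cyl e \<inter> ?cyl e' = {}" by auto
  qed
  have Un: "mass w * prob (\<Union>e\<in>E. ?cyl e) = (\<Sum>e\<in>E. mass (e @ w))" if "E \<subseteq> ?W" for E
  proof -
    have "prob (\<Union>e\<in>E. ?cyl e) = (\<Sum>e\<in>E. prob (?cyl e))"
      using that cyl disjoint_family_on_mono[OF that disj] finite_subset[OF that]
      by (intro finite_measure_finite_Union) auto
    also have "mass w * \<dots> = (\<Sum>e\<in>E. mass (e @ w))"
      using that by (simp add: sum_distrib_left prob_cyl subset_iff)
    finally show ?thesis .
  qed
  let ?E = "{e \<in> ?W. P (run w e)}"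
  have "mass w * prob (\<Union>e\<in>?W. ?cyl e) = mass w"
    using Un[of ?W] sum_mass_words[OF w, of n] by simp
  then have all: "prob (\<Union>e\<in>?W. ?cyl e) = 1" using pos by simp
  have Un_events: "(\<Union>e\<in>E. ?cyl e) \<in> events" if "E \<subseteq> ?W" for E
    using that by (intro sets.finite_UN cyl) (auto intro: finite_subset)
  have "{\<omega>. P \<omega>} \<inter> (\<Union>e\<in>?W. ?cyl e) = (\<Union>e\<in>?E. ?cyl e)"
  proof -
    have "P \<omega> = P (run w e)" if "\<omega> \<in> ?cyl e" for \<omega> e
      using that by (intro window) auto
    then show ?thesis by blast
  qed
  moreover have "prob ({\<omega>. P \<omega>} \<inter> (\<Union>e\<in>?W. ?cyl e)) = prob {\<omega>. P \<omega>}"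
    using all P Un_events[of ?W]
    by (intro measure_space_inter) (simp_all only: prob_space)
  ultimately show ?thesis using Un[of ?E] by simp
qed

lemma fpath_last_run [simp]: "fpath_last (run w e i) = state_at m w e i"
  by (simp add: run_def state_at_def)

lemma sf_sat_prob_free:
  assumes "prob_free_sf \<Phi>" "fpath_last \<rho> \<in> mdp_states M"
  shows "sf_sat C \<rho> \<Phi> \<longleftrightarrow> state_sat m (fpath_last \<rho>) (encode_sf \<Phi>)"
  using assms(1)
\<comment> \<open>Induction on the size avoids a simultaneous induction over path formulae.\<close>
proof (induction "size \<Phi>" arbitrary: \<Phi> rule: less_induct)
  case less
  show ?case
  proof (cases \<Phi>)
    case (Atom p)
    then show ?thesis using label[OF assms(2)] by (simp add: state_sat_simps induced_mc_def del: encode_sf.simps)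
  next
    case (NegAtom p)
    then show ?thesis using label[OF assms(2)] by (simp add: state_sat_simps induced_mc_def del: encode_sf.simps)
  next
    case (Conj \<Psi>\<^sub>1 \<Psi>\<^sub>2)
    then show ?thesis using less(1)[of \<Psi>\<^sub>1] less(1)[of \<Psi>\<^sub>2] less(2) by (simp add: state_sat_simps del: encode_sf.simps)
  next
    case (Disj \<Psi>\<^sub>1 \<Psi>\<^sub>2)
    then show ?thesis using less(1)[of \<Psi>\<^sub>1] less(1)[of \<Psi>\<^sub>2] less(2) by (simp add: state_sat_simps del: encode_sf.simps)
  qed (use less(2) in simp)
qed

lemma pf_sat_run:
  assumes \<phi>: "prob_free_pf \<phi>" "window_pf \<phi>" and w: "set w \<subseteq> L" "set e \<subseteq> L"
  shows "pf_sat C (run w e) \<phi> \<longleftrightarrow> path_sat m (w, e) (encode_pf \<phi>)"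
proof -
  have sat: "sf_sat C (run w e i) \<Phi> \<longleftrightarrow> state_sat m (state_at m w e i) (encode_sf \<Phi>)"
    if "prob_free_sf \<Phi>" for \<Phi> i
    using sf_sat_prob_free[OF that, of "run w e i"] state_at_in[OF w] by simp
  have upt: "set [0..<n] = {..<n}" for n by auto
  show ?thesis
  proof (cases \<phi>)
    case (Next l \<Phi>)
    with \<phi> show ?thesis by (simp add: path_sat_def sat del: list_encode.simps)
  next
    case (Until \<Phi> l \<Psi>)
    with \<phi> obtain k where k: "l = enat k" by (cases l) auto
    have h: "horizon (encode_pf (Until \<Phi> (enat k) \<Psi>)) = k" by (rule horizon_simps)
    show ?thesis using \<phi> unfolding Until k path_sat_def h upt
      by (simp add: sat Bex_def Ball_def less_Suc_eq_le del: list_encode.simps)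
  next
    case (WeakUntil \<Phi> l \<Psi>)
    with \<phi> obtain k where k: "l = enat k" by (cases l) auto
    have h: "horizon (encode_pf (WeakUntil \<Phi> (enat k) \<Psi>)) = k" by (rule horizon_simps)
    show ?thesis using \<phi> unfolding WeakUntil k path_sat_def h upt
      by (simp add: sat Bex_def Ball_def less_Suc_eq_le del: list_encode.simps)
  qed
qed

lemma pf_sat_window:
  assumes \<phi>: "window_pf \<phi>" and eq: "\<And>i. i \<le> horizon (encode_pf \<phi>) \<Longrightarrow> \<omega> i = \<omega>' i"
  shows "pf_sat C \<omega> \<phi> = pf_sat C \<omega>' \<phi>"
proof (cases \<phi>)
  case (Next l \<Phi>)
  with eq[of l] show ?thesis by (simp del: encode_pf.simps)
next
  case (Until \<Phi> l \<Psi>)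
  with \<phi> obtain k where k: "l = enat k" by (cases l) auto
  have "\<omega> i = \<omega>' i" if "i \<le> k" for i using eq[of i] that by (simp add: Until k del: encode_pf.simps)
  then have agree: "sf_sat C (\<omega> i) X = sf_sat C (\<omega>' i) X" if "i \<le> k" for i X using that by simp
  show ?thesis unfolding Until k pf_sat.simps
    by (intro ex_cong1 conj_cong all_cong1 imp_cong refl agree) auto
next
  case (WeakUntil \<Phi> l \<Psi>)
  with \<phi> obtain k where k: "l = enat k" by (cases l) auto
  have "\<omega> i = \<omega>' i" if "i \<le> k" for i using eq[of i] that by (simp add: WeakUntil k del: encode_pf.simps)
  then have agree: "sf_sat C (\<omega> i) X = sf_sat C (\<omega>' i) X" if "i \<le> k" for i X using that by simp
  show ?thesis unfolding WeakUntil k pf_sat.simps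
    by (intro all_cong1 imp_cong arg_cong2[where f = "(\<or>)"] ex_cong1 conj_cong refl agree) auto
qed

text \<open>Every condition at a position depends on one coordinate in a discrete space, and the
  quantifiers range over countably many positions.\<close>

lemma pf_sat_sets: "{\<omega>. pf_sat C \<omega> \<phi>} \<in> sets (path_measure C \<rho>)"
proof -
  have sat: "Measurable.pred (path_measure C \<rho>) (\<lambda>\<omega>. sf_sat C (\<omega> i) \<Phi>)" for i \<Phi>
    by (rule measurable_compose[OF measurable_coordinate]) simp
  have "Measurable.pred (path_measure C \<rho>) (\<lambda>\<omega>. pf_sat C \<omega> \<phi>)"
  proof (cases \<phi>)
    case (Next l \<Phi>)
    show ?thesis unfolding Next pf_sat.simps by (rule sat)
  next
    case (Until \<Phi> l \<Psi>)
    show ?thesis unfolding Until pf_sat.simps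
      by (intro pred_intros_countable pred_intros_logic(3-5) sat measurable_const) simp_all
  next
    case (WeakUntil \<Phi> l \<Psi>)
    show ?thesis unfolding WeakUntil pf_sat.simps
      by (intro pred_intros_countable pred_intros_logic(3-5) sat measurable_const) simp_all
  qed
  then show ?thesis unfolding pred_def by simp
qed

text \<open>The alternative of mass 0 is compatible with conjunction and disjunction, and for a sum
  the linear form factors as the mass of \<open>w\<close> times the difference of the two sides of
  the constraint. Agreement of \<open>\<mu>\<close> and \<open>mass\<close> is asked only on words
  over the letters, since the system speaks of no others.\<close>

lemma dnf_sat_formula:
  assumes w: "set w \<subseteq> L" and \<mu>: "\<And>w. set w \<subseteq> L \<Longrightarrow> \<mu> w = mass w"
    and \<Phi>: "window_sf \<Phi>" "flat_sf \<Phi>" "nonstrict_sf \<Phi>"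
  shows "dnf_sat \<mu> (formula_dnf m w (encode_sf \<Phi>)) \<longleftrightarrow> mass w = 0 \<or> sf_sat C (hist w) \<Phi>"
  using \<Phi>
proof (induction "size \<Phi>" arbitrary: \<Phi> rule: less_induct)
  case less
  note [simp del] = encode_sf.simps
  have lab: "[last_state m w, p] \<in> set (code_label m) \<longleftrightarrow> p \<in> mc_label C (hist w)" for p
    using label[OF last_state_in[OF w]] by (simp add: induced_mc_def)
  have zero: "dnf_sat \<mu> [[]]" "dnf_sat \<mu> [[[(0, 1, w)]]] \<longleftrightarrow> mass w = 0"
    using mass_nonneg[of w] by (auto simp: dnf_sat_def \<mu>[OF w] )
  show ?case
  proof (cases \<Phi>)
    case (Atom p)
    then show ?thesis using zero by (simp add: formula_dnf_simps lab)
  next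
    case (NegAtom p)
    then show ?thesis using zero by (simp add: formula_dnf_simps lab)
  next
    case (Conj \<Psi>\<^sub>1 \<Psi>\<^sub>2)
    then show ?thesis using less(1)[of \<Psi>\<^sub>1] less(1)[of \<Psi>\<^sub>2] less(2-)
      by (auto simp: formula_dnf_simps dnf_sat_conj)
  next
    case (Disj \<Psi>\<^sub>1 \<Psi>\<^sub>2)
    then show ?thesis using less(1)[of \<Psi>\<^sub>1] less(1)[of \<Psi>\<^sub>2] less(2-)
      by (auto simp: formula_dnf_simps dnf_sat_disj)
  next
    case (PSum cs R c\<^sub>0)
    let ?E = "\<lambda>\<phi>. {e. e \<in> set (words m (horizon (encode_pf \<phi>))) \<and> path_sat m (w, e) (encode_pf \<phi>)}"
    let ?pr = "\<lambda>\<phi>. measure (path_measure C (hist w)) {\<omega>. pf_sat C \<omega> \<phi>}"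
    have R: "R = Ge" using less(4) PSum by simp
    have cs: "(\<Sum>e\<in>?E (snd x). \<mu> (e @ w)) = mass w * ?pr (snd x)" if "x \<in> set cs" for x
    \<comment> \<open>If the mass of \<open>w\<close> is 0, so are the masses of its extensions, and
      both sides vanish whatever the path measure is.\<close>
    proof (cases "mass w = 0")
      case True
      then show ?thesis by (simp add: set_words w \<mu> mass_append_0)
    next
      case False
      then have pos: "0 < mass w" using mass_nonneg[of w] by linarith
      have x: "prob_free_pf (snd x)" "window_pf (snd x)" using that less(2,3) PSum by auto
      have "mass w * ?pr (snd x) = (\<Sum>e | e \<in> set (words m (horizon (encode_pf (snd x)))) \<and>
          pf_sat C (run w e) (snd x). mass (e @ w))"
        by (rule measure_window[OF w pos pf_sat_sets]) (rule pf_sat_window[OF x(2)])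
      also have "\<dots> = (\<Sum>e\<in>?E (snd x). \<mu> (e @ w))"
        using pf_sat_run[OF x w] by (intro sum.cong) (auto simp: set_words \<mu> w)
      finally show ?thesis by simp
    qed
    have "linear_value \<mu> (psum_linear m w (encode_sf \<Phi>)) =
        (\<Sum>x\<leftarrow>cs. of_int (fst x) * (mass w * ?pr (snd x))) - of_int c\<^sub>0 * mass w"
      unfolding PSum linear_value_psum \<mu>[OF w] using cs by (simp cong: map_cong)
    also have "(\<Sum>x\<leftarrow>cs. of_int (fst x) * (mass w * ?pr (snd x))) =
        mass w * (\<Sum>x\<leftarrow>cs. of_int (fst x) * ?pr (snd x))"
      by (simp add: sum_list_const_mult[symmetric] mult_ac)
    finally have "linear_value \<mu> (psum_linear m w (encode_sf \<Phi>)) =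
        mass w * ((\<Sum>x\<leftarrow>cs. of_int (fst x) * ?pr (snd x)) - of_int c\<^sub>0)"
      by (simp add: algebra_simps)
    then show ?thesis
      using mass_nonneg[of w] by (auto simp: PSum R formula_dnf_simps dnf_sat_def zero_le_mult_iff)
  qed
qed

end

section \<open>Correctness of the finite search\<close>

lemma in_stage_iff:
  "d \<in> set (stage m f n) \<longleftrightarrow> (\<exists>w\<in>set (words m n). d = [flow m w] \<or> d = formula_dnf m w f)"
  by (auto simp: stage_def)

lemma table_lookup_map: "table_lookup (map (\<lambda>w. (w, y w)) W) w = (if w \<in> set W then y w else 0)"
  by (induction W) (auto simp: table_lookup_def)

lemma table_lookup_le: "\<forall>p\<in>set \<tau>. snd p \<le> K \<Longrightarrow> table_lookup \<tau> w \<le> K"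
  by (induction \<tau>) (auto simp: table_lookup_def)

lemma tables_Cons:
  "tables K (w # W) = concat (map (\<lambda>\<tau>. map (\<lambda>v. (w, v) # \<tau>) [0..<Suc K]) (tables K W))"
  by (simp add: tables_def)

lemma map_in_tables: "\<forall>w\<in>set W. y w \<le> K \<Longrightarrow> map (\<lambda>w. (w, y w)) W \<in> set (tables K W)"
proof (induction W)
  case (Cons w W)
  then show ?case by (auto simp: tables_Cons image_iff less_Suc_eq_le simp del: upt_Suc)
qed (simp add: tables_def)

lemma in_tables_le: "\<tau> \<in> set (tables K W) \<Longrightarrow> p \<in> set \<tau> \<Longrightarrow> snd p \<le> K"
proof (induction W arbitrary: \<tau>)
  case (Cons w W)
  then show ?case by (auto simp: tables_Cons less_Suc_eq_le simp del: upt_Suc)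
qed (simp add: tables_def)

lemma dnf_relaxed_cong:
  assumes "\<And>c l x. c \<in> set d \<Longrightarrow> l \<in> set c \<Longrightarrow> x \<in> set l \<Longrightarrow> y (snd (snd x)) = y' (snd (snd x))"
  shows "dnf_relaxed y d \<longleftrightarrow> dnf_relaxed y' d"
proof -
  have "relaxed y l \<longleftrightarrow> relaxed y' l" if "c \<in> set d" "l \<in> set c" for c l
    using assms[OF that] by (simp add: relaxed_def cong: map_cong)
  then show ?thesis by (simp add: dnf_relaxed_def)
qed

text \<open>The stages up to \<open>K\<close> mention finitely many words. Outside these a table
  reads 0, which keeps the bound by \<open>K\<close> and changes none of the constraints.\<close>

lemma feasible_iff:
  "feasible m f K \<longleftrightarrow> (\<exists>y. (\<forall>v. y v \<le> K) \<and> y [] = K \<and> (\<forall>n\<le>K. \<forall>d\<in>set (stage m f n). dnf_relaxed y d))"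
proof
  have upt: "set [0..<Suc K] = {..K}" by auto
  let ?W = "[] # concat (map (stage_words m f) [0..<Suc K])"
  {
    assume "feasible m f K"
    then obtain \<tau> where \<tau>: "\<tau> \<in> set (tables K ?W)" "table_lookup \<tau> [] = K"
      "\<And>n d. n \<le> K \<Longrightarrow> d \<in> set (stage m f n) \<Longrightarrow> dnf_relaxed (table_lookup \<tau>) d"
      unfolding feasible_def upt by blast
    have "table_lookup \<tau> v \<le> K" for v
      using in_tables_le[OF \<tau>(1)] by (intro table_lookup_le) blast
    with \<tau> show "\<exists>y. (\<forall>v. y v \<le> K) \<and> y [] = K \<and> (\<forall>n\<le>K. \<forall>d\<in>set (stage m f n). dnf_relaxed y d)"
      by (intro exI[of _ "table_lookup \<tau>"]) blast
  }
  assume "\<exists>y. (\<forall>v. y v \<le> K) \<and> y [] = K \<and> (\<forall>n\<le>K. \<forall>d\<in>set (stage m f n). dnf_relaxed y d)"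
  then obtain y where y: "\<forall>v. y v \<le> K" "y [] = K"
    "\<And>n d. n \<le> K \<Longrightarrow> d \<in> set (stage m f n) \<Longrightarrow> dnf_relaxed y d" by blast
  let ?\<tau> = "map (\<lambda>w. (w, y w)) ?W"
  have "dnf_relaxed (table_lookup ?\<tau>) d" if n: "n \<le> K" and d: "d \<in> set (stage m f n)" for n d
  proof -
    have "snd (snd x) \<in> set ?W" if "c \<in> set d" "l \<in> set c" "x \<in> set l" for c l x
    proof -
      have "snd (snd x) \<in> set (stage_words m f n)"
        unfolding stage_words_def using d that by force
      then show ?thesis using n by (auto simp del: upt_Suc)
    qed
    then have "dnf_relaxed (table_lookup ?\<tau>) d \<longleftrightarrow> dnf_relaxed y d"
      unfolding table_lookup_map by (intro dnf_relaxed_cong) presburger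
    with y(3)[OF n d] show ?thesis by simp
  qed
  moreover have "table_lookup ?\<tau> [] = K" unfolding table_lookup_map using y(2) by simp
  moreover have "?\<tau> \<in> set (tables K ?W)" using y(1) by (intro map_in_tables) blast
  ultimately show "feasible m f K" unfolding feasible_def upt by blast
qed

section \<open>From strategies to masses and back\<close>

context encoded_mdp
begin

lemma masses_of_strategy:
  assumes \<Phi>: "window_sf \<Phi>" "flat_sf \<Phi>" "nonstrict_sf \<Phi>"
    and \<sigma>: "strategy M \<sigma>" "mc_models (induced_mc M \<sigma>) (AG \<Phi>)"
  obtains \<mu> where "\<forall>w. 0 \<le> \<mu> w \<and> \<mu> w \<le> 1" "\<mu> [] = 1"
    "\<forall>n. \<forall>d\<in>set (stage m (encode_sf \<Phi>) n). dnf_sat \<mu> d"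
proof -
  interpret encoded_strategy m M \<sigma> by standard (rule \<sigma>(1))
  have sat: "mass w = 0 \<or> sf_sat C (hist w) \<Phi>" for w
  proof (cases "mass w = 0")
    case False
    then have "0 < mass w" using mass_nonneg[of w] by linarith
    then have "mc_reachable C (mc_init C) (hist w)" using reachable_iff by blast
    then show ?thesis using \<sigma>(2) by (simp add: mc_models_def)
  qed simp
  have "dnf_sat mass d" if "d \<in> set (stage m (encode_sf \<Phi>) n)" for n d
  proof -
    from that obtain w where w: "set w \<subseteq> L" and d: "d = [flow m w] \<or> d = formula_dnf m w (encode_sf \<Phi>)"
      by (auto simp: in_stage_iff set_words)
    have "dnf_sat mass [flow m w]"
      unfolding dnf_sat_flow[OF w] using mass_flow[OF w] mass_flow_action[OF w]
      by (simp add: mass.simps(2))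
    moreover have "dnf_sat mass (formula_dnf m w (encode_sf \<Phi>))"
      using dnf_sat_formula[OF w refl \<Phi>] sat by blast
    ultimately show ?thesis using d by blast
  qed
  then show ?thesis using mass_le_1 by (intro that[of mass]) auto
qed

text \<open>After \<open>w\<close> the strategy plays \<open>a\<close> with the share of the mass of
  \<open>w\<close> that flows into the successors under \<open>a\<close>; where there is no mass it
  plays a fixed action. The flow equations then identify \<open>\<mu>\<close> with the masses of
  this strategy on all words over the letters.\<close>

lemma strategy_of_masses:
  assumes \<Phi>: "window_sf \<Phi>" "flat_sf \<Phi>" "nonstrict_sf \<Phi>"
    and \<mu>: "\<And>w. 0 \<le> \<mu> w" "\<mu> [] = 1"
    and sat: "\<And>n d. d \<in> set (stage m (encode_sf \<Phi>) n) \<Longrightarrow> dnf_sat \<mu> d"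
  obtains \<sigma> where "strategy M \<sigma>" "mc_models (induced_mc M \<sigma>) (AG \<Phi>)"
proof -
  let ?x = "\<lambda>w a. \<Sum>t\<in>mdp_states M. \<mu> ((a, t) # w)"
  have in_stage: "[flow m w] \<in> set (stage m (encode_sf \<Phi>) (length w))"
    "formula_dnf m w (encode_sf \<Phi>) \<in> set (stage m (encode_sf \<Phi>) (length w))" if "set w \<subseteq> L" for w
    using that by (auto simp: in_stage_iff set_words)
  have flow: "(\<Sum>z\<in>L. \<mu> (z # w)) = \<mu> w"
    "\<And>a t. a \<in> mdp_actions M \<Longrightarrow> t \<in> mdp_states M \<Longrightarrow>
      \<mu> ((a, t) # w) = pmf (mdp_trans M (last_state m w) a) t * ?x w a" if "set w \<subseteq> L" for w
    using sat[OF in_stage(1)[OF that]] unfolding dnf_sat_flow[OF that] by blast+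
  have flow': "(\<Sum>a\<in>mdp_actions M. ?x w a) = \<mu> w" if "set w \<subseteq> L" for w
    using flow(1)[OF that] by (simp add: L_eq sum.cartesian_product case_prod_unfold)
  \<comment> \<open>The unit mass of the empty word has to flow into some successor.\<close>
  have "mdp_actions M \<noteq> {}" using flow'[of "[]"] \<mu>(2) by auto
  then obtain a\<^sub>0 where a\<^sub>0: "a\<^sub>0 \<in> mdp_actions M" by blast
  have "\<forall>w. \<exists>p. if set w \<subseteq> L \<and> 0 < \<mu> w then \<forall>a. pmf p a = (if a \<in> mdp_actions M then ?x w a / \<mu> w else 0)
      else p = return_pmf a\<^sub>0"
  proof
    fix w
    show "\<exists>p. if set w \<subseteq> L \<and> 0 < \<mu> w then \<forall>a. pmf p a = (if a \<in> mdp_actions M then ?x w a / \<mu> w else 0)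
      else p = return_pmf a\<^sub>0"
    proof (cases "set w \<subseteq> L \<and> 0 < \<mu> w")
      case True
      then have sum: "(\<Sum>a\<in>mdp_actions M. ?x w a / \<mu> w) = 1"
        using flow'[of w] by (simp flip: sum_divide_distrib)
      have nonneg: "0 \<le> ?x w a / \<mu> w" for a
        using \<mu>(1) by (intro divide_nonneg_nonneg sum_nonneg)
      from pmf_with_finite_support[OF finite_actions nonneg sum] show ?thesis
        unfolding if_P[OF True] .
    next
      case False
      show ?thesis unfolding if_not_P[OF False] by blast
    qed
  qed
  from choice[OF this] obtain p where p: "\<forall>w. if set w \<subseteq> L \<and> 0 < \<mu> w
      then \<forall>a. pmf (p w) a = (if a \<in> mdp_actions M then ?x w a / \<mu> w else 0) else p w = return_pmf a\<^sub>0" ..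
  \<comment> \<open>Reading a path through its word ignores the start state, which is harmless since
    only paths from the initial state are reached.\<close>
  define \<sigma> where "\<sigma> \<rho> = p (word_of \<rho>)" for \<rho>
  have "set_pmf (p w) \<subseteq> mdp_actions M" for w
  proof (cases "set w \<subseteq> L \<and> 0 < \<mu> w")
    case True
    then have "pmf (p w) a = (if a \<in> mdp_actions M then ?x w a / \<mu> w else 0)" for a
      using p[THEN spec, of w] by meson
    then show ?thesis by (metis set_pmf_iff subsetI)
  next
    case False
    then show ?thesis using p[THEN spec, of w] a\<^sub>0 by simp
  qed
  then have \<sigma>: "strategy M \<sigma>" by (simp add: strategy_def \<sigma>_def)
  interpret encoded_strategy m M \<sigma> by standard (rule \<sigma>)
  have mass: "\<mu> w = mass w" if "set w \<subseteq> L" for w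
    using that
  proof (induction w)
    case Nil
    then show ?case by (simp add: \<mu>(2))
  next
    case (Cons z w)
    then have w: "set w \<subseteq> L" and z: "fst z \<in> mdp_actions M" "snd z \<in> mdp_states M"
      and IH: "\<mu> w = mass w" by (auto simp: L_eq)
    show ?case
    proof (cases "\<mu> w = 0")
      case True
      \<comment> \<open>The successor masses are nonnegative and sum to the mass of
        \<open>w\<close>, which is 0, so each of them is 0.\<close>
      have "\<mu> (z # w) \<le> (\<Sum>z\<in>L. \<mu> (z # w))"
        using Cons.prems \<mu>(1) by (intro member_le_sum) auto
      then show ?thesis using flow(1)[OF w] True \<mu>(1)[of "z # w"] IH by (simp add: mass.simps(2))
    next
      case False
      then have "0 < \<mu> w" using \<mu>(1)[of w] by simp
      then have "pmf (\<sigma> (hist w)) (fst z) = ?x w (fst z) / \<mu> w"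
        using p[THEN spec, of w] w z by (simp add: \<sigma>_def)
      then show ?thesis
        using flow(2)[OF w z] False by (simp add: mass.simps(2) flip: IH)
    qed
  qed
  have "sf_sat C (hist w) \<Phi>" if "0 < mass w" for w
  proof -
    have w: "set w \<subseteq> L" using path_in_finite_paths[OF that] ..
    have "dnf_sat \<mu> (formula_dnf m w (encode_sf \<Phi>)) \<longleftrightarrow> mass w = 0 \<or> sf_sat C (hist w) \<Phi>"
      by (rule dnf_sat_formula[OF w _ \<Phi>]) (rule mass)
    with sat[OF in_stage(2)[OF w]] that show ?thesis by simp
  qed
  then have "mc_models C (AG \<Phi>)"
    by (auto simp only: mc_models_def gf_sat.simps reachable_iff)
  with \<sigma> show ?thesis by (rule that)
qed

theorem strategy_iff_feasible:
  assumes \<Phi>: "window_sf \<Phi>" "flat_sf \<Phi>" "nonstrict_sf \<Phi>"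
  shows "(\<exists>\<sigma>. strategy M \<sigma> \<and> mc_models (induced_mc M \<sigma>) (AG \<Phi>)) \<longleftrightarrow> (\<forall>K. feasible m (encode_sf \<Phi>) K)"
proof -
  have "(\<exists>\<sigma>. strategy M \<sigma> \<and> mc_models (induced_mc M \<sigma>) (AG \<Phi>)) \<longleftrightarrow>
    (\<exists>\<mu>. (\<forall>w. 0 \<le> \<mu> w \<and> \<mu> w \<le> 1) \<and> \<mu> [] = 1 \<and>
      (\<forall>n. \<forall>d\<in>set (stage m (encode_sf \<Phi>) n). dnf_sat \<mu> d))"
    (is "?L \<longleftrightarrow> ?R")
  proof
    assume ?L
    then obtain \<sigma> where "strategy M \<sigma>" "mc_models (induced_mc M \<sigma>) (AG \<Phi>)" by blast
    then show ?R by (rule masses_of_strategy[OF \<Phi>]) blast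
  next
    assume ?R
    then obtain \<mu> where "\<And>w. 0 \<le> \<mu> w" "\<mu> [] = 1"
      "\<And>n d. d \<in> set (stage m (encode_sf \<Phi>) n) \<Longrightarrow> dnf_sat \<mu> d" by blast
    then obtain \<sigma> where "strategy M \<sigma>" "mc_models (induced_mc M \<sigma>) (AG \<Phi>)"
      by (rule strategy_of_masses[OF \<Phi>])
    then show ?L by blast
  qed
  then show ?thesis unfolding satisfiable_iff_relaxed feasible_iff .
qed

end

section \<open>Valid codes\<close>

lemma field_less: "i < length (list_decode n) \<Longrightarrow> field n i < n"
  using less_list_encode[of "list_decode n ! i" "list_decode n"] by (simp add: field_def nth_default_def)

lemma list_decode_eqD: "list_decode n = l \<Longrightarrow> n = list_encode l"
  by auto

lemma valid_state_formula_unfold: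
  "valid_state_formula m n \<longleftrightarrow>
    (if field n 0 < 2 then length (list_decode n) = 2 \<and> field n 1 \<in> set (code_ap m)
     else field n 0 < 4 \<and> length (list_decode n) = 3 \<and>
       valid_state_formula m (field n 1) \<and> valid_state_formula m (field n 2))"
  unfolding valid_state_formula_def
  by (subst course_rec.simps) (auto simp: nth_default_course_rec field_less)

lemma valid_formula_unfold:
  "valid_formula m n \<longleftrightarrow>
    (if field n 0 < 2 then length (list_decode n) = 2 \<and> field n 1 \<in> set (code_ap m)
     else if field n 0 < 4 then length (list_decode n) = 3 \<and>
       valid_formula m (field n 1) \<and> valid_formula m (field n 2)
     else field n 0 = 4 \<and> length (list_decode n) = 4 \<and> list_decode (field n 1) \<noteq> [] \<and> field n 2 = 0 \<and>
       (\<forall>z\<in>set (list_decode (field n 1)). valid_path_formula m (snd (prod_decode z))))"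
  unfolding valid_formula_def
  by (subst course_rec.simps) (auto simp: nth_default_course_rec field_less)

lemma code_cases:
  assumes "length (list_decode n) = k"
  shows "k = 2 \<Longrightarrow> n = list_encode [field n 0, field n 1]"
    and "k = 3 \<Longrightarrow> n = list_encode [field n 0, field n 1, field n 2]"
    and "k = 4 \<Longrightarrow> n = list_encode [field n 0, field n 1, field n 2, field n 3]"
    and "k = 6 \<Longrightarrow> n = list_encode [field n 0, field n 1, field n 2, field n 3, field n 4, field n 5]"
  using assms by (auto simp: field_def numeral_eq_Suc length_Suc_conv dest!: list_decode_eqD
      simp del: list_encode.simps)

lemma valid_state_formula_encode:
  "prob_free_sf \<Phi> \<Longrightarrow> valid_state_formula m (encode_sf \<Phi>) \<longleftrightarrow> sf_atoms \<Phi> \<subseteq> set (code_ap m)"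
proof (induction "size \<Phi>" arbitrary: \<Phi> rule: less_induct)
  case less
  show ?case
  proof (cases \<Phi>)
    case (Conj \<Psi>\<^sub>1 \<Psi>\<^sub>2)
    then show ?thesis using less(1)[of \<Psi>\<^sub>1] less(1)[of \<Psi>\<^sub>2] less(2)
      by (subst valid_state_formula_unfold) (simp del: list_encode.simps)
  next
    case (Disj \<Psi>\<^sub>1 \<Psi>\<^sub>2)
    then show ?thesis using less(1)[of \<Psi>\<^sub>1] less(1)[of \<Psi>\<^sub>2] less(2)
      by (subst valid_state_formula_unfold) (simp del: list_encode.simps)
  qed (use less(2) in \<open>subst valid_state_formula_unfold, simp del: list_encode.simps\<close>)+
qed

text \<open>The fields holding the parts are smaller than the code, so the formula is rebuilt by
  induction on the code.\<close>

lemma valid_state_formula_decode: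
  "valid_state_formula m n \<Longrightarrow> \<exists>\<Phi>. n = encode_sf \<Phi> \<and> prob_free_sf \<Phi>"
proof (induction n rule: less_induct)
  case (less n)
  note valid = less.prems[unfolded valid_state_formula_unfold[of m n]]
  show ?case
  proof (cases "field n 0 < 2")
    case True
    then have "n = list_encode [field n 0, field n 1]" using valid code_cases(1) by simp
    moreover have "field n 0 = 0 \<or> field n 0 = 1" using True by auto
    ultimately show ?thesis
      by (metis encode_sf.simps(1,2) prob_free_sf.simps(1,2))
  next
    case False
    with valid have v: "field n 0 < 4" "length (list_decode n) = 3"
      "valid_state_formula m (field n 1)" "valid_state_formula m (field n 2)" by auto
    have n: "n = list_encode [field n 0, field n 1, field n 2]" using v(2) code_cases(2) by simp
    from less.IH[OF field_less v(3)] less.IH[OF field_less v(4)] v(2)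
    obtain \<Phi> \<Psi> where "field n 1 = encode_sf \<Phi>" "prob_free_sf \<Phi>" "field n 2 = encode_sf \<Psi>" "prob_free_sf \<Psi>"
      by auto
    moreover have "field n 0 = 2 \<or> field n 0 = 3" using v(1) False by auto
    ultimately show ?thesis
      using n by (metis encode_sf.simps(3,4) prob_free_sf.simps(3,4))
  qed
qed

lemma valid_path_formula_encode:
  assumes "prob_free_pf \<phi>" "window_pf \<phi>"
  shows "valid_path_formula m (encode_pf \<phi>) \<longleftrightarrow> pf_atoms \<phi> \<subseteq> set (code_ap m)"
  using assms by (cases \<phi>) (auto simp: valid_path_formula_def valid_state_formula_encode
      simp del: list_encode.simps split: enat.split)

lemma prob_free_imp:
  "prob_free_sf \<Phi> \<Longrightarrow> window_sf \<Phi> \<and> nonstrict_sf \<Phi> \<and> sums_nonempty_sf \<Phi>"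
proof (induction "size \<Phi>" arbitrary: \<Phi> rule: less_induct)
  case less
  show ?case
  proof (cases \<Phi>)
    case (Conj \<Psi>\<^sub>1 \<Psi>\<^sub>2)
    then show ?thesis using less(1)[of \<Psi>\<^sub>1] less(1)[of \<Psi>\<^sub>2] less(2) by simp
  next
    case (Disj \<Psi>\<^sub>1 \<Psi>\<^sub>2)
    then show ?thesis using less(1)[of \<Psi>\<^sub>1] less(1)[of \<Psi>\<^sub>2] less(2) by simp
  qed (use less(2) in auto)
qed

lemma valid_path_formula_decode:
  assumes "valid_path_formula m n"
  shows "\<exists>\<phi>. n = encode_pf \<phi> \<and> prob_free_pf \<phi> \<and> window_pf \<phi>"
proof (cases "field n 0 = 0")
  case True
  with assms have v: "length (list_decode n) = 3" "valid_state_formula m (field n 2)"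
    by (auto simp: valid_path_formula_def)
  from valid_state_formula_decode[OF v(2)] obtain \<Phi> where \<Phi>: "field n 2 = encode_sf \<Phi>" "prob_free_sf \<Phi>"
    by blast
  have "n = encode_pf (Next (field n 1) \<Phi>)"
    using code_cases(2)[OF v(1) refl] unfolding True \<Phi> encode_pf.simps .
  moreover have "prob_free_pf (Next l \<Phi>)" "window_pf (Next l \<Phi>)" for l
    using \<Phi>(2) by (auto simp: prob_free_imp)
  ultimately show ?thesis by blast
next
  case False
  with assms have v: "field n 0 < 3" "length (list_decode n) = 4" "0 < field n 2"
    "valid_state_formula m (field n 1)" "valid_state_formula m (field n 3)"
    by (auto simp: valid_path_formula_def)
  from valid_state_formula_decode[OF v(4)] valid_state_formula_decode[OF v(5)] obtain \<Phi> \<Psi> where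
    \<Phi>: "field n 1 = encode_sf \<Phi>" "prob_free_sf \<Phi>" and \<Psi>: "field n 3 = encode_sf \<Psi>" "prob_free_sf \<Psi>"
    by blast
  obtain k where k: "field n 2 = Suc k" using v(3) gr0_implies_Suc by blast
  have "field n 0 = 1 \<or> field n 0 = 2" using v(1) False by auto
  then have "n = encode_pf (Until \<Phi> (enat k) \<Psi>) \<or> n = encode_pf (WeakUntil \<Phi> (enat k) \<Psi>)"
    using code_cases(3)[OF v(2) refl] unfolding \<Phi> \<Psi> k encode_pf.simps enat.case by metis
  moreover have "prob_free_pf (Until \<Phi> (enat k) \<Psi>)" "window_pf (Until \<Phi> (enat k) \<Psi>)"
    "prob_free_pf (WeakUntil \<Phi> (enat k) \<Psi>)" "window_pf (WeakUntil \<Phi> (enat k) \<Psi>)"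
    using \<Phi>(2) \<Psi>(2) by (auto simp: prob_free_imp)
  ultimately show ?thesis by blast
qed

lemma prob_free_pf_imp: "prob_free_pf \<phi> \<Longrightarrow> nonstrict_pf \<phi> \<and> sums_nonempty_pf \<phi>"
  by (cases \<phi>) (auto simp: prob_free_imp)

text \<open>For a formula in the fragment the choice of atoms is the only thing left to
  check.\<close>

lemma valid_formula_encode:
  assumes "window_sf \<Phi>" "flat_sf \<Phi>" "nonstrict_sf \<Phi>" "sums_nonempty_sf \<Phi>"
  shows "valid_formula m (encode_sf \<Phi>) \<longleftrightarrow> sf_atoms \<Phi> \<subseteq> set (code_ap m)"
  using assms
proof (induction "size \<Phi>" arbitrary: \<Phi> rule: less_induct)
  case less
  show ?case
  proof (cases \<Phi>)
    case (Conj \<Psi>\<^sub>1 \<Psi>\<^sub>2)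
    then show ?thesis using less(1)[of \<Psi>\<^sub>1] less(1)[of \<Psi>\<^sub>2] less(2-)
      by (subst valid_formula_unfold) (simp del: list_encode.simps)
  next
    case (Disj \<Psi>\<^sub>1 \<Psi>\<^sub>2)
    then show ?thesis using less(1)[of \<Psi>\<^sub>1] less(1)[of \<Psi>\<^sub>2] less(2-)
      by (subst valid_formula_unfold) (simp del: list_encode.simps)
  next
    case (PSum cs R c\<^sub>0)
    have "valid_path_formula m (encode_pf (snd x)) \<longleftrightarrow> pf_atoms (snd x) \<subseteq> set (code_ap m)" if "x \<in> set cs" for x
      using less(2,3) that by (intro valid_path_formula_encode) (auto simp: PSum)
    then show ?thesis using less(2-) PSum
      by (subst valid_formula_unfold) (fastforce simp del: list_encode.simps)
  qed (subst valid_formula_unfold, simp del: list_encode.simps)+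
qed

text \<open>The atoms are left out here; they are recovered from \<open>valid_formula_encode\<close>
  once a formula is at hand.\<close>

lemma valid_formula_decode:
  "valid_formula m n \<Longrightarrow> \<exists>\<Phi>. n = encode_sf \<Phi> \<and> window_sf \<Phi> \<and> flat_sf \<Phi> \<and> nonstrict_sf \<Phi> \<and> sums_nonempty_sf \<Phi>"
proof (induction n rule: less_induct)
  case (less n)
  note valid = less.prems[unfolded valid_formula_unfold[of m n]]
  consider "field n 0 < 2" | "field n 0 = 2 \<or> field n 0 = 3" | "field n 0 \<ge> 4" by linarith
  then show ?case
  proof cases
    case 1
    then have "n = list_encode [field n 0, field n 1]" using valid code_cases(1) by simp
    moreover have "field n 0 = 0 \<or> field n 0 = 1" using 1 by auto
    ultimately have "n = encode_sf (Atom (field n 1)) \<or> n = encode_sf (NegAtom (field n 1))"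
      by (metis encode_sf.simps(1,2))
    then show ?thesis
      by (elim disjE) (rule exI, rule conjI, assumption, simp)+
  next
    case 2
    with valid have v: "length (list_decode n) = 3"
      "valid_formula m (field n 1)" "valid_formula m (field n 2)" by auto
    have n: "n = list_encode [field n 0, field n 1, field n 2]" using v(1) code_cases(2) by simp
    from less.IH[OF field_less v(2)] less.IH[OF field_less v(3)] v(1)
    obtain \<Phi> \<Psi> where \<Phi>: "field n 1 = encode_sf \<Phi>" "window_sf \<Phi>" "flat_sf \<Phi>" "nonstrict_sf \<Phi>" "sums_nonempty_sf \<Phi>"
      and \<Psi>: "field n 2 = encode_sf \<Psi>" "window_sf \<Psi>" "flat_sf \<Psi>" "nonstrict_sf \<Psi>" "sums_nonempty_sf \<Psi>"
      by auto
    have "n = encode_sf (Conj \<Phi> \<Psi>) \<or> n = encode_sf (Disj \<Phi> \<Psi>)"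
      using n 2 \<Phi>(1) \<Psi>(1) by (metis encode_sf.simps(3,4))
    then show ?thesis
      by (elim disjE) (rule exI, rule conjI, assumption, simp add: \<Phi> \<Psi>)+
  next
    case 3
    with valid have v: "field n 0 = 4" "length (list_decode n) = 4" "list_decode (field n 1) \<noteq> []" "field n 2 = 0"
      "\<And>z. z \<in> set (list_decode (field n 1)) \<Longrightarrow> valid_path_formula m (snd (prod_decode z))" by auto
    have n: "n = list_encode [4, field n 1, 0, field n 3]" using code_cases(3)[OF v(2) refl] unfolding v(1,4) .
    from valid_path_formula_decode[OF v(5)] obtain g where
      g: "\<And>z. z \<in> set (list_decode (field n 1)) \<Longrightarrow>
        snd (prod_decode z) = encode_pf (g z) \<and> prob_free_pf (g z) \<and> window_pf (g z)" by metis
    let ?cs = "map (\<lambda>z. (int_decode (fst (prod_decode z)), g z)) (list_decode (field n 1))"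
    have "map (\<lambda>x. prod_encode (int_encode (fst x), encode_pf (snd x))) ?cs = list_decode (field n 1)"
      using g by (auto simp: comp_def intro!: map_idI) (metis prod.collapse prod_decode_inverse)
    then have "n = encode_sf (PSum ?cs Ge (int_decode (field n 3)))"
      by (subst n) (simp del: list_encode.simps map_map)
    moreover have "window_sf (PSum ?cs Ge (int_decode (field n 3)))" "flat_sf (PSum ?cs Ge (int_decode (field n 3)))"
      "nonstrict_sf (PSum ?cs Ge (int_decode (field n 3)))" "sums_nonempty_sf (PSum ?cs Ge (int_decode (field n 3)))"
      using g v(3) by (auto simp: prob_free_pf_imp)
    ultimately show ?thesis by blast
  qed
qed

section \<open>Rational probabilities as reduced fractions\<close>

lemma encode_prob_fraction:
  assumes "0 < d" "coprime k d"
  shows "encode_prob (real k / real d) = prod_encode (k, d)"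
proof -
  have "real k / real d = of_rat (Fract (int k) (int d))"
    using assms(1) by (simp add: of_rat_rat)
  moreover have "the_inv of_rat (of_rat z :: real) = z" for z
    by (rule the_inv_f_f) (simp add: inj_def)
  moreover have "quotient_of (Fract (int k) (int d)) = (int k, int d)"
    using assms by (simp add: quotient_of_Fract normalize_stable)
  ultimately show ?thesis by (simp only: encode_prob_def prod.case nat_int)
qed

lemma nonneg_Rats_fraction:
  assumes "x \<in> \<rat>" "0 \<le> (x :: real)"
  obtains k d where "0 < d" "coprime k d" "x = real k / real d"
proof -
  obtain a b where "b \<noteq> 0" "\<bar>x\<bar> = real a / real b" "coprime a b"
    by (rule Rats_abs_nat_div_natE[OF assms(1)])
  then show ?thesis using assms(2) by (intro that[of b a]) auto
qed

text \<open>The greatest common divisor is itself among the candidates, being at most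
  \<open>d\<close>.\<close>

lemma coprime_iff_bounded:
  assumes "0 < (d :: nat)"
  shows "coprime k d \<longleftrightarrow> (\<forall>i\<in>set [0..<Suc d]. k mod i = 0 \<and> d mod i = 0 \<longrightarrow> i = 1)"
proof -
  have *: "(\<forall>i\<in>set [0..<Suc d]. k mod i = 0 \<and> d mod i = 0 \<longrightarrow> i = 1) \<longleftrightarrow>
      (\<forall>i\<le>d. i dvd k \<longrightarrow> i dvd d \<longrightarrow> i = 1)"
    by (auto simp: less_Suc_eq_le mod_eq_0_iff_dvd simp del: upt_Suc)
  show ?thesis
    unfolding *
  proof
    assume "coprime k d"
    then show "\<forall>i\<le>d. i dvd k \<longrightarrow> i dvd d \<longrightarrow> i = 1"
      using coprime_common_divisor_nat by blast
  next
    assume "\<forall>i\<le>d. i dvd k \<longrightarrow> i dvd d \<longrightarrow> i = 1"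
    moreover have "gcd k d \<le> d" using assms by (intro gcd_le2_nat) simp
    ultimately have "gcd k d = 1" by simp
    then show "coprime k d" by (simp add: coprime_iff_gcd_eq_1)
  qed
qed

text \<open>Each \<open>d t\<close> divides the product of all denominators, so the integer
  divisions are exact and the equation is merely scaled.\<close>

lemma sum_common_denominator:
  fixes k d :: "'a \<Rightarrow> nat"
  assumes "\<forall>t\<in>set ts. 0 < d t"
  shows "(\<Sum>t\<leftarrow>ts. k t * (prod_list (map d ts) div d t)) = prod_list (map d ts) \<longleftrightarrow>
    (\<Sum>t\<leftarrow>ts. real (k t) / real (d t)) = 1"
proof -
  let ?P = "prod_list (map d ts)"
  have P: "0 < ?P" using assms by (induction ts) auto
  have "real (\<Sum>t\<leftarrow>us. k t * (?P div d t)) = real ?P * (\<Sum>t\<leftarrow>us. real (k t) / real (d t))"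
    if "set us \<subseteq> set ts" for us
    using that
  proof (induction us)
    case (Cons u us)
    have "d u dvd ?P" using Cons.prems by (intro prod_list_dvd) simp
    then have "real (?P div d u) = real ?P / real (d u)" by (rule real_of_nat_div)
    with Cons show ?case by (simp add: distrib_left)
  qed simp
  from this[of ts] have "real (\<Sum>t\<leftarrow>ts. k t * (?P div d t)) = real ?P * (\<Sum>t\<leftarrow>ts. real (k t) / real (d t))"
    by simp
  moreover have "(\<Sum>t\<leftarrow>ts. k t * (?P div d t)) = ?P \<longleftrightarrow>
      real (\<Sum>t\<leftarrow>ts. k t * (?P div d t)) = real ?P"
    by (simp only: of_nat_eq_iff)
  ultimately show ?thesis using P by simp
qed

lemma code_prob_eq:
  assumes "[s, a, t, q] \<in> set (code_trans m)" "\<And>q'. [s, a, t, q'] \<in> set (code_trans m) \<Longrightarrow> q' = q"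
  shows "code_prob m s (a, t) = q"
proof -
  let ?F = "filter (\<lambda>e. e = [s, a, t, nth_default 0 e 3]) (code_trans m)"
  have "[s, a, t, q] \<in> set ?F" using assms(1) by simp
  then obtain e es where e: "?F = e # es" by (cases ?F) auto
  then have "e \<in> set ?F" by simp
  then obtain q' where "e \<in> set (code_trans m)" "e = [s, a, t, q']"
    unfolding set_filter by blast
  then have "nth_default 0 e 3 = q" using assms(2)[of q'] by simp
  with e show ?thesis by (simp add: code_prob_def)
qed

section \<open>Codes of decision processes\<close>

lemma set_code_lists:
  "set (code_trans m) = list_decode ` set_decode (field m 3)"
  "set (code_label m) = list_decode ` set_decode (field m 5)"
  by (simp_all add: code_trans_def code_label_def set_bits)

lemma encode_mdp_valid:
  assumes M: "markov_decision_process M"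
  shows "encoded_mdp (encode_mdp M) M" "valid_mdp (encode_mdp M)"
proof -
  let ?m = "encode_mdp M"
  let ?T = "{list_encode [s, a, t, encode_prob (pmf (mdp_trans M s a) t)] | s a t.
        s \<in> mdp_states M \<and> a \<in> mdp_actions M \<and> t \<in> mdp_states M}"
  let ?Lb = "{list_encode [s, p] | s p. s \<in> mdp_states M \<and> p \<in> mdp_label M s}"
  note defs = M[unfolded markov_decision_process_def]
  have "?T = (\<lambda>(s, a, t). list_encode [s, a, t, encode_prob (pmf (mdp_trans M s a) t)]) `
      (mdp_states M \<times> mdp_actions M \<times> mdp_states M)"
    by (auto simp: image_iff list_encode_eq simp del: list_encode.simps)
  then have finT: "finite ?T" using defs by (simp del: list_encode.simps)
  have "?Lb \<subseteq> (\<lambda>(s, p). list_encode [s, p]) ` (mdp_states M \<times> mdp_ap M)"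
    using defs by (fastforce simp: image_iff list_encode_eq simp del: list_encode.simps)
  then have finLb: "finite ?Lb"
    by (rule finite_subset) (use defs in auto)
  have fields: "set (code_states ?m) = mdp_states M" "set (code_actions ?m) = mdp_actions M"
    "code_init ?m = mdp_init M" "set (code_ap ?m) = mdp_ap M"
    "set_decode (field ?m 3) = ?T" "set_decode (field ?m 5) = ?Lb"
    using defs finT finLb
    by (simp_all add: code_states_def code_actions_def code_init_def code_ap_def set_bits encode_mdp_def
        del: list_encode.simps)
  have T: "set (code_trans ?m) = {[s, a, t, encode_prob (pmf (mdp_trans M s a) t)] | s a t.
        s \<in> mdp_states M \<and> a \<in> mdp_actions M \<and> t \<in> mdp_states M}"
    unfolding set_code_lists fields by (force simp del: list_encode.simps)
  have Lb: "set (code_label ?m) = {[s, p] | s p. s \<in> mdp_states M \<and> p \<in> mdp_label M s}"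
    unfolding set_code_lists fields by (force simp del: list_encode.simps)
  have prob: "code_prob ?m s (a, t) = encode_prob (pmf (mdp_trans M s a) t)"
    "0 < code_den ?m s (a, t)" "coprime (code_num ?m s (a, t)) (code_den ?m s (a, t))"
    "pmf (mdp_trans M s a) t = real (code_num ?m s (a, t)) / real (code_den ?m s (a, t))"
    if sat: "s \<in> mdp_states M" "a \<in> mdp_actions M" "t \<in> mdp_states M" for s a t
  proof -
    show c: "code_prob ?m s (a, t) = encode_prob (pmf (mdp_trans M s a) t)"
      by (rule code_prob_eq) (use sat in \<open>auto simp: T\<close>)
    obtain k d where kd: "0 < d" "coprime k d" "pmf (mdp_trans M s a) t = real k / real d"
      using nonneg_Rats_fraction[of "pmf (mdp_trans M s a) t"] defs sat by (metis pmf_nonneg)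
    then have "code_num ?m s (a, t) = k" "code_den ?m s (a, t) = d"
      unfolding code_num_def code_den_def c by (simp_all add: encode_prob_fraction)
    with kd show "0 < code_den ?m s (a, t)" "coprime (code_num ?m s (a, t)) (code_den ?m s (a, t))"
      "pmf (mdp_trans M s a) t = real (code_num ?m s (a, t)) / real (code_den ?m s (a, t))" by auto
  qed
  show enc: "encoded_mdp ?m M"
    by standard (use M fields prob in \<open>auto simp: Lb\<close>)
  have sums: "(\<Sum>t\<leftarrow>code_states ?m. code_num ?m s (a, t) *
       (prod_list (map (\<lambda>t. code_den ?m s (a, t)) (code_states ?m)) div code_den ?m s (a, t))) =
       prod_list (map (\<lambda>t. code_den ?m s (a, t)) (code_states ?m))"
    if sa: "s \<in> mdp_states M" "a \<in> mdp_actions M" for s a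
  proof -
    have "(\<Sum>t\<leftarrow>code_states ?m. real (code_num ?m s (a, t)) / real (code_den ?m s (a, t))) =
        (\<Sum>t\<in>mdp_states M. real (code_num ?m s (a, t)) / real (code_den ?m s (a, t)))"
      by (simp add: sum_list_distinct_conv_sum_set distinct_bits code_states_def fields(1)[unfolded code_states_def])
    also have "\<dots> = (\<Sum>t\<in>mdp_states M. pmf (mdp_trans M s a) t)"
      using prob(4)[OF sa] by simp
    also have "\<dots> = 1" using encoded_mdp.sum_trans[OF enc sa] .
    finally show ?thesis
      using prob(2)[OF sa] by (subst sum_common_denominator) (simp_all add: fields)
  qed
  show "valid_mdp ?m"
    unfolding valid_mdp_def fields
  proof (intro conjI ballI)
    show "length (list_decode ?m) = 6" by (simp add: encode_mdp_def del: list_encode.simps)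
    show "mdp_init M \<in> mdp_states M" using defs by blast
    show "code_ap ?m \<noteq> []" using fields(4) defs by auto
    show "\<exists>s\<in>mdp_states M. \<exists>p\<in>mdp_ap M. e = [s, p]" if "e \<in> set (code_label ?m)" for e
      using that defs unfolding Lb by blast
    show "\<exists>s\<in>mdp_states M. \<exists>a\<in>mdp_actions M. \<exists>t\<in>mdp_states M. e = [s, a, t, code_prob ?m s (a, t)]"
      if "e \<in> set (code_trans ?m)" for e
      using that prob(1) unfolding T by fastforce
    fix s a assume sa: "s \<in> mdp_states M" "a \<in> mdp_actions M"
    show "(\<Sum>t\<leftarrow>code_states ?m. code_num ?m s (a, t) *
       (prod_list (map (\<lambda>t. code_den ?m s (a, t)) (code_states ?m)) div code_den ?m s (a, t))) =
       prod_list (map (\<lambda>t. code_den ?m s (a, t)) (code_states ?m))"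
      by (rule sums[OF sa])
    fix t assume t: "t \<in> mdp_states M"
    show "[s, a, t, code_prob ?m s (a, t)] \<in> set (code_trans ?m)"
      using sa t prob(1)[OF sa t] unfolding T by blast
    show "0 < code_den ?m s (a, t)" by (rule prob(2)[OF sa t])
    show "code_num ?m s (a, t) mod i = 0 \<and> code_den ?m s (a, t) mod i = 0 \<longrightarrow> i = 1"
      if "i \<in> set [0..<Suc (code_den ?m s (a, t))]" for i
      by (rule bspec[OF iffD1[OF coprime_iff_bounded[OF prob(2)[OF sa t]] prob(3)[OF sa t]] that])
  qed
qed

text \<open>The process read off the tables has \<open>m\<close> itself as its code: sets are coded
  canonically, fractions are reduced, and the tables contain no entries outside the
  carriers.\<close>

lemma valid_mdp_encode:
  assumes "valid_mdp m"
  shows "\<exists>M. markov_decision_process M \<and> encode_mdp M = m"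
proof -
  note valid = assms[unfolded valid_mdp_def]
  let ?S = "set (code_states m)" and ?A = "set (code_actions m)"
  have T: "set (code_trans m) = {[s, a, t, code_prob m s (a, t)] | s a t. s \<in> ?S \<and> a \<in> ?A \<and> t \<in> ?S}"
    using valid by blast
  have den: "0 < code_den m s (a, t)" "coprime (code_num m s (a, t)) (code_den m s (a, t))"
    if "s \<in> ?S" "a \<in> ?A" "t \<in> ?S" for s a t
    using valid that by (simp_all add: coprime_iff_bounded del: upt_Suc)
  have "\<exists>p. \<forall>t. pmf p t = (if t \<in> ?S then real (code_num m s (a, t)) / real (code_den m s (a, t)) else 0)"
    if sa: "s \<in> ?S" "a \<in> ?A" for s a
  proof (rule pmf_with_finite_support)
    have "(\<Sum>t\<leftarrow>code_states m. real (code_num m s (a, t)) / real (code_den m s (a, t))) = 1"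
      using valid sa den by (subst sum_common_denominator[symmetric]) auto
    then show "(\<Sum>t\<in>?S. real (code_num m s (a, t)) / real (code_den m s (a, t))) = 1"
      by (simp add: sum_list_distinct_conv_sum_set distinct_bits code_states_def)
  qed auto
  then obtain P where P: "\<And>s a t. s \<in> ?S \<Longrightarrow> a \<in> ?A \<Longrightarrow>
      pmf (P s a) t = (if t \<in> ?S then real (code_num m s (a, t)) / real (code_den m s (a, t)) else 0)"
    by metis
  define M where "M = \<lparr>mdp_states = ?S, mdp_actions = ?A, mdp_init = code_init m, mdp_trans = P,
    mdp_ap = set (code_ap m), mdp_label = (\<lambda>s. {p. [s, p] \<in> set (code_label m)})\<rparr>"
  have "set_pmf (P s a) \<subseteq> ?S" if "s \<in> ?S" "a \<in> ?A" for s a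
    using P[OF that] by (auto simp: set_pmf_iff split: if_splits)
  then have mdp: "markov_decision_process M"
    using valid P by (auto simp: markov_decision_process_def M_def simp del: upt_Suc)
  have ep: "encode_prob (pmf (P s a) t) = code_prob m s (a, t)" if "s \<in> ?S" "a \<in> ?A" "t \<in> ?S" for s a t
    using P[OF that(1,2), of t] that(3) encode_prob_fraction[OF den[OF that]]
    by (simp add: code_num_def code_den_def)
  have inj: "list_encode ` list_decode ` X = X" for X by (simp add: image_image)
  have "{list_encode [s, a, t, encode_prob (pmf (P s a) t)] | s a t. s \<in> ?S \<and> a \<in> ?A \<and> t \<in> ?S} =
      list_encode ` set (code_trans m)"
    unfolding T using ep by (force simp del: list_encode.simps)
  also have "\<dots> = set_decode (field m 3)" by (simp add: set_code_lists inj)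
  finally have T': "set_encode {list_encode [s, a, t, encode_prob (pmf (P s a) t)] | s a t.
      s \<in> ?S \<and> a \<in> ?A \<and> t \<in> ?S} = field m 3" by simp
  have Lb: "\<exists>s\<in>?S. \<exists>p. e = [s, p]" if "e \<in> set (code_label m)" for e
    using valid that by blast
  have "{list_encode [s, p] | s p. s \<in> ?S \<and> p \<in> {p. [s, p] \<in> set (code_label m)}} =
      list_encode ` set (code_label m)"
    unfolding image_def mem_Collect_eq using Lb by blast
  also have "\<dots> = set_decode (field m 5)" by (simp add: set_code_lists inj)
  finally have L': "set_encode {list_encode [s, p] | s p. s \<in> ?S \<and> p \<in> {p. [s, p] \<in> set (code_label m)}} =
      field m 5" by simp
  have "set_encode ?S = field m 0" "set_encode ?A = field m 1" "set_encode (set (code_ap m)) = field m 4"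
    by (simp_all add: code_states_def code_actions_def code_ap_def set_bits)
  then have "encode_mdp M = list_encode [field m 0, field m 1, field m 2, field m 3, field m 4, field m 5]"
    unfolding encode_mdp_def M_def using T' L' by (simp add: code_init_def del: list_encode.simps)
  also have "\<dots> = m" using valid code_cases(4)[of m 6] by (simp del: list_encode.simps)
  finally show ?thesis using mdp by blast
qed

theorem theorem24:
  shows "coRE {encode_instance M (AG \<Phi>) | M \<Phi>.
     markov_decision_process M \<and>
     lpctl_sf (mdp_ap M) \<Phi> \<and> window_sf \<Phi> \<and> flat_sf \<Phi> \<and> nonstrict_sf \<Phi> \<and>
     (\<exists>\<sigma>. strategy M \<sigma> \<and> mc_models (induced_mc M \<sigma>) (AG \<Phi>))}"
    (is "coRE ?A")
proof -
  \<comment> \<open>Membership is a conjunction of decidable tests over all \<open>K\<close>: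
    validity makes \<open>x\<close> the code of an instance, and feasibility for every
    \<open>K\<close> yields the strategy.\<close>
  have "x \<in> ?A \<longleftrightarrow> (\<forall>K. accepts x K)" for x
  proof
    assume "x \<in> ?A"
    then obtain M \<Phi> where x: "x = encode_instance M (AG \<Phi>)" and M: "markov_decision_process M"
      and \<Phi>: "lpctl_sf (mdp_ap M) \<Phi>" "window_sf \<Phi>" "flat_sf \<Phi>" "nonstrict_sf \<Phi>"
      and \<sigma>: "\<exists>\<sigma>. strategy M \<sigma> \<and> mc_models (induced_mc M \<sigma>) (AG \<Phi>)"
      by blast
    interpret encoded_mdp "encode_mdp M" M by (rule encode_mdp_valid[OF M])
    show "\<forall>K. accepts x K"
      using \<sigma> \<Phi> encode_mdp_valid(2)[OF M] unfolding strategy_iff_feasible[OF \<Phi>(2-4)]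
      by (simp add: accepts_def x encode_instance_def lpctl_sf_def ap valid_formula_encode)
  next
    assume acc: "\<forall>K. accepts x K"
    then obtain M where M: "markov_decision_process M" "encode_mdp M = fst (prod_decode x)"
      using valid_mdp_encode unfolding accepts_def by blast
    interpret encoded_mdp "fst (prod_decode x)" M using encode_mdp_valid(1)[OF M(1)] M(2) by simp
    obtain \<Phi> where f: "snd (prod_decode x) = encode_sf \<Phi>"
      and \<Phi>: "window_sf \<Phi>" "flat_sf \<Phi>" "nonstrict_sf \<Phi>" "sums_nonempty_sf \<Phi>"
      using acc valid_formula_decode unfolding accepts_def by blast
    have "lpctl_sf (mdp_ap M) \<Phi>"
      using acc \<Phi> by (simp add: accepts_def f valid_formula_encode lpctl_sf_def ap)
    moreover have "\<exists>\<sigma>. strategy M \<sigma> \<and> mc_models (induced_mc M \<sigma>) (AG \<Phi>)"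
      unfolding strategy_iff_feasible[OF \<Phi>(1-3)] using acc unfolding accepts_def f by blast
    moreover have "x = encode_instance M (AG \<Phi>)"
      by (simp add: encode_instance_def M(2) flip: f)
    ultimately show "x \<in> ?A" using M(1) \<Phi> by blast
  qed
  then have "- ?A = {x. \<exists>K. \<not> accepts x K}" by blast
  moreover have "RE {x. \<exists>K. \<not> accepts x K}"
    by (intro RE_Collect_not_all computable_intros)
  ultimately show ?thesis unfolding coRE_def by (simp only:)
qed

end
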